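(* Let $P\subset\mathbb{R}^m$ be a finite set with a finite cover $\mathscr{V}$ having one-dimensional nerve $N_{\mathscr{V}}$, let $0<\epsilon_1<\dots<\epsilon_N<\epsilon_*$ be parameters (with $\epsilon_*$ the constant defined in the context), and let $n\ge 0$. Let $\mathbb{V}$ be the (global) persistence module $$\mathbb{V}: H_n(\mathscr{R}^1)\to H_n(\mathscr{R}^2)\to\cdots\to H_n(\mathscr{R}^N)$$ with maps induced by inclusion, and let $\mathbb{V}_\Psi$ be the (local) persistence module $$\mathbb{V}_{\Psi}: H_0(C_\bullet\mathscr{F}^1_n)\oplus H_1(C_\bullet\mathscr{F}^1_{n-1})\xrightarrow{\Psi^1}\cdots\xrightarrow{\Psi^{N-1}}H_0(C_\bullet\mathscr{F}^N_n)\oplus H_1(C_\bullet\mathscr{F}^N_{n-1}),$$ whose maps $\Psi^i$ are obtained from the inductive construction described in the context (for any choices made in that construction). Then $\mathbb{V}_\Psi$ and $\mathbb{V}$ are isomorphic persistence modules.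
   Context: **Basic setting.** All homology has coefficients in a fixed field $\mathbb{K}$. $P$ is a finite subset of $\mathbb{R}^m$ with Euclidean distance $d$. The Vietoris–Rips complex $\mathscr{R}^{\epsilon}$ of $P$ is the simplicial complex whose simplices are the nonempty subsets of $P$ with all pairwise distances $\le\epsilon$. $\mathscr{V}$ is a finite cover of $P$ by nonempty subsets; its nerve $N_{\mathscr{V}}$ is the simplicial complex whose simplices are the subcollections of $\mathscr{V}$ with nonempty common intersection. It is one-dimensional, so its cells are vertices $v$ and edges $e$; edges are oriented and $[v:e]=\pm1$ is the incidence number of an endpoint $v$ of $e$. For $\sigma\in N_{\mathscr{V}}$, $\mathscr{R}^\epsilon_\sigma$ is the Rips complex with parameter $\epsilon$ on the intersection of the cover elements in $\sigma$. For parameters $\epsilon_1<\dots<\epsilon_N$ write $\mathscr{R}^i=\mathscr{R}^{\epsilon_i}$, $\mathscr{R}^i_\sigma=\mathscr{R}^{\epsilon_i}_\sigma$. Chain and homology groups in negative degree are $0$. A persistence module is a finite sequence of vector spaces and linear maps $V_1\to\dots\to V_N$; an isomorphism is a family of linear isomorphisms $V_i\to W_i$ commuting with the structure maps. **The constant $\epsilon_*$.** (Minimum over the empty set is $\infty$.) Each $p\in P$ lies in one or two elements of $\mathscr{V}$. If $p$ lies in a unique $U\in\mathscr{V}$, put $K_p=\min_{q\in P,\,q\notin U}d(p,q)$. If $p$ lies in two elements $U,W$, put $K'_p=\min_{q\in P,\,q\notin U\cup W}d(p,q)$, $K''_p=\min\{d(q,q') : q,q'\in P,\ d(p,q)<K'_p,\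 q\notin U,\ d(p,q')<K'_p,\ q'\notin W\}$, and $K_p=\min\{K_p',K_p''\}$. Then $\epsilon_*=\min_{p\in P}K_p$. **Cosheaves.** $\mathscr{F}^i_k$ is the cellular cosheaf on $N_{\mathscr{V}}$ with $\mathscr{F}^i_k(\sigma)=H_k(\mathscr{R}^i_\sigma)$ and, for a face $v$ of $e$, the map $\mathscr{F}^i_k(e)\to\mathscr{F}^i_k(v)$ induced by $\mathscr{R}^i_e\hookrightarrow\mathscr{R}^i_v$. Its chain complex $C_\bullet\mathscr{F}^i_k$ is $\partial^i_k:\bigoplus_e H_k(\mathscr{R}^i_e)\to\bigoplus_v H_k(\mathscr{R}^i_v)$ (degrees $1$ and $0$), the sum of the cosheaf maps weighted by $[v:e]$; so $H_1(C_\bullet\mathscr{F}^i_k)=\ker\partial^i_k$ and $H_0(C_\bullet\mathscr{F}^i_k)=\operatorname{coker}\partial^i_k$. The inclusions $\mathscr{R}^i_\sigma\hookrightarrow\mathscr{R}^{i+1}_\sigma$ induce a cosheaf morphism $\phi^i_k:\mathscr{F}^i_k\to\mathscr{F}^{i+1}_k$ and hence maps $H_0(\phi^i_k)$, $H_1(\phi^i_k)$ on cosheaf homology. **Chain-level maps.** $\iota^i_k:\bigoplus_v C_k(\mathscr{R}^i_v)\to\bigoplus_v C_k(\mathscr{R}^{i+1}_v)$ and $\kappa^i_k:\bigoplus_e C_k(\mathscr{R}^i_e)\to\bigoplus_e C_k(\mathscr{R}^{i+1}_e)$ are the inclusions. $e^i_k:\bigoplus_e C_k(\mathscr{R}^i_e)\to\bigoplus_v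 C_k(\mathscr{R}^i_v)$ is given on the summand of $e$ by the sum over endpoints $v$ of $e$ of $[v:e]$ times the inclusion $C_k(\mathscr{R}^i_e)\to C_k(\mathscr{R}^i_v)$. $\partial$ denotes the simplicial boundary. For a cycle $\gamma$ in $\bigoplus_eC_{k}(\mathscr{R}^i_e)$ or $\bigoplus_vC_{k}(\mathscr{R}^i_v)$, $\langle\gamma\rangle$ is its class in $\bigoplus_eH_{k}(\mathscr{R}^i_e)$ or $\bigoplus_vH_{k}(\mathscr{R}^i_v)$, and $\{\langle\gamma\rangle\}$ is the resulting class in cosheaf homology. **Inductive construction.** For $i=1,\dots,N-1$ choose a complement $A^i$: $H_1(C_\bullet\mathscr{F}^i_{n-1})=A^i\oplus\ker H_1(\phi^i_{n-1})$, a basis $\mathscr{B}^i_A$ of $A^i$, a basis $\mathscr{B}^i_{\ker}$ of $\ker H_1(\phi^i_{n-1})$, and set $\mathscr{B}^i=\mathscr{B}^i_A\cup\mathscr{B}^i_{\ker}$. Cycles $b^*\in\bigoplus_eC_{n-1}(\mathscr{R}^i_e)$ representing $\langle b\rangle$ for $\{\langle b\rangle\}\in\mathscr{B}^i$, and a set map $\Gamma^i:\mathscr{B}^i\to\bigoplus_vC_n(\mathscr{R}^i_v)$ with $\partial\Gamma^i\{\langle b\rangle\}=e^i_{n-1}b^*$, are chosen as follows. - $i=1$: choose any representatives $b^*$ and any $\Gamma^1\{\langle b\rangle\}$ with $\partial\Gamma^1\{\langle b\rangle\}=e^1_{n-1}b^*$. - $i>1$: let $\mathscr{B}^{i-1}_A=\{\{\langle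 b_1\rangle\},\dots,\{\langle b_t\rangle\}\}$. The classes $\{\langle\kappa^{i-1}_{n-1}b_s\rangle\}$ are linearly independent in $H_1(C_\bullet\mathscr{F}^i_{n-1})$; let $\mathscr{C}^i_{\mathrm{im}}$ be the set of them and extend it to a basis $\mathscr{C}^i=\mathscr{C}^i_{\mathrm{im}}\cup\mathscr{C}^i_D$ of $H_1(C_\bullet\mathscr{F}^i_{n-1})$. For $\{\langle c\rangle\}=\{\langle\kappa^{i-1}_{n-1}b_s\rangle\}\in\mathscr{C}^i_{\mathrm{im}}$ put $c^*=\kappa^{i-1}_{n-1}b_s^*$ and $\Gamma^i_{\mathscr{C}}\{\langle c\rangle\}=\iota^{i-1}_n\Gamma^{i-1}\{\langle b_s\rangle\}$. For $\{\langle c\rangle\}\in\mathscr{C}^i_D$ choose any representative $c^*$ and any $\Gamma^i_{\mathscr{C}}\{\langle c\rangle\}$ with $\partial\Gamma^i_{\mathscr{C}}\{\langle c\rangle\}=e^i_{n-1}c^*$. For $\{\langle b\rangle\}=\sum_s d_s\{\langle c_s\rangle\}\in\mathscr{B}^i$ (expansion in $\mathscr{C}^i$) put $b^*=\sum_sd_sc_s^*$ and $\Gamma^i\{\langle b\rangle\}=\sum_sd_s\Gamma^i_{\mathscr{C}}\{\langle c_s\rangle\}$. For $\{\langle b\rangle\}\in\mathscr{B}^i_{\ker}$ put $\delta^i\{\langle b\rangle\}=\{\langle -e^{i+1}_n\alpha^{i+1}+\iota^i_n\Gamma^i\{\langle b\rangle\}\rangle\}\in H_0(C_\bullet\mathscr{F}^{i+1}_n)$,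 where $\alpha^{i+1}\in\bigoplus_eC_n(\mathscr{R}^{i+1}_e)$ is any chain with $\partial\alpha^{i+1}=\kappa^i_{n-1}b^*$, and extend linearly to $\ker H_1(\phi^i_{n-1})$. Let $\psi^i:H_1(C_\bullet\mathscr{F}^i_{n-1})\to H_0(C_\bullet\mathscr{F}^{i+1}_n)$ be $\delta^i$ on $\ker H_1(\phi^i_{n-1})$ and $0$ on $A^i$. Finally $$\Psi^i(\{\langle x\rangle\},\{\langle y\rangle\})=\big(H_0(\phi^i_n)\{\langle x\rangle\}+(-1)^{n+1}\psi^i\{\langle y\rangle\},\ H_1(\phi^i_{n-1})\{\langle y\rangle\}\big).$$ *)

theory Defs
  imports "HOL-Analysis.Analysis" "HOL-Algebra.AbelCoset" "Jordan_Normal_Form.VS_Connect"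
begin

section \<open>Quotients and finite direct sums of vector spaces\<close>

text \<open>
  Vector spaces over the field \<^typ>\<open>'k\<close> are records of type \<open>('k, 'v) module\<close> over the ring
  \<^const>\<open>class_ring\<close>; a subspace \<open>W\<close> of \<open>V\<close> is turned into a vector space as
  \<open>V\<lparr>carrier := W\<rparr>\<close>.  The record fields \<open>mult\<close> and \<open>one\<close> have no meaning for modules and are filled
  with arbitrary values, as in \<^const>\<open>direct_sum\<close>.
\<close>

definition quotient_space :: "('k, 'v) module \<Rightarrow> 'v set \<Rightarrow> ('k, 'v set) module" where
  "quotient_space V W =
     \<lparr>carrier = a_rcosets\<^bsub>V\<^esub> W,
      mult = (\<lambda>X Y. W),
      one = W,
      zero = W,
      add = (\<lambda>X Y. X <+>\<^bsub>V\<^esub> Y),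
      smult = (\<lambda>a X. \<Union>x\<in>X. W +>\<^bsub>V\<^esub> (a \<odot>\<^bsub>V\<^esub> x))\<rparr>"

text \<open>
  The map \<open>V/W \<rightarrow> V'/W'\<close> induced by \<open>f\<close>: all the cosets in the union coincide when
  \<open>f ` W \<subseteq> W'\<close>.
\<close>

definition quotient_map :: "('k, 'w) module \<Rightarrow> 'w set \<Rightarrow> ('v \<Rightarrow> 'w) \<Rightarrow> 'v set \<Rightarrow> 'w set" where
  "quotient_map V' W' f X = (\<Union>x\<in>X. W' +>\<^bsub>V'\<^esub> f x)"

definition dsum :: "'i set \<Rightarrow> ('i \<Rightarrow> ('k, 'v) module) \<Rightarrow> ('k, 'i \<Rightarrow> 'v) module" where
  "dsum I V =
     \<lparr>carrier = (\<Pi>\<^sub>E i\<in>I. carrier (V i)),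
      mult = (\<lambda>x y. \<lambda>i\<in>I. \<zero>\<^bsub>V i\<^esub>),
      one = (\<lambda>i\<in>I. \<zero>\<^bsub>V i\<^esub>),
      zero = (\<lambda>i\<in>I. \<zero>\<^bsub>V i\<^esub>),
      add = (\<lambda>x y. \<lambda>i\<in>I. x i \<oplus>\<^bsub>V i\<^esub> y i),
      smult = (\<lambda>a x. \<lambda>i\<in>I. a \<odot>\<^bsub>V i\<^esub> x i)\<rparr>"

definition dsum_map :: "'i set \<Rightarrow> ('i \<Rightarrow> 'v \<Rightarrow> 'w) \<Rightarrow> ('i \<Rightarrow> 'v) \<Rightarrow> 'i \<Rightarrow> 'w" where
  "dsum_map I f x = (\<lambda>i\<in>I. f i (x i))"


section \<open>Persistence modules\<close>

definition persistence_module ::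
    "nat \<Rightarrow> (nat \<Rightarrow> ('k::field, 'v) module) \<Rightarrow> (nat \<Rightarrow> 'v \<Rightarrow> 'v) \<Rightarrow> bool" where
  "persistence_module N V f \<longleftrightarrow>
     (\<forall>i\<in>{1..N}. vectorspace class_ring (V i)) \<and>
     (\<forall>i\<in>{1..<N}. linear_map class_ring (V i) (V (Suc i)) (f i))"

definition isomorphic_persistence_modules ::
    "nat \<Rightarrow> (nat \<Rightarrow> ('k::field, 'v) module) \<Rightarrow> (nat \<Rightarrow> 'v \<Rightarrow> 'v) \<Rightarrow>
     (nat \<Rightarrow> ('k, 'w) module) \<Rightarrow> (nat \<Rightarrow> 'w \<Rightarrow> 'w) \<Rightarrow> bool" where
  "isomorphic_persistence_modules N V f W g \<longleftrightarrow>
     persistence_module N V f \<and> persistence_module N W g \<and>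
     (\<exists>\<Phi>. (\<forall>i\<in>{1..N}. linear_map class_ring (V i) (W i) (\<Phi> i) \<and>
                        bij_betw (\<Phi> i) (carrier (V i)) (carrier (W i))) \<and>
          (\<forall>i\<in>{1..<N}. \<forall>x\<in>carrier (V i). \<Phi> (Suc i) (f i x) = g i (\<Phi> i x)))"


section \<open>Simplicial complexes and their homology\<close>

text \<open>A complex is the set of its (nonempty, finite) simplices; \<open>simplices K k\<close> are those of
  dimension \<open>k\<close>, and there are none for negative \<open>k\<close>.\<close>

definition simplices :: "'a set set \<Rightarrow> int \<Rightarrow> 'a set set" where
  "simplices K k = {\<sigma>\<in>K. int (card \<sigma>) = k + 1}"

definition has_dimension :: "'a set set \<Rightarrow> int \<Rightarrow> bool" where
  "has_dimension K d \<longleftrightarrow> simplices K d \<noteq> {} \<and> (\<forall>k>d. simplices K k = {})"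

definition rips :: "real \<Rightarrow> 'p::metric_space set \<Rightarrow> 'p set set" where
  "rips \<epsilon> P = {\<sigma>. \<sigma> \<subseteq> P \<and> \<sigma> \<noteq> {} \<and> finite \<sigma> \<and> (\<forall>p\<in>\<sigma>. \<forall>q\<in>\<sigma>. dist p q \<le> \<epsilon>)}"

definition nerve :: "'p set set \<Rightarrow> 'p set set set" where
  "nerve \<V> = {\<sigma>. \<sigma> \<subseteq> \<V> \<and> \<sigma> \<noteq> {} \<and> finite \<sigma> \<and> \<Inter>\<sigma> \<noteq> {}}"

definition chains :: "'p set set \<Rightarrow> int \<Rightarrow> ('k::field, 'p set \<Rightarrow> 'k) module" where
  "chains K k =
     \<lparr>carrier = {c. \<forall>\<sigma>. \<sigma> \<notin> simplices K k \<longrightarrow> c \<sigma> = 0},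
      mult = (\<lambda>c d \<sigma>. 0),
      one = (\<lambda>\<sigma>. 0),
      zero = (\<lambda>\<sigma>. 0),
      add = (\<lambda>c d \<sigma>. c \<sigma> + d \<sigma>),
      smult = (\<lambda>a c \<sigma>. a * c \<sigma>)\<rparr>"

text \<open>
  Simplices are oriented by an injective numbering \<open>ord\<close> of the vertices:
  \<open>[v\<^sub>0, \<dots>, v\<^sub>k]\<close> with \<open>ord v\<^sub>0 < \<dots> < ord v\<^sub>k\<close> has boundary
  \<open>\<Sum>i. (-1)^i [v\<^sub>0, \<dots>, v\<^sub>i\<^sub>-\<^sub>1, v\<^sub>i\<^sub>+\<^sub>1, \<dots>, v\<^sub>k]\<close>, and \<open>i\<close> is the number of vertices preceding \<open>v\<^sub>i\<close>.
  The value of a chain at \<open>\<sigma>\<close> is the coefficient of \<open>\<sigma>\<close>.  The test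
  \<open>\<tau> \<in> simplices K (k - 1)\<close> discards the empty face of a vertex, so homology is not reduced.
\<close>

definition boundary :: "('p \<Rightarrow> nat) \<Rightarrow> 'p set set \<Rightarrow> int \<Rightarrow> ('p set \<Rightarrow> 'k::field) \<Rightarrow> 'p set \<Rightarrow> 'k" where
  "boundary ord K k c =
     (\<lambda>\<tau>. if \<tau> \<in> simplices K (k - 1)
          then \<Sum>\<sigma>\<in>simplices K k. \<Sum>v | v \<in> \<sigma> \<and> \<sigma> - {v} = \<tau>.
                 (- 1) ^ card {w\<in>\<sigma>. ord w < ord v} * c \<sigma>
          else 0)"

definition cycles :: "('p \<Rightarrow> nat) \<Rightarrow> 'p set set \<Rightarrow> int \<Rightarrow> ('p set \<Rightarrow> 'k::field) set" where
  "cycles ord K k = a_kernel (chains K k) (chains K (k - 1)) (boundary ord K k)"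

definition boundaries :: "('p \<Rightarrow> nat) \<Rightarrow> 'p set set \<Rightarrow> int \<Rightarrow> ('p set \<Rightarrow> 'k::field) set" where
  "boundaries ord K k = boundary ord K (k + 1) ` carrier (chains K (k + 1))"

definition homology ::
    "('p \<Rightarrow> nat) \<Rightarrow> 'p set set \<Rightarrow> int \<Rightarrow> ('k::field, ('p set \<Rightarrow> 'k) set) module" where
  "homology ord K k =
     quotient_space ((chains K k)\<lparr>carrier := cycles ord K k\<rparr>) (boundaries ord K k)"

definition homology_class ::
    "('p \<Rightarrow> nat) \<Rightarrow> 'p set set \<Rightarrow> int \<Rightarrow> ('p set \<Rightarrow> 'k::field) \<Rightarrow> ('p set \<Rightarrow> 'k) set" where
  "homology_class ord K k c = boundaries ord K k +>\<^bsub>chains K k\<^esub> c"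

text \<open>
  Since chains are extended by zero, \<open>C\<^sub>k(K) \<subseteq> C\<^sub>k(L)\<close> for a subcomplex \<open>K\<close> of \<open>L\<close>, and the
  inclusion of chains is the identity function.  The map \<open>H\<^sub>k(K) \<rightarrow> H\<^sub>k(L)\<close> that it induces
  depends, as a function on cosets, on \<open>L\<close> only.
\<close>

definition homology_map ::
    "('p \<Rightarrow> nat) \<Rightarrow> 'p set set \<Rightarrow> int \<Rightarrow> ('p set \<Rightarrow> 'k::field) set \<Rightarrow> ('p set \<Rightarrow> 'k) set" where
  "homology_map ord L k = quotient_map (chains L k) (boundaries ord L k) (\<lambda>c. c)"


section \<open>The constant \<open>\<epsilon>\<^sub>*\<close>\<close>

text \<open>All infima range over finite sets when \<open>P\<close> is finite; \<open>Inf {} = \<infinity>\<close> in \<^typ>\<open>ereal\<close>.\<close>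

definition K_single :: "'p::metric_space set \<Rightarrow> 'p \<Rightarrow> 'p set \<Rightarrow> ereal" where
  "K_single P p U = (INF q\<in>{q\<in>P. q \<notin> U}. ereal (dist p q))"

definition K_double' :: "'p::metric_space set \<Rightarrow> 'p \<Rightarrow> 'p set \<Rightarrow> 'p set \<Rightarrow> ereal" where
  "K_double' P p U W = (INF q\<in>{q\<in>P. q \<notin> U \<union> W}. ereal (dist p q))"

definition K_double'' :: "'p::metric_space set \<Rightarrow> 'p \<Rightarrow> 'p set \<Rightarrow> 'p set \<Rightarrow> ereal" where
  "K_double'' P p U W =
     Inf {ereal (dist q q') | q q'. q \<in> P \<and> q' \<in> P \<and>
            ereal (dist p q) < K_double' P p U W \<and> q \<notin> U \<and>
            ereal (dist p q') < K_double' P p U W \<and> q' \<notin> W}"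

definition eps_star :: "'p::metric_space set \<Rightarrow> 'p set set \<Rightarrow> ereal" where
  "eps_star P \<V> =
     Inf ({K_single P p U | p U. p \<in> P \<and> {V\<in>\<V>. p \<in> V} = {U}} \<union>
          {min (K_double' P p U W) (K_double'' P p U W) | p U W.
             p \<in> P \<and> U \<noteq> W \<and> {V\<in>\<V>. p \<in> V} = {U, W}})"


section \<open>Cellular cosheaves on a one-dimensional complex\<close>

text \<open>
  Cells are simplices of the base complex \<open>B\<close>; the vertices are the singletons
  \<open>simplices B 0\<close> and the edges the doubletons \<open>simplices B 1\<close>.  \<open>extension F e v\<close> is the map from the
  stalk at the edge \<open>e\<close> to the stalk at its endpoint \<open>v\<close>.
\<close>

record ('c, 'k, 'v) cosheaf =
  stalk :: "'c \<Rightarrow> ('k, 'v) module"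
  extension :: "'c \<Rightarrow> 'c \<Rightarrow> 'v \<Rightarrow> 'v"

text \<open>The edge \<open>e\<close> is oriented towards its element \<open>orient e\<close>; this is \<open>[v:e]\<close> for \<open>v \<subseteq> e\<close>.\<close>

definition incidence :: "('a set \<Rightarrow> 'a) \<Rightarrow> 'a set \<Rightarrow> 'a set \<Rightarrow> 'k::field" where
  "incidence orient v e = (if v = {orient e} then 1 else - 1)"

definition cosheaf_chains ::
    "'a set set \<Rightarrow> ('a set, 'k::field, 'v) cosheaf \<Rightarrow> int \<Rightarrow> ('k, 'a set \<Rightarrow> 'v) module" where
  "cosheaf_chains B F j = dsum (simplices B j) (stalk F)"

definition cosheaf_boundary ::
    "'a set set \<Rightarrow> ('a set \<Rightarrow> 'a) \<Rightarrow> ('a set, 'k::field, 'v) cosheaf \<Rightarrow> ('a set \<Rightarrow> 'v) \<Rightarrow> 'a set \<Rightarrow> 'v" where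
  "cosheaf_boundary B orient F x =
     (\<lambda>v\<in>simplices B 0.
        \<Oplus>\<^bsub>stalk F v\<^esub> e\<in>{e\<in>simplices B 1. v \<subseteq> e}.
          incidence orient v e \<odot>\<^bsub>stalk F v\<^esub> extension F e v (x e))"

definition cosheaf_H1 ::
    "'a set set \<Rightarrow> ('a set \<Rightarrow> 'a) \<Rightarrow> ('a set, 'k::field, 'v) cosheaf \<Rightarrow> ('k, 'a set \<Rightarrow> 'v) module" where
  "cosheaf_H1 B orient F =
     (cosheaf_chains B F 1)\<lparr>carrier :=
        a_kernel (cosheaf_chains B F 1) (cosheaf_chains B F 0) (cosheaf_boundary B orient F)\<rparr>"

definition cosheaf_image ::
    "'a set set \<Rightarrow> ('a set \<Rightarrow> 'a) \<Rightarrow> ('a set, 'k::field, 'v) cosheaf \<Rightarrow> ('a set \<Rightarrow> 'v) set" where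
  "cosheaf_image B orient F = cosheaf_boundary B orient F ` carrier (cosheaf_chains B F 1)"

definition cosheaf_H0 ::
    "'a set set \<Rightarrow> ('a set \<Rightarrow> 'a) \<Rightarrow> ('a set, 'k::field, 'v) cosheaf \<Rightarrow> ('k, ('a set \<Rightarrow> 'v) set) module" where
  "cosheaf_H0 B orient F = quotient_space (cosheaf_chains B F 0) (cosheaf_image B orient F)"

text \<open>For a cosheaf morphism \<open>\<phi>\<close>; as a function on cosets, the map in degree 0 depends on the
  target cosheaf \<open>G\<close> and not on the source.\<close>

definition cosheaf_H1_map ::
    "'a set set \<Rightarrow> ('a set \<Rightarrow> 'v \<Rightarrow> 'w) \<Rightarrow> ('a set \<Rightarrow> 'v) \<Rightarrow> 'a set \<Rightarrow> 'w" where
  "cosheaf_H1_map B \<phi> = dsum_map (simplices B 1) \<phi>"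

definition cosheaf_H0_map ::
    "'a set set \<Rightarrow> ('a set \<Rightarrow> 'a) \<Rightarrow> ('a set, 'k::field, 'w) cosheaf \<Rightarrow> ('a set \<Rightarrow> 'v \<Rightarrow> 'w) \<Rightarrow>
     ('a set \<Rightarrow> 'v) set \<Rightarrow> ('a set \<Rightarrow> 'w) set" where
  "cosheaf_H0_map B orient G \<phi> =
     quotient_map (cosheaf_chains B G 0) (cosheaf_image B orient G) (dsum_map (simplices B 0) \<phi>)"

text \<open>The cosheaves of homology groups and of chain groups of a system \<open>R\<close> of complexes with
  \<open>R e \<subseteq> R v\<close> for \<open>v \<subseteq> e\<close>; all maps are induced by inclusions.\<close>

definition homology_cosheaf ::
    "('p \<Rightarrow> nat) \<Rightarrow> ('c \<Rightarrow> 'p set set) \<Rightarrow> int \<Rightarrow> ('c, 'k::field, ('p set \<Rightarrow> 'k) set) cosheaf" where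
  "homology_cosheaf ord R k =
     \<lparr>stalk = (\<lambda>\<sigma>. homology ord (R \<sigma>) k), extension = (\<lambda>e v. homology_map ord (R v) k)\<rparr>"

definition chain_cosheaf ::
    "('c \<Rightarrow> 'p set set) \<Rightarrow> int \<Rightarrow> ('c, 'k::field, 'p set \<Rightarrow> 'k) cosheaf" where
  "chain_cosheaf R k = \<lparr>stalk = (\<lambda>\<sigma>. chains (R \<sigma>) k), extension = (\<lambda>e v c. c)\<rparr>"


section \<open>The local persistence module of a covered point set\<close>

type_synonym ('p, 'k) chain_family = "'p set set \<Rightarrow> 'p set \<Rightarrow> 'k"
type_synonym ('p, 'k) class_family = "'p set set \<Rightarrow> ('p set \<Rightarrow> 'k) set"

text \<open>No assumptions are made here; the locale only fixes the data that the notions below depend on.\<close>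

locale covered_rips =
  fixes \<V> :: "'p::metric_space set set"
    and ord :: "'p \<Rightarrow> nat"
    and orient :: "'p set set \<Rightarrow> 'p set"
    and \<epsilon> :: "nat \<Rightarrow> real"
    and n :: nat
begin

definition R_local :: "nat \<Rightarrow> 'p set set \<Rightarrow> 'p set set" where
  "R_local i \<sigma> = rips (\<epsilon> i) (\<Inter>\<sigma>)"

definition F :: "nat \<Rightarrow> int \<Rightarrow> ('p set set, 'k::field, ('p set \<Rightarrow> 'k) set) cosheaf" where
  "F i k = homology_cosheaf ord (R_local i) k"

definition \<phi> :: "nat \<Rightarrow> int \<Rightarrow> 'p set set \<Rightarrow> ('p set \<Rightarrow> 'k::field) set \<Rightarrow> ('p set \<Rightarrow> 'k) set" where
  "\<phi> i k \<sigma> = homology_map ord (R_local (Suc i) \<sigma>) k"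

definition H0 :: "nat \<Rightarrow> int \<Rightarrow> ('k::field, ('p, 'k) class_family set) module" where
  "H0 i k = cosheaf_H0 (nerve \<V>) orient (F i k)"

definition H1 :: "nat \<Rightarrow> int \<Rightarrow> ('k::field, ('p, 'k) class_family) module" where
  "H1 i k = cosheaf_H1 (nerve \<V>) orient (F i k)"

definition H0_map ::
    "nat \<Rightarrow> int \<Rightarrow> ('p, 'k::field) class_family set \<Rightarrow> ('p, 'k) class_family set" where
  "H0_map i k = cosheaf_H0_map (nerve \<V>) orient (F (Suc i) k) (\<phi> i k)"

definition H1_map :: "nat \<Rightarrow> int \<Rightarrow> ('p, 'k::field) class_family \<Rightarrow> ('p, 'k) class_family" where
  "H1_map i k = cosheaf_H1_map (nerve \<V>) (\<phi> i k)"

definition ker_H1_map :: "nat \<Rightarrow> ('p, 'k::field) class_family set" where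
  "ker_H1_map i =
     a_kernel (H1 i (int n - 1)) (H1 (Suc i) (int n - 1)) (H1_map i (int n - 1))"

text \<open>\<open>C_fam i j k\<close> is the direct sum of the \<open>k\<close>-chains of the local Rips complexes over the
  cells of the nerve of dimension \<open>j\<close>, that is, over vertices (\<open>j = 0\<close>) or edges (\<open>j = 1\<close>).\<close>

definition C_fam :: "nat \<Rightarrow> int \<Rightarrow> int \<Rightarrow> ('k::field, ('p, 'k) chain_family) module" where
  "C_fam i j k = cosheaf_chains (nerve \<V>) (chain_cosheaf (R_local i) k) j"

definition bd_fam ::
    "nat \<Rightarrow> int \<Rightarrow> int \<Rightarrow> ('p, 'k::field) chain_family \<Rightarrow> ('p, 'k) chain_family" where
  "bd_fam i j k = dsum_map (simplices (nerve \<V>) j) (\<lambda>\<sigma>. boundary ord (R_local i \<sigma>) k)"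

definition \<iota> :: "('p, 'k::field) chain_family \<Rightarrow> ('p, 'k) chain_family" where
  "\<iota> = dsum_map (simplices (nerve \<V>) 0) (\<lambda>\<sigma> c. c)"

definition \<kappa> :: "('p, 'k::field) chain_family \<Rightarrow> ('p, 'k) chain_family" where
  "\<kappa> = dsum_map (simplices (nerve \<V>) 1) (\<lambda>\<sigma> c. c)"

definition e_map :: "nat \<Rightarrow> int \<Rightarrow> ('p, 'k::field) chain_family \<Rightarrow> ('p, 'k) chain_family" where
  "e_map i k = cosheaf_boundary (nerve \<V>) orient (chain_cosheaf (R_local i) k)"

definition class_fam ::
    "nat \<Rightarrow> int \<Rightarrow> int \<Rightarrow> ('p, 'k::field) chain_family \<Rightarrow> ('p, 'k) class_family" where
  "class_fam i j k = dsum_map (simplices (nerve \<V>) j) (\<lambda>\<sigma>. homology_class ord (R_local i \<sigma>) k)"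

text \<open>\<open>x\<close> is a cycle whose class in degree-one cosheaf homology is \<open>b\<close>.  Since this homology is a
  kernel, the class of \<open>x\<close> there is just \<open>class_fam i 1 (n - 1) x\<close>.\<close>

definition represents ::
    "nat \<Rightarrow> ('p, 'k::field) chain_family \<Rightarrow> ('p, 'k) class_family \<Rightarrow> bool" where
  "represents i x b \<longleftrightarrow>
     x \<in> a_kernel (C_fam i 1 (int n - 1)) (C_fam i 1 (int n - 2)) (bd_fam i 1 (int n - 1)) \<and>
     class_fam i 1 (int n - 1) x = b"

text \<open>\<open>\<partial>y = e x\<close> for \<open>y\<close> a family of \<open>n\<close>-chains over the vertices.\<close>

definition lifts :: "nat \<Rightarrow> ('p, 'k::field) chain_family \<Rightarrow> ('p, 'k) chain_family \<Rightarrow> bool" where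
  "lifts i y x \<longleftrightarrow>
     y \<in> carrier (C_fam i 0 (int n)) \<and> bd_fam i 0 (int n) y = e_map i (int n - 1) x"

definition H0_class :: "nat \<Rightarrow> ('p, 'k::field) chain_family \<Rightarrow> ('p, 'k) class_family set" where
  "H0_class i x =
     cosheaf_image (nerve \<V>) orient (F i (int n))
       +>\<^bsub>cosheaf_chains (nerve \<V>) (F i (int n)) 0\<^esub> class_fam i 0 (int n) x"

definition local_space ::
    "nat \<Rightarrow> ('k::field, ('p, 'k) class_family set \<times> ('p, 'k) class_family) module" where
  "local_space i = direct_sum (H0 i (int n)) (H1 i (int n - 1))"

definition \<Psi> ::
    "(nat \<Rightarrow> ('p, 'k::field) class_family \<Rightarrow> ('p, 'k) class_family set) \<Rightarrow> nat \<Rightarrow>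
     ('p, 'k) class_family set \<times> ('p, 'k) class_family \<Rightarrow>
     ('p, 'k) class_family set \<times> ('p, 'k) class_family" where
  "\<Psi> \<psi> i = (\<lambda>(x, y).
     (H0_map i (int n) x \<oplus>\<^bsub>H0 (Suc i) (int n)\<^esub> (((- 1) ^ (n + 1)) \<odot>\<^bsub>H0 (Suc i) (int n)\<^esub> \<psi> i y),
      H1_map i (int n - 1) y))"

definition global_space :: "'p set \<Rightarrow> nat \<Rightarrow> ('k::field, ('p set \<Rightarrow> 'k) set) module" where
  "global_space P i = homology ord (rips (\<epsilon> i) P) (int n)"

definition global_map ::
    "'p set \<Rightarrow> nat \<Rightarrow> ('p set \<Rightarrow> 'k::field) set \<Rightarrow> ('p set \<Rightarrow> 'k) set" where
  "global_map P i = homology_map ord (rips (\<epsilon> (Suc i)) P) (int n)"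

end

text \<open>
  The choices made in the inductive construction.  \<open>rep i b\<close> is the cycle \<open>b\<^sup>*\<close>, and
  \<open>rep_C i c\<close> the cycle \<open>c\<^sup>*\<close>.  \<open>C i\<close> and the data on it are constrained for \<open>i > 1\<close>
  only; the part of \<open>C i\<close> inherited from the previous stage is the image of \<open>B_A (i - 1)\<close>, and
  \<open>C\<^sub>D\<close> is the rest.  The statements about stage \<open>i > 1\<close> are indexed by the previous stage.
  There is no separate \<open>\<delta>\<close>: \<open>\<psi> i\<close> is determined by being linear, its values on \<open>B_ker i\<close>,
  where it is \<open>\<delta>\<close>, and its vanishing on \<open>A i\<close>.
\<close>

locale inductive_construction = covered_rips \<V> ord orient \<epsilon> n
  for \<V> :: "'p::metric_space set set"
    and ord :: "'p \<Rightarrow> nat"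
    and orient :: "'p set set \<Rightarrow> 'p set"
    and \<epsilon> :: "nat \<Rightarrow> real"
    and n :: nat +
  fixes N :: nat
    and A B_A B_ker :: "nat \<Rightarrow> ('p, 'k::field) class_family set"
    and rep :: "nat \<Rightarrow> ('p, 'k) class_family \<Rightarrow> ('p, 'k) chain_family"
    and \<Gamma> :: "nat \<Rightarrow> ('p, 'k) class_family \<Rightarrow> ('p, 'k) chain_family"
    and C :: "nat \<Rightarrow> ('p, 'k) class_family set"
    and rep_C :: "nat \<Rightarrow> ('p, 'k) class_family \<Rightarrow> ('p, 'k) chain_family"
    and \<Gamma>_C :: "nat \<Rightarrow> ('p, 'k) class_family \<Rightarrow> ('p, 'k) chain_family"
    and \<alpha> :: "nat \<Rightarrow> ('p, 'k) class_family \<Rightarrow> ('p, 'k) chain_family"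
    and \<psi> :: "nat \<Rightarrow> ('p, 'k) class_family \<Rightarrow> ('p, 'k) class_family set"
  assumes A_subspace:
      "\<And>i. i \<in> {1..<N} \<Longrightarrow> VectorSpace.subspace class_ring (A i) (H1 i (int n - 1))"
    and A_inter:
      "\<And>i. i \<in> {1..<N} \<Longrightarrow> A i \<inter> ker_H1_map i = {\<zero>\<^bsub>H1 i (int n - 1)\<^esub>}"
    and A_sum:
      "\<And>i. i \<in> {1..<N} \<Longrightarrow>
         A i <+>\<^bsub>H1 i (int n - 1)\<^esub> ker_H1_map i = carrier (H1 i (int n - 1))"
    and basis_A:
      "\<And>i. i \<in> {1..<N} \<Longrightarrow>
         vectorspace.basis class_ring ((H1 i (int n - 1))\<lparr>carrier := A i\<rparr>) (B_A i)"
    and basis_ker: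
      "\<And>i. i \<in> {1..<N} \<Longrightarrow>
         vectorspace.basis class_ring ((H1 i (int n - 1))\<lparr>carrier := ker_H1_map i\<rparr>) (B_ker i)"
    and stage_1:
      "\<And>b. 1 < N \<Longrightarrow> b \<in> B_A 1 \<union> B_ker 1 \<Longrightarrow>
         represents 1 (rep 1 b) b \<and> lifts 1 (\<Gamma> 1 b) (rep 1 b)"
    and C_image:
      "\<And>i. 1 \<le> i \<Longrightarrow> Suc i < N \<Longrightarrow>
         (\<lambda>b. class_fam (Suc i) 1 (int n - 1) (\<kappa> (rep i b))) ` B_A i \<subseteq> C (Suc i)"
    and C_basis:
      "\<And>i. 1 \<le> i \<Longrightarrow> Suc i < N \<Longrightarrow>
         vectorspace.basis class_ring (H1 (Suc i) (int n - 1)) (C (Suc i))"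
    and C_on_image:
      "\<And>i b c. 1 \<le> i \<Longrightarrow> Suc i < N \<Longrightarrow> b \<in> B_A i \<Longrightarrow>
         c = class_fam (Suc i) 1 (int n - 1) (\<kappa> (rep i b)) \<Longrightarrow>
         rep_C (Suc i) c = \<kappa> (rep i b) \<and> \<Gamma>_C (Suc i) c = \<iota> (\<Gamma> i b)"
    and C_off_image:
      "\<And>i c. 1 \<le> i \<Longrightarrow> Suc i < N \<Longrightarrow>
         c \<in> C (Suc i) - (\<lambda>b. class_fam (Suc i) 1 (int n - 1) (\<kappa> (rep i b))) ` B_A i \<Longrightarrow>
         represents (Suc i) (rep_C (Suc i) c) c \<and>
         lifts (Suc i) (\<Gamma>_C (Suc i) c) (rep_C (Suc i) c)"
    and expansion:
      "\<And>i b. 1 \<le> i \<Longrightarrow> Suc i < N \<Longrightarrow> b \<in> B_A (Suc i) \<union> B_ker (Suc i) \<Longrightarrow>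
         \<exists>d. b = (\<Oplus>\<^bsub>H1 (Suc i) (int n - 1)\<^esub> c\<in>C (Suc i). d c \<odot>\<^bsub>H1 (Suc i) (int n - 1)\<^esub> c) \<and>
             rep (Suc i) b =
               (\<Oplus>\<^bsub>C_fam (Suc i) 1 (int n - 1)\<^esub> c\<in>C (Suc i).
                  d c \<odot>\<^bsub>C_fam (Suc i) 1 (int n - 1)\<^esub> rep_C (Suc i) c) \<and>
             \<Gamma> (Suc i) b =
               (\<Oplus>\<^bsub>C_fam (Suc i) 0 (int n)\<^esub> c\<in>C (Suc i).
                  d c \<odot>\<^bsub>C_fam (Suc i) 0 (int n)\<^esub> \<Gamma>_C (Suc i) c)"
    and \<alpha>:
      "\<And>i b. i \<in> {1..<N} \<Longrightarrow> b \<in> B_ker i \<Longrightarrow>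
         \<alpha> (Suc i) b \<in> carrier (C_fam (Suc i) 1 (int n)) \<and>
         bd_fam (Suc i) 1 (int n) (\<alpha> (Suc i) b) = \<kappa> (rep i b)"
    and \<psi>_linear:
      "\<And>i. i \<in> {1..<N} \<Longrightarrow>
         linear_map class_ring (H1 i (int n - 1)) (H0 (Suc i) (int n)) (\<psi> i)"
    and \<psi>_ker:
      "\<And>i b. i \<in> {1..<N} \<Longrightarrow> b \<in> B_ker i \<Longrightarrow>
         \<psi> i b =
           H0_class (Suc i)
             (\<ominus>\<^bsub>C_fam (Suc i) 0 (int n)\<^esub> e_map (Suc i) (int n) (\<alpha> (Suc i) b)
                \<oplus>\<^bsub>C_fam (Suc i) 0 (int n)\<^esub> \<iota> (\<Gamma> i b))"
    and \<psi>_A: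
      "\<And>i a. i \<in> {1..<N} \<Longrightarrow> a \<in> A i \<Longrightarrow> \<psi> i a = \<zero>\<^bsub>H0 (Suc i) (int n)\<^esub>"

end

theory Submission
  imports Defs "HOL-Library.Function_Algebras"
begin

text \<open>
  For \<open>\<epsilon> < \<epsilon>\<^sub>*\<close> every simplex of the Rips complex lies in a cover element, so the chain groups form
  a short exact sequence \<open>0 \<rightarrow> \<Oplus>\<^sub>e C(R\<^sub>e) \<rightarrow> \<Oplus>\<^sub>v C(R\<^sub>v) \<rightarrow> C(R) \<rightarrow> 0\<close>; call its maps \<open>E\<close> and \<open>J\<close>.
  The Mayer-Vietoris argument then shows that \<open>{\<langle>u\<rangle>} \<mapsto> [J u]\<close> embeds \<open>H\<^sub>0\<close> of the cosheaf into
  \<open>H\<^sub>n(R)\<close>, with cokernel \<open>H\<^sub>1\<close>: the connecting homomorphism is the inverse of the linear relation that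
  relates \<open>\<langle>x\<rangle>\<close> to \<open>[J y]\<close> whenever \<open>\<partial>y = E x\<close>.  Hence every linear \<open>\<gamma> : H\<^sub>1 \<rightarrow> H\<^sub>n(R)\<close> whose graph lies in
  this relation gives an isomorphism \<open>(X, y) \<mapsto> J X + (-1)\<^sup>n\<^sup>+\<^sup>1 \<gamma> y\<close> from the local to the global space.

  The inductive construction is what makes these isomorphisms commute with the structure maps: one can
  choose \<open>\<gamma>\<^sub>i\<close> with \<open>\<gamma>\<^sub>i b = [J \<Gamma>\<^sub>i b]\<close> on the basis at stage \<open>i\<close> and, at the same time,
  \<open>\<gamma>\<^sub>i (\<phi> b) = [J \<Gamma>\<^sub>i\<^sub>-\<^sub>1 b]\<close> for \<open>b\<close> in the basis of \<open>A\<^sub>i\<^sub>-\<^sub>1\<close>, because the cycles and the chains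
  \<open>\<Gamma>\<close> at stage \<open>i\<close> extend those of the previous stage.  For \<open>b\<close> in the kernel of \<open>\<phi>\<close>, the class
  \<open>[J \<Gamma>\<^sub>i b]\<close> is the image of \<open>\<psi> b\<close> at stage \<open>i + 1\<close>, since \<open>J E = 0\<close>.
\<close>

section \<open>Linear algebra on vector space records\<close>

text \<open>The fibre of the connecting relation over 0 is the whole image of
  \<open>H\<^sub>0\<close>, so arbitrary splittings at the individual parameters have no reason to
  commute with the structure maps. Each square asks something of both of its ends: the one leaving a
  stage needs the values of \<gamma> on the basis of that stage, the one entering it needs the
  values on the images of the previous \<open>B_A\<close>. A linear selection of a relation can be
  prescribed on a linearly independent family, but the union of these two families is in general not
  independent. The basis \<open>C\<close> resolves this: it is one independent family whose
  prescribed values determine both. Homology is handled through representatives. Families of chains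
  are plain functions, constrained only at the cells, and one boundary operator serves all
  complexes, so that every inclusion acts as the identity on representatives.\<close>

abbreviation vspace :: "('k::field, 'v) module \<Rightarrow> bool" where
  "vspace \<equiv> vectorspace class_ring"

abbreviation subsp :: "'v set \<Rightarrow> ('k::field, 'v) module \<Rightarrow> bool" where
  "subsp \<equiv> VectorSpace.subspace class_ring"

abbreviation linmap :: "('k::field, 'v) module \<Rightarrow> ('k, 'w) module \<Rightarrow> ('v \<Rightarrow> 'w) \<Rightarrow> bool" where
  "linmap \<equiv> linear_map class_ring"

lemma field_class_ring: "field (class_ring :: 'k::field ring)"
  by (rule class_field.field_axioms)

text \<open>The laws are stated with scalars of the type \<open>'k\<close> instead of elements of
  \<open>class_ring\<close>. Negatives are supplied by
  \<open>v \<oplus> (- 1) \<odot> v = (1 + - 1) \<odot> v\<close>, which is why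
  \<open>0 \<odot> x = \<zero>\<close> is among the assumptions.\<close>

lemma vectorspaceI:
  fixes V :: "('k::field, 'v) module" (structure)
  assumes "\<zero> \<in> carrier V"
    and "\<And>x y. x \<in> carrier V \<Longrightarrow> y \<in> carrier V \<Longrightarrow> x \<oplus> y \<in> carrier V"
    and "\<And>a x. x \<in> carrier V \<Longrightarrow> a \<odot> x \<in> carrier V"
    and "\<And>x y. x \<in> carrier V \<Longrightarrow> y \<in> carrier V \<Longrightarrow> x \<oplus> y = y \<oplus> x"
    and "\<And>x y z. x \<in> carrier V \<Longrightarrow> y \<in> carrier V \<Longrightarrow> z \<in> carrier V \<Longrightarrow>
           (x \<oplus> y) \<oplus> z = x \<oplus> (y \<oplus> z)"
    and "\<And>x. x \<in> carrier V \<Longrightarrow> x \<oplus> \<zero> = x"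
    and "\<And>x. x \<in> carrier V \<Longrightarrow> 0 \<odot> x = \<zero>"
    and "\<And>x. x \<in> carrier V \<Longrightarrow> 1 \<odot> x = x"
    and "\<And>a b x. x \<in> carrier V \<Longrightarrow> (a * b) \<odot> x = a \<odot> (b \<odot> x)"
    and "\<And>a b x. x \<in> carrier V \<Longrightarrow> (a + b) \<odot> x = a \<odot> x \<oplus> b \<odot> x"
    and "\<And>a x y. x \<in> carrier V \<Longrightarrow> y \<in> carrier V \<Longrightarrow>
           a \<odot> (x \<oplus> y) = a \<odot> x \<oplus> a \<odot> y"
  shows "vspace V"
proof (rule vs_criteria[OF field_class_ring])
  show "\<forall>v\<in>carrier V. \<exists>w\<in>carrier V. v \<oplus> w = \<zero>"
  proof
    fix v assume v: "v \<in> carrier V"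
    have "v \<oplus> (- 1) \<odot> v = (1 + - 1) \<odot> v"
      using v assms(8,10) by metis
    also have "\<dots> = \<zero>" using v assms(7) by simp
    finally show "\<exists>w\<in>carrier V. v \<oplus> w = \<zero>" using v assms(3) by blast
  qed
qed (use assms in auto)

context
  fixes V :: "('k::field, 'v) module" (structure)
  assumes V: "vspace V"
begin

interpretation V: vectorspace class_ring V by (rule V)

lemma vs_zero_closed: "\<zero> \<in> carrier V" by simp
lemma vs_add_closed: "x \<in> carrier V \<Longrightarrow> y \<in> carrier V \<Longrightarrow> x \<oplus> y \<in> carrier V" by simp
lemma vs_smult_closed: "x \<in> carrier V \<Longrightarrow> a \<odot> x \<in> carrier V"
  using V.smult_closed[of a x] by simp
lemma vs_add_comm: "x \<in> carrier V \<Longrightarrow> y \<in> carrier V \<Longrightarrow> x \<oplus> y = y \<oplus> x"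
  by (rule V.a_comm)
lemma vs_add_assoc:
  "x \<in> carrier V \<Longrightarrow> y \<in> carrier V \<Longrightarrow> z \<in> carrier V \<Longrightarrow>
    (x \<oplus> y) \<oplus> z = x \<oplus> (y \<oplus> z)"
  by (rule V.a_assoc)
lemma vs_add_zero: "x \<in> carrier V \<Longrightarrow> x \<oplus> \<zero> = x" "x \<in> carrier V \<Longrightarrow> \<zero> \<oplus> x = x" by simp_all
lemma vs_smult_0: "x \<in> carrier V \<Longrightarrow> 0 \<odot> x = \<zero>"
  using V.lmult_0[of x] by simp
lemma vs_smult_zero: "a \<odot> \<zero> = \<zero>"
  using V.rmult_0[of a] by simp
lemma vs_smult_1: "x \<in> carrier V \<Longrightarrow> 1 \<odot> x = x"
  using V.smult_one[of x] by simp
lemma vs_smult_assoc: "x \<in> carrier V \<Longrightarrow> (a * b) \<odot> x = a \<odot> (b \<odot> x)"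
  using V.smult_assoc1[of a b x] by simp
lemma vs_smult_ldistr: "x \<in> carrier V \<Longrightarrow> (a + b) \<odot> x = a \<odot> x \<oplus> b \<odot> x"
  using V.smult_l_distr[of a b x] by simp
lemma vs_smult_rdistr:
  "x \<in> carrier V \<Longrightarrow> y \<in> carrier V \<Longrightarrow> a \<odot> (x \<oplus> y) = a \<odot> x \<oplus> a \<odot> y"
  using V.smult_r_distr[of a x y] by simp
lemma vs_minus: "x \<in> carrier V \<Longrightarrow> \<ominus> x = (- 1) \<odot> x"
  using V.smult_minus_1[of x] by (simp add: class_ring_simps)
lemma vs_diff:
  "x \<in> carrier V \<Longrightarrow> y \<in> carrier V \<Longrightarrow> x \<ominus> y = x \<oplus> (- 1) \<odot> y"
  by (simp add: a_minus_def vs_minus)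
lemma vs_finsum_closed:
  "(\<And>i. i \<in> I \<Longrightarrow> f i \<in> carrier V) \<Longrightarrow> (\<Oplus>i\<in>I. f i) \<in> carrier V"
  by (rule V.finsum_closed) auto

lemmas vs_simps = vs_zero_closed vs_add_closed vs_smult_closed vs_add_zero vs_smult_0
  vs_smult_zero vs_smult_1

lemma vs_subspaceI:
  assumes "W \<subseteq> carrier V" "\<zero> \<in> W"
    and "\<And>x y. x \<in> W \<Longrightarrow> y \<in> W \<Longrightarrow> x \<oplus> y \<in> W"
    and "\<And>a x. x \<in> W \<Longrightarrow> a \<odot> x \<in> W"
  shows "subsp W V"
  using assms V by (auto simp: subspace_def submodule_def vectorspace_def)

lemma vs_subspaceD:
  assumes "subsp W V"
  shows "W \<subseteq> carrier V" "\<zero> \<in> W"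
    "\<And>x y. x \<in> W \<Longrightarrow> y \<in> W \<Longrightarrow> x \<oplus> y \<in> W"
    "\<And>a x. x \<in> W \<Longrightarrow> a \<odot> x \<in> W"
    "vspace (V\<lparr>carrier := W\<rparr>)"
  using assms V.subspace_is_vs[OF assms] by (auto simp: subspace_def submodule_def)

end

section \<open>Linear maps and their descent along surjections\<close>

lemma linear_mapI:
  fixes V :: "('k::field, 'v) module" (structure) and W :: "('k, 'w) module"
  assumes "vspace V" "vspace W"
    and "\<And>x. x \<in> carrier V \<Longrightarrow> f x \<in> carrier W"
    and "\<And>x y. x \<in> carrier V \<Longrightarrow> y \<in> carrier V \<Longrightarrow> f (x \<oplus> y) = f x \<oplus>\<^bsub>W\<^esub> f y"
    and "\<And>a x. x \<in> carrier V \<Longrightarrow> f (a \<odot> x) = a \<odot>\<^bsub>W\<^esub> f x"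
  shows "linmap V W f"
  using assms
  by (auto simp: linear_map_def mod_hom_def mod_hom_axioms_def module_hom_def vectorspace_def)

lemma linear_mapD:
  fixes V :: "('k::field, 'v) module" (structure) and W :: "('k, 'w) module"
  assumes "linmap V W f"
  shows "vspace V" "vspace W"
    "\<And>x. x \<in> carrier V \<Longrightarrow> f x \<in> carrier W"
    "\<And>x y. x \<in> carrier V \<Longrightarrow> y \<in> carrier V \<Longrightarrow> f (x \<oplus> y) = f x \<oplus>\<^bsub>W\<^esub> f y"
    "\<And>a x. x \<in> carrier V \<Longrightarrow> f (a \<odot> x) = a \<odot>\<^bsub>W\<^esub> f x"
    "f \<zero> = \<zero>\<^bsub>W\<^esub>"
    "\<And>x y. x \<in> carrier V \<Longrightarrow> y \<in> carrier V \<Longrightarrow> f (x \<ominus> y) = f x \<ominus>\<^bsub>W\<^esub> f y"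
proof -
  interpret linear_map class_ring V W f by fact
  show "vspace V" "vspace W"
    by (rule V.vectorspace_axioms W.vectorspace_axioms)+
  show "\<And>x. x \<in> carrier V \<Longrightarrow> f x \<in> carrier W"
    "\<And>x y. x \<in> carrier V \<Longrightarrow> y \<in> carrier V \<Longrightarrow> f (x \<oplus> y) = f x \<oplus>\<^bsub>W\<^esub> f y"
    "\<And>a x. x \<in> carrier V \<Longrightarrow> f (a \<odot> x) = a \<odot>\<^bsub>W\<^esub> f x"
    "f \<zero> = \<zero>\<^bsub>W\<^esub>"
    "\<And>x y. x \<in> carrier V \<Longrightarrow> y \<in> carrier V \<Longrightarrow> f (x \<ominus> y) = f x \<ominus>\<^bsub>W\<^esub> f y"
    by (simp_all add: T_add T_smult)
qed

lemma linear_map_finsum: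
  fixes V :: "('k::field, 'v) module" (structure) and W :: "('k, 'w) module"
  assumes f: "linmap V W f" and "\<And>i. i \<in> I \<Longrightarrow> x i \<in> carrier V"
  shows "f (\<Oplus>i\<in>I. x i) = (\<Oplus>\<^bsub>W\<^esub>i\<in>I. f (x i))"
proof -
  interpret linear_map class_ring V W f by fact
  show ?thesis using assms(2)
    by (induction I rule: infinite_finite_induct) (auto simp: Pi_def T_add)
qed

lemma linear_map_compose:
  fixes V :: "('k::field, 'v) module" (structure) and W :: "('k, 'w) module" and U :: "('k, 'u) module"
  assumes "linmap V W f" "linmap W U g"
  shows "linmap V U (\<lambda>x. g (f x))"
  using linear_mapD[OF assms(1)] linear_mapD[OF assms(2)] by (intro linear_mapI) auto

lemma linear_map_add:
  fixes V :: "('k::field, 'v) module" (structure) and W :: "('k, 'w) module"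
  assumes "linmap V W f" "linmap V W g"
  shows "linmap V W (\<lambda>x. f x \<oplus>\<^bsub>W\<^esub> g x)"
proof -
  note f = linear_mapD[OF assms(1)] and g = linear_mapD[OF assms(2)]
  interpret W: vectorspace class_ring W by (rule f(2))
  show ?thesis
    by (intro linear_mapI f(1,2)) (auto simp: f g W.a_ac vs_smult_rdistr[OF f(2)])
qed

lemma linear_map_smult:
  fixes V :: "('k::field, 'v) module" (structure) and W :: "('k, 'w) module"
  assumes "linmap V W f"
  shows "linmap V W (\<lambda>x. c \<odot>\<^bsub>W\<^esub> f x)"
proof -
  note f = linear_mapD[OF assms(1)]
  show ?thesis
    by (intro linear_mapI f(1,2))
      (auto simp: f vs_smult_closed[OF f(2)] vs_smult_rdistr[OF f(2)] vs_smult_assoc[OF f(2), symmetric] mult.commute)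
qed

text \<open>Transport of structure: a record whose operations are computed on preimages under
  \<open>p\<close> inherits every vector space law from \<open>Z\<close>. Quotient spaces and
  degree-one cosheaf homology obtain their laws in this way.\<close>

lemma linear_map_image:
  fixes Z :: "('k::field, 'z) module" and V :: "('k, 'v) module"
  assumes Z: "vspace Z"
    and carr: "carrier V = p ` carrier Z"
    and zero: "p \<zero>\<^bsub>Z\<^esub> = \<zero>\<^bsub>V\<^esub>"
    and add: "\<And>x y. x \<in> carrier Z \<Longrightarrow> y \<in> carrier Z \<Longrightarrow> p x \<oplus>\<^bsub>V\<^esub> p y = p (x \<oplus>\<^bsub>Z\<^esub> y)"
    and smult: "\<And>a x. x \<in> carrier Z \<Longrightarrow> a \<odot>\<^bsub>V\<^esub> p x = p (a \<odot>\<^bsub>Z\<^esub> x)"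
  shows "linmap Z V p"
proof -
  note Zs = vs_simps[OF Z]
  interpret Z: vectorspace class_ring Z by (rule Z)
  have "vspace V"
    by (rule vectorspaceI)
      (auto simp: carr zero[symmetric] add smult Zs Z.a_ac vs_smult_assoc[OF Z] vs_smult_ldistr[OF Z]
        vs_smult_rdistr[OF Z])
  then show ?thesis using Z by (intro linear_mapI) (auto simp: carr add smult)
qed

text \<open>For maps that are already given as functions on classes, such as
  \<open>homology_map\<close>: linearity is checked on representatives, where the composite with
  \<open>p\<close> is a known linear map.\<close>

lemma linear_map_descend:
  fixes Z :: "('k::field, 'z) module" and V :: "('k, 'v) module" and W :: "('k, 'w) module"
  assumes p: "linmap Z V p" and surj: "carrier V = p ` carrier Z"
    and q: "linmap Z W q"
    and f: "\<And>x. x \<in> carrier Z \<Longrightarrow> f (p x) = q x"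
  shows "linmap V W f"
proof -
  note p' = linear_mapD[OF p] and q' = linear_mapD[OF q]
  show ?thesis
  proof (rule linear_mapI)
    show "vspace V" "vspace W" by fact+
    show "f x \<in> carrier W" if "x \<in> carrier V" for x using that surj f q' by auto
    show "f (x \<oplus>\<^bsub>V\<^esub> y) = f x \<oplus>\<^bsub>W\<^esub> f y" if "x \<in> carrier V" "y \<in> carrier V" for x y
    proof -
      obtain a b where ab: "x = p a" "y = p b" "a \<in> carrier Z" "b \<in> carrier Z"
        using \<open>x \<in> _\<close> \<open>y \<in> _\<close> surj by auto
      then have "f (x \<oplus>\<^bsub>V\<^esub> y) = f (p (a \<oplus>\<^bsub>Z\<^esub> b))" using p' by simp
      also have "\<dots> = q (a \<oplus>\<^bsub>Z\<^esub> b)" using ab vs_add_closed[OF p'(1)] by (intro f) auto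
      finally show ?thesis using ab q' f by simp
    qed
    show "f (c \<odot>\<^bsub>V\<^esub> x) = c \<odot>\<^bsub>W\<^esub> f x" if "x \<in> carrier V" for c x
    proof -
      obtain a where ab: "x = p a" "a \<in> carrier Z"
        using \<open>x \<in> _\<close> surj by auto
      then have "f (c \<odot>\<^bsub>V\<^esub> x) = f (p (c \<odot>\<^bsub>Z\<^esub> a))" using p' by simp
      also have "\<dots> = q (c \<odot>\<^bsub>Z\<^esub> a)" using ab vs_smult_closed[OF p'(1)] by (intro f) auto
      finally show ?thesis using ab q' f by simp
    qed
  qed
qed

text \<open>The counterpart when no formula for the map on classes is at hand: a preimage is chosen
  by \<open>SOME\<close>, and \<open>ker\<close> makes the value independent of it.\<close>

lemma linear_map_factor:
  fixes Z :: "('k::field, 'z) module" and V :: "('k, 'v) module" and W :: "('k, 'w) module"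
  assumes p: "linmap Z V p" and surj: "carrier V = p ` carrier Z"
    and q: "linmap Z W q"
    and ker: "\<And>x y. x \<in> carrier Z \<Longrightarrow> y \<in> carrier Z \<Longrightarrow> p x = p y \<Longrightarrow> q x = q y"
  obtains f where "linmap V W f" "\<And>x. x \<in> carrier Z \<Longrightarrow> f (p x) = q x"
proof -
  define f where "f y = q (SOME x. x \<in> carrier Z \<and> p x = y)" for y
  have f: "f (p x) = q x" if "x \<in> carrier Z" for x
  proof -
    let ?x = "SOME x'. x' \<in> carrier Z \<and> p x' = p x"
    have "?x \<in> carrier Z \<and> p ?x = p x" by (rule someI) (use that in simp)
    then show ?thesis using ker[of ?x x] that by (simp add: f_def)
  qed
  show thesis by (rule that[OF linear_map_descend[OF p surj q f] f])
qed

lemma linear_map_eq_on_span: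
  fixes V :: "('k::field, 'v) module" (structure) and W :: "('k, 'w) module"
  assumes f: "linmap V W f" and g: "linmap V W g"
    and B: "vectorspace.basis class_ring V B"
    and eq: "\<And>b. b \<in> B \<Longrightarrow> f b = g b" and x: "x \<in> carrier V"
  shows "f x = g x"
proof -
  note f' = linear_mapD[OF f] and g' = linear_mapD[OF g]
  interpret V: vectorspace class_ring V by (rule f'(1))
  interpret W: vectorspace class_ring W by (rule f'(2))
  from B x have "x \<in> V.span B" and BV: "B \<subseteq> carrier V" by (auto simp: V.basis_def)
  then obtain a T where T: "finite T" "T \<subseteq> B" "x = (\<Oplus>v\<in>T. a v \<odot> v)"
    by (auto simp: V.span_def V.lincomb_def)
  then have TV: "T \<subseteq> carrier V" using BV by auto
  have "f x = (\<Oplus>\<^bsub>W\<^esub>v\<in>T. f (a v \<odot> v))" unfolding T(3)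
    by (rule linear_map_finsum[OF f]) (use TV vs_smult_closed[OF f'(1)] in auto)
  also have "\<dots> = (\<Oplus>\<^bsub>W\<^esub>v\<in>T. g (a v \<odot> v))"
  proof (rule W.finsum_cong')
    show "f (a v \<odot> v) = g (a v \<odot> v)" if "v \<in> T" for v
    proof -
      have "v \<in> carrier V" using that TV by auto
      then show ?thesis using f'(5) g'(5) eq[of v] that T(2) by auto
    qed
  qed (use TV vs_smult_closed[OF f'(1)] g'(3) in auto)
  also have "\<dots> = g x" unfolding T(3)
    by (rule linear_map_finsum[OF g, symmetric]) (use TV vs_smult_closed[OF f'(1)] in auto)
  finally show ?thesis .
qed

lemma linear_map_restrict:
  fixes V :: "('k::field, 'v) module" (structure) and W :: "('k, 'w) module"
  assumes f: "linmap V W f" and U: "subsp U V"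
  shows "linmap (V\<lparr>carrier := U\<rparr>) W f"
proof -
  note f' = linear_mapD[OF f] and U' = vs_subspaceD[OF linear_mapD(1)[OF f] U]
  have "x \<in> carrier V" if "x \<in> U" for x using that U'(1) by auto
  then show ?thesis using f' U'(5) by (intro linear_mapI) simp_all
qed

section \<open>Cosets and quotient spaces\<close>

lemma a_r_coset_eq: "W +>\<^bsub>V\<^esub> x = (\<lambda>w. w \<oplus>\<^bsub>V\<^esub> x) ` W"
  by (auto simp: a_r_coset_def r_coset_def)

lemma
  fixes V :: "('k::field, 'v) module" (structure)
  assumes V: "vspace V" and W: "subsp W V"
  shows quotient_space_eq_iff:
      "\<And>x y. x \<in> carrier V \<Longrightarrow> y \<in> carrier V \<Longrightarrow> W +> x = W +> y \<longleftrightarrow> x \<ominus> y \<in> W"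
    and quotient_space_surj: "carrier (quotient_space V W) = (\<lambda>x. W +> x) ` carrier V"
    and quotient_space_linear: "linmap V (quotient_space V W) (\<lambda>x. W +> x)"
proof -
  interpret V: vectorspace class_ring V by (rule V)
  note W' = vs_subspaceD[OF V W]
  have WV: "w \<in> carrier V" if "w \<in> W" for w using that W' by auto
  have neg: "\<ominus> w \<in> W" if "w \<in> W" for w
    using that W' vs_minus[OF V, of w] by auto
  show eq: "W +> x = W +> y \<longleftrightarrow> x \<ominus> y \<in> W"
    if x: "x \<in> carrier V" and y: "y \<in> carrier V" for x y
  proof
    assume "W +> x = W +> y"
    moreover have "x \<in> W +> x" unfolding a_r_coset_eq
      using x W'(2) by (intro image_eqI[where x = "\<zero>"]) auto
    ultimately obtain w where w: "w \<in> W" "x = w \<oplus> y" unfolding a_r_coset_eq by auto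
    then have "x \<ominus> y = w"
      using WV y by (simp add: a_minus_def V.a_assoc V.r_neg)
    then show "x \<ominus> y \<in> W" using w by simp
  next
    assume *: "x \<ominus> y \<in> W"
    \<comment> \<open>One inclusion suffices; the other follows because \<open>W\<close> also
      contains the negative of \<open>x \<ominus> y\<close>, which is
      \<open>y \<ominus> x\<close>.\<close>
    have sub: "W +> a \<subseteq> W +> b"
      if "a \<in> carrier V" "b \<in> carrier V" "a \<ominus> b \<in> W" for a b
    proof -
      have "w \<oplus> a = (w \<oplus> (a \<ominus> b)) \<oplus> b" if "w \<in> W" for w
        using \<open>a \<in> _\<close> \<open>b \<in> _\<close> WV[OF that]
        by (simp add: a_minus_def V.a_assoc V.l_neg)
      then show ?thesis unfolding a_r_coset_eq using that(3) W'(3) by auto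
    qed
    have "y \<ominus> x = \<ominus> (x \<ominus> y)"
      using x y by (simp add: a_minus_def V.minus_add V.a_comm)
    then show "W +> x = W +> y"
      using sub[OF x y *] sub[OF y x] neg[OF *] by auto
  qed
  show surj: "carrier (quotient_space V W) = (\<lambda>x. W +> x) ` carrier V"
    by (auto simp: quotient_space_def A_RCOSETS_def RCOSETS_def a_r_coset_def)
  show "linmap V (quotient_space V W) (\<lambda>x. W +> x)"
  proof (rule linear_map_image[OF V surj])
    show "W +> \<zero> = \<zero>\<^bsub>quotient_space V W\<^esub>"
      using WV by (auto simp: quotient_space_def a_r_coset_eq image_iff)
    fix x assume x: "x \<in> carrier V"
    show "(W +> x) \<oplus>\<^bsub>quotient_space V W\<^esub> (W +> y) = W +> (x \<oplus> y)"
      if y: "y \<in> carrier V" for y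
    proof -
      have "(w \<oplus> x) \<oplus> (w' \<oplus> y) = (w \<oplus> w') \<oplus> (x \<oplus> y)" if "w \<in> W" "w' \<in> W" for w w'
        using WV that x y by (simp add: V.a_ac)
      then have "h \<oplus> k \<in> W +> (x \<oplus> y)" if "h \<in> W +> x" "k \<in> W +> y" for h k
        using that W'(3) unfolding a_r_coset_eq by force
      moreover have "\<exists>h\<in>W +> x. \<exists>k\<in>W +> y. g = h \<oplus> k"
        if g: "g \<in> W +> (x \<oplus> y)" for g
      proof -
        obtain w where w: "w \<in> W" "g = w \<oplus> (x \<oplus> y)" using g unfolding a_r_coset_eq by blast
        then have g': "g = (w \<oplus> x) \<oplus> (\<zero> \<oplus> y)" using WV x y by (simp add: V.a_ac)
        show ?thesis unfolding a_r_coset_eq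
          by (rule bexI[of _ "w \<oplus> x"], rule bexI[of _ "\<zero> \<oplus> y"]) (use g' w(1) W'(2) in auto)
      qed
      ultimately have "(W +> x) <+> (W +> y) = W +> (x \<oplus> y)"
        by (intro equalityI subsetI) (auto simp: set_add_def set_mult_def)
      then show ?thesis by (simp add: quotient_space_def)
    qed
    show "a \<odot>\<^bsub>quotient_space V W\<^esub> (W +> x) = W +> (a \<odot> x)" for a
    proof -
      \<comment> \<open>Scalar multiplication on the quotient is defined as a union over a coset;
        all the cosets in this union agree.\<close>
      have "W +> (a \<odot> z) = W +> (a \<odot> x)" if z: "z \<in> W +> x" for z
      proof -
        obtain w where w: "w \<in> W" "z = w \<oplus> x" using z unfolding a_r_coset_eq by blast
        then have aw: "a \<odot> w \<in> carrier V" "a \<odot> x \<in> carrier V" "a \<odot> w \<in> W"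
          using WV W'(4) x vs_smult_closed[OF V] by auto
        have "a \<odot> z = a \<odot> w \<oplus> a \<odot> x"
          using w x WV by (simp add: vs_smult_rdistr[OF V])
        then have "a \<odot> z \<ominus> a \<odot> x = a \<odot> w"
          using aw by (simp add: a_minus_def V.a_assoc V.r_neg)
        then show ?thesis using eq aw w x WV vs_smult_closed[OF V] by simp
      qed
      moreover have "x \<in> W +> x" unfolding a_r_coset_eq
        using x W'(2) by (intro image_eqI[where x = "\<zero>"]) auto
      ultimately have "(\<Union>z\<in>W +> x. W +> (a \<odot> z)) = W +> (a \<odot> x)"
        by (intro UN_constant_eq) (assumption, blast)
      then show ?thesis by (simp add: quotient_space_def)
    qed
  qed
qed

lemma quotient_map_coset:
  fixes V :: "('k::field, 'v) module" (structure) and V' :: "('k, 'w) module"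
  assumes V: "vspace V" and W: "subsp W V"
    and V': "vspace V'" and W': "subsp W' V'"
    and f: "linmap V V' f" and sub: "f ` W \<subseteq> W'" and x: "x \<in> carrier V"
  shows "quotient_map V' W' f (W +> x) = W' +>\<^bsub>V'\<^esub> f x"
proof -
  interpret V': vectorspace class_ring V' by (rule V')
  note WV = vs_subspaceD[OF V W] and f' = linear_mapD[OF f]
  have "W' +>\<^bsub>V'\<^esub> f z = W' +>\<^bsub>V'\<^esub> f x" if z: "z \<in> W +> x" for z
  proof -
    obtain w where w: "w \<in> W" "z = w \<oplus> x" using z unfolding a_r_coset_eq by blast
    then have "f z = f w \<oplus>\<^bsub>V'\<^esub> f x" and c: "f w \<in> carrier V'" "f x \<in> carrier V'"
      using WV(1) x f' by auto
    then have "f z \<ominus>\<^bsub>V'\<^esub> f x = f w" "f z \<in> carrier V'"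
      by (simp_all add: a_minus_def V'.a_assoc V'.r_neg)
    then show ?thesis using quotient_space_eq_iff[OF V' W', of "f z" "f x"] c w sub by auto
  qed
  moreover have "x \<in> W +> x" unfolding a_r_coset_eq
    using x WV(2) vs_add_zero[OF V] by (intro image_eqI[where x = "\<zero>"]) auto
  ultimately show ?thesis unfolding quotient_map_def by (intro UN_constant_eq) (assumption, blast)
qed

section \<open>Direct sums\<close>

lemma carrier_dsum_iff:
  "x \<in> carrier (dsum I V) \<longleftrightarrow> x \<in> extensional I \<and> (\<forall>i\<in>I. x i \<in> carrier (V i))"
  by (auto simp: dsum_def PiE_iff)

lemma dsum_simps [simp]:
  "\<zero>\<^bsub>dsum I V\<^esub> = (\<lambda>i\<in>I. \<zero>\<^bsub>V i\<^esub>)"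
  "x \<oplus>\<^bsub>dsum I V\<^esub> y = (\<lambda>i\<in>I. x i \<oplus>\<^bsub>V i\<^esub> y i)"
  "a \<odot>\<^bsub>dsum I V\<^esub> x = (\<lambda>i\<in>I. a \<odot>\<^bsub>V i\<^esub> x i)"
  by (simp_all add: dsum_def)

lemma vectorspace_dsum:
  fixes V :: "'i \<Rightarrow> ('k::field, 'v) module" (structure)
  assumes "\<And>i. i \<in> I \<Longrightarrow> vspace (V i)"
  shows "vspace (dsum I V)" (is "vspace ?D")
proof (rule vectorspaceI)
  fix x y z a
  assume x: "x \<in> carrier (?D)" and y: "y \<in> carrier (?D)"
  show "x \<oplus>\<^bsub>?D\<^esub> y = y \<oplus>\<^bsub>?D\<^esub> x"
    unfolding dsum_simps by (rule restrict_ext) (use x y vs_add_comm[OF assms] in \<open>auto simp: carrier_dsum_iff\<close>)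
  show "a \<odot>\<^bsub>?D\<^esub> (x \<oplus>\<^bsub>?D\<^esub> y) = a \<odot>\<^bsub>?D\<^esub> x \<oplus>\<^bsub>?D\<^esub> a \<odot>\<^bsub>?D\<^esub> y"
    unfolding dsum_simps by (rule restrict_ext) (use x y vs_smult_rdistr[OF assms] in \<open>auto simp: carrier_dsum_iff\<close>)
  show "x \<oplus>\<^bsub>?D\<^esub> y \<in> carrier (?D)"
    using x y vs_add_closed[OF assms] by (auto simp: carrier_dsum_iff)
  assume z: "z \<in> carrier (?D)"
  show "x \<oplus>\<^bsub>?D\<^esub> y \<oplus>\<^bsub>?D\<^esub> z = x \<oplus>\<^bsub>?D\<^esub> (y \<oplus>\<^bsub>?D\<^esub> z)"
    unfolding dsum_simps by (rule restrict_ext) (use x y z vs_add_assoc[OF assms] in \<open>auto simp: carrier_dsum_iff\<close>)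
next
  fix x a b
  assume x: "x \<in> carrier (?D)"
  show "a \<odot>\<^bsub>?D\<^esub> x \<in> carrier (?D)"
    using x vs_smult_closed[OF assms] by (auto simp: carrier_dsum_iff)
  from x have x': "x \<in> extensional I" "\<And>i. i \<in> I \<Longrightarrow> x i \<in> carrier (V i)" by (auto simp: carrier_dsum_iff)
  show "x \<oplus>\<^bsub>?D\<^esub> \<zero>\<^bsub>?D\<^esub> = x"
    unfolding dsum_simps by (rule extensionalityI[of _ I]) (simp_all add: x' vs_add_zero[OF assms])
  show "1 \<odot>\<^bsub>?D\<^esub> x = x"
    unfolding dsum_simps by (rule extensionalityI[of _ I]) (simp_all add: x' vs_smult_1[OF assms])
  show "0 \<odot>\<^bsub>?D\<^esub> x = \<zero>\<^bsub>?D\<^esub>"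
    unfolding dsum_simps by (rule restrict_ext) (simp add: x' vs_smult_0[OF assms])
  show "(a * b) \<odot>\<^bsub>?D\<^esub> x = a \<odot>\<^bsub>?D\<^esub> (b \<odot>\<^bsub>?D\<^esub> x)"
    unfolding dsum_simps by (rule restrict_ext) (simp add: x' vs_smult_assoc[OF assms])
  show "(a + b) \<odot>\<^bsub>?D\<^esub> x = a \<odot>\<^bsub>?D\<^esub> x \<oplus>\<^bsub>?D\<^esub> b \<odot>\<^bsub>?D\<^esub> x"
    unfolding dsum_simps by (rule restrict_ext) (simp add: x' vs_smult_ldistr[OF assms])
next
  show "\<zero>\<^bsub>?D\<^esub> \<in> carrier (?D)"
    using vs_zero_closed[OF assms] by (simp add: carrier_dsum_iff)
qed

lemma linear_map_dsum_map:
  fixes V :: "'i \<Rightarrow> ('k::field, 'v) module" (structure) and W :: "'i \<Rightarrow> ('k, 'w) module"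
  assumes f: "\<And>i. i \<in> I \<Longrightarrow> linmap (V i) (W i) (f i)"
  shows "linmap (dsum I V) (dsum I W) (dsum_map I f)"
proof (rule linear_mapI)
  note f' = linear_mapD[OF f]
  show "vspace (dsum I V)" "vspace (dsum I W)"
    using f'(1,2) by (auto intro: vectorspace_dsum)
  fix x y a
  assume x: "x \<in> carrier (dsum I V)"
  show "dsum_map I f x \<in> carrier (dsum I W)"
    using x f'(3) by (auto simp: carrier_dsum_iff dsum_map_def)
  show "dsum_map I f (a \<odot>\<^bsub>dsum I V\<^esub> x) = a \<odot>\<^bsub>dsum I W\<^esub> dsum_map I f x"
    unfolding dsum_simps dsum_map_def by (rule restrict_ext) (use x f'(5) in \<open>simp add: carrier_dsum_iff\<close>)
  assume y: "y \<in> carrier (dsum I V)"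
  show "dsum_map I f (x \<oplus>\<^bsub>dsum I V\<^esub> y) = dsum_map I f x \<oplus>\<^bsub>dsum I W\<^esub> dsum_map I f y"
    unfolding dsum_simps dsum_map_def by (rule restrict_ext) (use x y f'(4) in \<open>simp add: carrier_dsum_iff\<close>)
qed

lemma direct_sum_simps [simp]:
  "carrier (direct_sum V W) = carrier V \<times> carrier W"
  "\<zero>\<^bsub>direct_sum V W\<^esub> = (\<zero>\<^bsub>V\<^esub>, \<zero>\<^bsub>W\<^esub>)"
  "p \<oplus>\<^bsub>direct_sum V W\<^esub> q = (fst p \<oplus>\<^bsub>V\<^esub> fst q, snd p \<oplus>\<^bsub>W\<^esub> snd q)"
  "a \<odot>\<^bsub>direct_sum V W\<^esub> p = (a \<odot>\<^bsub>V\<^esub> fst p, a \<odot>\<^bsub>W\<^esub> snd p)"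
  by (simp_all add: direct_sum_def)

text \<open>By Zorn's lemma there is a maximal single-valued subrelation of \<open>L\<close> containing \<open>G0\<close>; it is total.\<close>

lemma linear_selection_extend:
  fixes V :: "('k::field, 'v) module" (structure) and W :: "('k, 'w) module"
  assumes V: "vspace V" and W: "vspace W"
    and L: "subsp L (direct_sum V W)"
    and total: "\<And>x. x \<in> carrier V \<Longrightarrow> \<exists>y. (x, y) \<in> L"
    and G0: "subsp G0 (direct_sum V W)" "G0 \<subseteq> L"
    and single: "\<And>y. (\<zero>, y) \<in> G0 \<Longrightarrow> y = \<zero>\<^bsub>W\<^esub>"
  obtains g where "linmap V W g" "\<And>x. x \<in> carrier V \<Longrightarrow> (x, g x) \<in> L"
    "\<And>x y. (x, y) \<in> G0 \<Longrightarrow> g x = y"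
proof -
  let ?S = "direct_sum V W"
  interpret V: vectorspace class_ring V by (rule V)
  interpret W: vectorspace class_ring W by (rule W)
  have VW: "vspace ?S" by (rule direct_sum_is_vs[OF V W])
  note L' = vs_subspaceD[OF VW L]
  \<comment> \<open>Single-valuedness is asked only over \<zero>: in a subspace the difference of
    two pairs over the same point is a pair over \<zero>.\<close>
  define \<G> where "\<G> = {G. subsp G ?S \<and> G0 \<subseteq> G \<and> G \<subseteq> L \<and>
    (\<forall>y. (\<zero>, y) \<in> G \<longrightarrow> y = \<zero>\<^bsub>W\<^esub>)}"
  have "\<exists>M\<in>\<G>. \<forall>X\<in>\<G>. M \<subseteq> X \<longrightarrow> X = M"
  proof (rule subset_Zorn_nonempty)
    show "\<G> \<noteq> {}" using G0 single unfolding \<G>_def by blast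
    fix \<C> assume ne: "\<C> \<noteq> {}" and ch: "subset.chain \<G> \<C>"
    then have mem: "G \<in> \<G>" if "G \<in> \<C>" for G using that unfolding subset_chain_def by blast
    have linked: "X \<subseteq> Y \<or> Y \<subseteq> X" if "X \<in> \<C>" "Y \<in> \<C>" for X Y
      using ch that unfolding subset_chain_def by blast
    have sub: "subsp G ?S" if "G \<in> \<C>" for G
      using mem[OF that] unfolding \<G>_def by blast
    note D = vs_subspaceD[OF VW sub]
    have "subsp (\<Union>\<C>) ?S"
    proof (rule vs_subspaceI[OF VW])
      show "p \<oplus>\<^bsub>?S\<^esub> q \<in> \<Union>\<C>" if pq: "p \<in> \<Union>\<C>" "q \<in> \<Union>\<C>" for p q
      proof -
        obtain X Y where "p \<in> X" "X \<in> \<C>" "q \<in> Y" "Y \<in> \<C>" using pq by blast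
        moreover from this have "X \<subseteq> Y \<or> Y \<subseteq> X" by (intro linked)
        ultimately have "p \<in> X \<and> q \<in> X \<and> X \<in> \<C> \<or> p \<in> Y \<and> q \<in> Y \<and> Y \<in> \<C>" by blast
        then show ?thesis using D(3) by (elim disjE conjE) (metis UnionI)+
      qed
      show "\<Union>\<C> \<subseteq> carrier ?S" using D(1) by (rule Union_least)
      show "\<zero>\<^bsub>?S\<^esub> \<in> \<Union>\<C>" using D(2) ne by (metis UnionI ex_in_conv)
      show "a \<odot>\<^bsub>?S\<^esub> p \<in> \<Union>\<C>" if "p \<in> \<Union>\<C>" for a p
        using D(4) that by (elim UnionE) (metis UnionI)
    qed
    moreover have "G0 \<subseteq> G" "G \<subseteq> L" "\<And>y. (\<zero>, y) \<in> G \<Longrightarrow> y = \<zero>\<^bsub>W\<^esub>" if "G \<in> \<C>" for G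
      using mem[OF that] unfolding \<G>_def by blast+
    ultimately show "\<Union>\<C> \<in> \<G>" using ne unfolding \<G>_def mem_Collect_eq by (metis Sup_upper UnionE Union_least ex_in_conv order_trans)
  qed
  then obtain M where M: "M \<in> \<G>" and max: "\<And>X. X \<in> \<G> \<Longrightarrow> M \<subseteq> X \<Longrightarrow> X = M" by blast
  from M have Ms: "subsp M ?S" and M_sub: "M \<subseteq> L" and "G0 \<subseteq> M"
    and Msingle: "\<And>y. (\<zero>, y) \<in> M \<Longrightarrow> y = \<zero>\<^bsub>W\<^esub>" unfolding \<G>_def by blast+
  note M' = vs_subspaceD[OF VW Ms]
  have Mc: "x \<in> carrier V" "y \<in> carrier W" if "(x, y) \<in> M" for x y using that M'(1) by auto
  have Madd: "(x \<oplus> x', y \<oplus>\<^bsub>W\<^esub> y') \<in> M" if "(x, y) \<in> M" "(x', y') \<in> M" for x y x' y'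
    using M'(3)[OF that] by simp
  have Msm: "(a \<odot> x, a \<odot>\<^bsub>W\<^esub> y) \<in> M" if "(x, y) \<in> M" for a x y
    using M'(4)[OF that] by simp
  have dom: "\<exists>w. (v, w) \<in> M" if v: "v \<in> carrier V" for v
  proof (rule ccontr)
    assume nd: "\<nexists>w. (v, w) \<in> M"
    obtain w where vw: "(v, w) \<in> L" using total[OF v] by blast
    then have w: "w \<in> carrier W" using L'(1) by auto
    \<comment> \<open>The span of \<open>M\<close> and one pair of \<open>L\<close> over the missing
      point \<open>v\<close>. If it is still single-valued, it contradicts maximality.\<close>
    let ?M = "{(x \<oplus> a \<odot> v, y \<oplus>\<^bsub>W\<^esub> a \<odot>\<^bsub>W\<^esub> w) | x y a. (x, y) \<in> M}"
    note cl = vs_smult_closed[OF V] vs_smult_closed[OF W]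
    have M_le: "M \<subseteq> ?M"
    proof
      fix p assume p: "p \<in> M"
      obtain x y where xy: "p = (x, y)" by (cases p)
      then have "p = (x \<oplus> 0 \<odot> v, y \<oplus>\<^bsub>W\<^esub> 0 \<odot>\<^bsub>W\<^esub> w)"
        using Mc p v w by (simp add: vs_smult_0[OF V] vs_smult_0[OF W])
      then show "p \<in> ?M" using p xy by (intro CollectI exI conjI) auto
    qed
    have "?M \<in> \<G>"
    proof -
      have "subsp ?M ?S"
      proof (rule vs_subspaceI[OF VW])
        show "?M \<subseteq> carrier ?S" using Mc v w cl by auto
        show "\<zero>\<^bsub>?S\<^esub> \<in> ?M"
          using M'(2) v w by (force simp: vs_smult_0[OF V] vs_smult_0[OF W] intro!: exI[of _ 0])
        show "p \<oplus>\<^bsub>?S\<^esub> q \<in> ?M" if pq: "p \<in> ?M" "q \<in> ?M" for p q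
        proof -
          obtain x y a where p: "p = (x \<oplus> a \<odot> v, y \<oplus>\<^bsub>W\<^esub> a \<odot>\<^bsub>W\<^esub> w)" "(x, y) \<in> M" using pq(1) by blast
          obtain x' y' a' where q: "q = (x' \<oplus> a' \<odot> v, y' \<oplus>\<^bsub>W\<^esub> a' \<odot>\<^bsub>W\<^esub> w)" "(x', y') \<in> M"
            using pq(2) by blast
          have "p \<oplus>\<^bsub>?S\<^esub> q =
              ((x \<oplus> x') \<oplus> (a + a') \<odot> v, (y \<oplus>\<^bsub>W\<^esub> y') \<oplus>\<^bsub>W\<^esub> (a + a') \<odot>\<^bsub>W\<^esub> w)"
            using p q v w Mc cl
            by (simp add: vs_smult_ldistr[OF V] vs_smult_ldistr[OF W] V.a_ac W.a_ac)
          then show ?thesis using Madd[OF p(2) q(2)] by blast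
        qed
        show "b \<odot>\<^bsub>?S\<^esub> p \<in> ?M" if "p \<in> ?M" for b p
        proof -
          obtain x y a where p: "p = (x \<oplus> a \<odot> v, y \<oplus>\<^bsub>W\<^esub> a \<odot>\<^bsub>W\<^esub> w)" "(x, y) \<in> M" using \<open>p \<in> ?M\<close> by blast
          have "b \<odot>\<^bsub>?S\<^esub> p =
              (b \<odot> x \<oplus> (b * a) \<odot> v, b \<odot>\<^bsub>W\<^esub> y \<oplus>\<^bsub>W\<^esub> (b * a) \<odot>\<^bsub>W\<^esub> w)"
            using p v w Mc cl by (simp add: vs_smult_rdistr[OF V] vs_smult_rdistr[OF W]
                vs_smult_assoc[OF V] vs_smult_assoc[OF W])
          then show ?thesis using Msm[OF p(2)] by blast
        qed
      qed
      moreover note M_le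
      moreover have "?M \<subseteq> L"
      proof
        fix p assume "p \<in> ?M"
        then obtain x y a where p: "p = (x \<oplus> a \<odot> v, y \<oplus>\<^bsub>W\<^esub> a \<odot>\<^bsub>W\<^esub> w)" "(x, y) \<in> M" by blast
        then show "p \<in> L" using L'(3)[of "(x, y)"] L'(4)[OF vw, of a] M_sub by auto
      qed
      moreover have "y = \<zero>\<^bsub>W\<^esub>" if z: "(\<zero>, y) \<in> ?M" for y
      proof -
        obtain x y' a where xy: "x \<oplus> a \<odot> v = \<zero>" "y = y' \<oplus>\<^bsub>W\<^esub> a \<odot>\<^bsub>W\<^esub> w" "(x, y') \<in> M"
          using z by auto
        \<comment> \<open>Otherwise \<open>v\<close> would be a multiple of \<open>x\<close>, and
          \<open>M\<close> would already contain a pair over it.\<close>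
        have "a = 0"
        proof (rule ccontr)
          assume a: "a \<noteq> 0"
          have "a \<odot> v = \<ominus> x" using xy(1) Mc[OF xy(3)] cl v
            by (metis V.minus_equality V.minus_minus V.a_comm V.a_inv_closed)
          then have "inverse a \<odot> (a \<odot> v) = inverse a \<odot> ((- 1) \<odot> x)"
            using Mc[OF xy(3)] by (simp add: vs_minus[OF V])
          then have "v = (- inverse a) \<odot> x"
            using a v Mc[OF xy(3)]
            by (simp add: vs_smult_assoc[OF V, symmetric] vs_smult_1[OF V])
          then show False using nd Msm[OF xy(3)] by metis
        qed
        then show ?thesis using xy Msingle[of y'] Mc[OF xy(3)] v w
          by (simp add: vs_smult_0[OF V] vs_smult_0[OF W])
      qed
      ultimately show ?thesis using \<open>G0 \<subseteq> M\<close> unfolding \<G>_def by blast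
    qed
    then have "?M = M" using M_le by (rule max)
    moreover have "(\<zero> \<oplus> 1 \<odot> v, \<zero>\<^bsub>W\<^esub> \<oplus>\<^bsub>W\<^esub> 1 \<odot>\<^bsub>W\<^esub> w) \<in> ?M"
      using M'(2) by auto
    ultimately show False using nd v w by (auto simp: vs_smult_1[OF V] vs_smult_1[OF W])
  qed
  have uniq: "y = y'" if "(x, y) \<in> M" "(x, y') \<in> M" for x y y'
  proof -
    have "(x \<oplus> (- 1) \<odot> x, y \<oplus>\<^bsub>W\<^esub> (- 1) \<odot>\<^bsub>W\<^esub> y') \<in> M"
      using Madd[OF that(1) Msm[OF that(2)]] .
    then have "(\<zero>, y \<ominus>\<^bsub>W\<^esub> y') \<in> M"
      using Mc[OF that(1)] Mc[OF that(2)] by (simp add: vs_diff[OF V, symmetric] vs_diff[OF W, symmetric] V.r_neg V.minus_eq)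
    then have "y \<ominus>\<^bsub>W\<^esub> y' = \<zero>\<^bsub>W\<^esub>" by (rule Msingle)
    then show ?thesis using Mc[OF that(1)] Mc[OF that(2)] by simp
  qed
  define g where "g x = (SOME y. (x, y) \<in> M)" for x
  have g: "(x, g x) \<in> M" if "x \<in> carrier V" for x
    unfolding g_def using dom[OF that] by (rule someI_ex)
  have "linmap V W g"
  proof (rule linear_mapI[OF V W])
    show "g (x \<oplus> y) = g x \<oplus>\<^bsub>W\<^esub> g y" if "x \<in> carrier V" "y \<in> carrier V" for x y
      using uniq[OF g Madd[OF g g]] that by simp
    show "g (a \<odot> x) = a \<odot>\<^bsub>W\<^esub> g x" if "x \<in> carrier V" for a x
      using uniq[OF g Msm[OF g]] that vs_smult_closed[OF V] by simp
  qed (use g Mc in blast)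
  then show thesis
    using that g M_sub uniq \<open>G0 \<subseteq> M\<close> Mc by blast
qed

text \<open>The form in which splittings are chosen. The subrelation to be extended is the span of
  the prescribed pairs; independence of the family \<open>s\<close> makes every pair over \<zero> in
  this span trivial.\<close>

lemma linear_selection:
  fixes V :: "('k::field, 'v) module" (structure) and W :: "('k, 'w) module"
  assumes V: "vspace V" and W: "vspace W"
    and L: "subsp L (direct_sum V W)"
    and total: "\<And>x. x \<in> carrier V \<Longrightarrow> \<exists>y. (x, y) \<in> L"
    and st: "\<And>i. i \<in> I \<Longrightarrow> (s i, t i) \<in> L"
    and indep: "\<And>T a. finite T \<Longrightarrow> T \<subseteq> I \<Longrightarrow> (\<Oplus>i\<in>T. a i \<odot> s i) = \<zero> \<Longrightarrow> \<forall>i\<in>T. a i = 0"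
  obtains g where "linmap V W g" "\<And>x. x \<in> carrier V \<Longrightarrow> (x, g x) \<in> L"
    "\<And>i. i \<in> I \<Longrightarrow> g (s i) = t i"
proof -
  let ?S = "direct_sum V W" and ?f = "\<lambda>i. (s i, t i)"
  interpret V: vectorspace class_ring V by (rule V)
  have VW: "vspace ?S" by (rule direct_sum_is_vs[OF V W])
  interpret VW: vectorspace class_ring ?S by (rule VW)
  have QL: "?f ` I \<subseteq> L" using st by blast
  then have QS: "?f ` I \<subseteq> carrier ?S" using vs_subspaceD(1)[OF VW L] by blast
  have sub: "subsp (VW.span (?f ` I)) ?S" by (rule VW.span_is_subspace[OF QS])
  have "submodule class_ring L ?S" using L by (simp add: subspace_def)
  then have le: "VW.span (?f ` I) \<subseteq> L" by (rule VW.span_is_subset[OF QL])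
  have fst: "linmap ?S V fst" by (rule linear_mapI[OF VW V]) auto
  have single: "y = \<zero>\<^bsub>W\<^esub>" if y: "(\<zero>, y) \<in> VW.span (?f ` I)" for y
  proof -
    obtain a T where T: "finite T" "T \<subseteq> ?f ` I" and aT: "(\<zero>, y) = (\<Oplus>\<^bsub>?S\<^esub>p\<in>T. a p \<odot>\<^bsub>?S\<^esub> p)"
      using y unfolding VW.span_def VW.lincomb_def by blast
    \<comment> \<open>One index is kept for each pair occurring in the combination, so that its
      first component can be rewritten as a combination of the \<open>s i\<close>.\<close>
    obtain U where U: "U \<subseteq> I" "inj_on ?f U" "T = ?f ` U" using T(2) unfolding subset_image_inj by blast
    have Tc: "p \<in> carrier ?S" if "p \<in> T" for p using that T(2) QS by blast
    then have c: "a p \<odot>\<^bsub>?S\<^esub> p \<in> carrier ?S" if "p \<in> T" for p by (rule vs_smult_closed[OF VW]) (rule that)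
    have "\<zero> = fst (\<Oplus>\<^bsub>?S\<^esub>p\<in>T. a p \<odot>\<^bsub>?S\<^esub> p)" by (rule arg_cong[OF aT, of fst, unfolded fst_conv])
    also have "\<dots> = (\<Oplus>p\<in>?f ` U. fst (a p \<odot>\<^bsub>?S\<^esub> p))" unfolding U(3)[symmetric] by (rule linear_map_finsum[OF fst c])
    also have "\<dots> = (\<Oplus>i\<in>U. fst (a (?f i) \<odot>\<^bsub>?S\<^esub> ?f i))"
      by (rule V.finsum_reindex[OF _ U(2)]) (use c linear_mapD(3)[OF fst] U(3) in blast)
    finally have "(\<Oplus>i\<in>U. a (?f i) \<odot> s i) = \<zero>" by simp
    then have "\<forall>i\<in>U. a (?f i) = 0"
      by (rule indep[rotated 2]) (use T(1) U in \<open>auto simp: finite_image_iff\<close>)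
    then have "a p \<odot>\<^bsub>?S\<^esub> p = \<zero>\<^bsub>?S\<^esub>" if "p \<in> T" for p
      using that Tc[OF that] vs_smult_0[OF VW, of p] U(3) by auto
    then have "(\<Oplus>\<^bsub>?S\<^esub>p\<in>T. a p \<odot>\<^bsub>?S\<^esub> p) = (\<Oplus>\<^bsub>?S\<^esub>p\<in>T. \<zero>\<^bsub>?S\<^esub>)"
      by (intro VW.finsum_cong') (auto simp: vs_zero_closed[OF W])
    then show ?thesis using aT by simp
  qed
  show thesis
  proof (rule linear_selection_extend[OF V W L total sub le single])
    fix g assume g: "linmap V W g" "\<And>x. x \<in> carrier V \<Longrightarrow> (x, g x) \<in> L"
      "\<And>x y. (x, y) \<in> VW.span (?f ` I) \<Longrightarrow> g x = y"
    have gs: "g (s i) = t i" if "i \<in> I" for i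
      by (rule g(3)) (use that VW.in_own_span[OF QS] in blast)
    show thesis by (rule that[OF g(1,2)], assumption, rule gs)
  qed
qed

section \<open>Chains and homology of complexes on a finite ordered vertex set\<close>

text \<open>Meant for evaluation at a simplex, or at a cell and a simplex: sums in the records
  become ordinary sums of coefficients. Over an infinite index set both sides are zero by
  convention.\<close>

lemma finsum_additive:
  fixes V :: "('k::field, 'v) module" (structure) and h :: "'v \<Rightarrow> 'b::comm_monoid_add"
  assumes V: "vspace V"
    and add: "\<And>x y. x \<in> carrier V \<Longrightarrow> y \<in> carrier V \<Longrightarrow> h (x \<oplus> y) = h x + h y"
    and zero: "h \<zero> = 0"
    and f: "\<And>i. i \<in> I \<Longrightarrow> f i \<in> carrier V"
  shows "h (\<Oplus>i\<in>I. f i) = (\<Sum>i\<in>I. h (f i))"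
proof -
  interpret V: vectorspace class_ring V by (rule V)
  show ?thesis using f
    by (induction I rule: infinite_finite_induct) (auto simp: zero add Pi_def)
qed

lemma a_kernel_eq: "a_kernel V W f = {x \<in> carrier V. f x = \<zero>\<^bsub>W\<^esub>}"
  by (simp add: a_kernel_def kernel_def)

lemma chains_simps [simp]:
  "\<zero>\<^bsub>chains K k\<^esub> = 0" "c \<oplus>\<^bsub>chains K k\<^esub> d = c + d" "a \<odot>\<^bsub>chains K k\<^esub> c = (\<lambda>\<sigma>. a * c \<sigma>)"
  by (simp_all add: chains_def fun_eq_iff)

lemma carrier_chains: "c \<in> carrier (chains K k) \<longleftrightarrow> (\<forall>\<sigma>. \<sigma> \<notin> simplices K k \<longrightarrow> c \<sigma> = 0)"
  by (simp add: chains_def)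

lemma vectorspace_chains: "vspace (chains K k :: ('k::field, 'p set \<Rightarrow> 'k) module)"
  by (rule vectorspaceI) (auto simp: carrier_chains fun_eq_iff algebra_simps)

text \<open>Coefficientwise, the boundary of a chain does not depend on the complex containing it.\<close>

definition bd :: "'p set \<Rightarrow> ('p \<Rightarrow> nat) \<Rightarrow> ('p set \<Rightarrow> 'k::field) \<Rightarrow> 'p set \<Rightarrow> 'k" where
  "bd P ord c \<tau> = (if \<tau> = {} \<or> \<not> \<tau> \<subseteq> P then 0
     else \<Sum>v\<in>P - \<tau>. (- 1) ^ card {w\<in>\<tau>. ord w < ord v} * c (insert v \<tau>))"

lemma bd_sum: "bd P ord (\<lambda>\<sigma>. \<Sum>i\<in>I. a i * f i \<sigma>) = (\<lambda>\<tau>. \<Sum>i\<in>I. a i * bd P ord (f i) \<tau>)"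
proof
  fix \<tau>
  have "(\<Sum>v\<in>P - \<tau>. (- 1) ^ card {w\<in>\<tau>. ord w < ord v} * (\<Sum>i\<in>I. a i * f i (insert v \<tau>))) =
    (\<Sum>v\<in>P - \<tau>. \<Sum>i\<in>I. a i * ((- 1) ^ card {w\<in>\<tau>. ord w < ord v} * f i (insert v \<tau>)))"
    by (simp add: sum_distrib_left mult.left_commute)
  also have "\<dots> = (\<Sum>i\<in>I. \<Sum>v\<in>P - \<tau>. a i * ((- 1) ^ card {w\<in>\<tau>. ord w < ord v} * f i (insert v \<tau>)))"
    by (rule sum.swap)
  finally show "bd P ord (\<lambda>\<sigma>. \<Sum>i\<in>I. a i * f i \<sigma>) \<tau> = (\<Sum>i\<in>I. a i * bd P ord (f i) \<tau>)"
    by (simp add: bd_def sum_distrib_left)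
qed

lemma bd_add: "bd P ord (c + d) = bd P ord c + bd P ord d"
  by (auto simp: fun_eq_iff bd_def sum.distrib algebra_simps)

lemma bd_smult: "bd P ord (\<lambda>\<sigma>. a * c \<sigma>) = (\<lambda>\<tau>. a * bd P ord c \<tau>)"
  by (auto simp: fun_eq_iff bd_def sum_distrib_left mult_ac)

lemma bd_zero [simp]: "bd P ord 0 = 0"
  by (auto simp: fun_eq_iff bd_def)

lemma bd_diff: "bd P ord (c - d) = bd P ord c - bd P ord d"
  by (auto simp: fun_eq_iff bd_def sum_subtractf algebra_simps)

text \<open>The coefficient at \<tau> is a sum over ordered pairs of vertices to be added to \<tau>.
  Exchanging the two vertices changes the sign of the term, because in exactly one of the two orders
  the vertex added first is counted by the sign of the second.\<close>

lemma bd_bd: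
  fixes c :: "'p set \<Rightarrow> 'k::field"
  assumes P: "finite P" and inj: "inj_on ord P"
  shows "bd P ord (bd P ord c) = 0"
proof
  fix \<tau>
  show "bd P ord (bd P ord c) \<tau> = 0 \<tau>"
  proof (cases "\<tau> = {} \<or> \<not> \<tau> \<subseteq> P")
    case True
    then show ?thesis by (simp add: bd_def)
  next
    case False
    then have \<tau>: "\<tau> \<noteq> {}" "\<tau> \<subseteq> P" "finite \<tau>" using P finite_subset by auto
    define s :: "'p \<Rightarrow> 'p set \<Rightarrow> 'k" where "s v \<rho> = (- 1) ^ card {w\<in>\<rho>. ord w < ord v}" for v \<rho>
    define f where "f p = s (fst p) \<tau> * s (snd p) (insert (fst p) \<tau>) * c (insert (snd p) (insert (fst p) \<tau>))" for p
    let ?A = "{p \<in> (P - \<tau>) \<times> (P - \<tau>). ord (fst p) < ord (snd p)}"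
    let ?B = "{p \<in> (P - \<tau>) \<times> (P - \<tau>). ord (snd p) < ord (fst p)}"
    have s: "s w (insert v \<tau>) = (if ord v < ord w then - s w \<tau> else s w \<tau>)" if "v \<notin> \<tau>" for v w
    proof -
      have "{x \<in> insert v \<tau>. ord x < ord w} =
          (if ord v < ord w then insert v {x \<in> \<tau>. ord x < ord w} else {x \<in> \<tau>. ord x < ord w})" by auto
      then show ?thesis using that \<tau>(3) by (simp add: s_def)
    qed
    have anti: "f (prod.swap p) = - f p" if "p \<in> ?A" for p
      using that by (auto simp: f_def s insert_commute)
    have "bd P ord (bd P ord c) \<tau> = (\<Sum>v\<in>P - \<tau>. s v \<tau> * (\<Sum>w\<in>P - insert v \<tau>. s w (insert v \<tau>) * c (insert w (insert v \<tau>))))"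
      using \<tau> by (auto simp: bd_def s_def intro!: sum.cong)
    also have "\<dots> = (\<Sum>v\<in>P - \<tau>. \<Sum>w\<in>P - insert v \<tau>. f (v, w))"
      by (simp add: f_def sum_distrib_left mult.assoc)
    also have "\<dots> = sum f (SIGMA v:P - \<tau>. P - insert v \<tau>)"
      using P by (simp add: sum.Sigma)
    \<comment> \<open>Injectivity of \<open>ord\<close> splits the pairs of distinct vertices into
      two halves that \<open>prod.swap\<close> exchanges.\<close>
    also have "(SIGMA v:P - \<tau>. P - insert v \<tau>) = ?A \<union> ?B"
    proof -
      have "ord v < ord w \<or> ord w < ord v" if "v \<in> P" "w \<in> P" "v \<noteq> w" for v w
        using that inj by (metis inj_on_eq_iff linorder_less_linear)
      then show ?thesis by (auto split: prod.splits) (metis order.asym)+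
    qed
    also have "sum f (?A \<union> ?B) = sum f ?A + sum f ?B"
      using P by (intro sum.union_disjoint) auto
    also have "sum f ?B = (\<Sum>p\<in>?A. f (prod.swap p))"
      by (rule sum.reindex_bij_witness[of _ prod.swap prod.swap]) auto
    also have "\<dots> = - sum f ?A" using anti by (simp add: sum_negf)
    finally show ?thesis by simp
  qed
qed

section \<open>Chains, cycles and homology of subcomplexes\<close>

definition subcomplex :: "'p set \<Rightarrow> 'p set set \<Rightarrow> bool" where
  "subcomplex P K \<longleftrightarrow> (\<forall>\<sigma>\<in>K. \<sigma> \<noteq> {} \<and> \<sigma> \<subseteq> P \<and> (\<forall>\<tau>\<subseteq>\<sigma>. \<tau> \<noteq> {} \<longrightarrow> \<tau> \<in> K))"

lemma simplices_mono: "K \<subseteq> L \<Longrightarrow> simplices K k \<subseteq> simplices L k"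
  by (auto simp: simplices_def)

lemma chains_mono: "K \<subseteq> L \<Longrightarrow> carrier (chains K k) \<subseteq> carrier (chains L k)"
  using simplices_mono[of K L k] by (force simp: carrier_chains)

lemma chains_sum:
  assumes "\<And>i. i \<in> I \<Longrightarrow> f i \<in> carrier (chains K k)"
  shows "(\<lambda>\<sigma>. \<Sum>i\<in>I. a i * f i \<sigma>) \<in> carrier (chains K k)"
  using assms by (auto simp: carrier_chains intro!: sum.neutral)

lemma chains_add: "c \<in> carrier (chains K k) \<Longrightarrow> d \<in> carrier (chains K k) \<Longrightarrow> c + d \<in> carrier (chains K k)"
  and chains_diff: "c \<in> carrier (chains K k) \<Longrightarrow> d \<in> carrier (chains K k) \<Longrightarrow> c - d \<in> carrier (chains K k)"
  and chains_smult: "c \<in> carrier (chains K k) \<Longrightarrow> (\<lambda>\<sigma>. a * c \<sigma>) \<in> carrier (chains K k)"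
  and chains_zero [simp]: "0 \<in> carrier (chains K k)"
  by (auto simp: carrier_chains)

locale ordered_vertices =
  fixes P :: "'p set" and ord :: "'p \<Rightarrow> nat"
  assumes finite_P: "finite P" and inj_ord: "inj_on ord P"
begin

abbreviation D :: "('p set \<Rightarrow> 'k::field) \<Rightarrow> 'p set \<Rightarrow> 'k" where "D \<equiv> bd P ord"

lemmas D_D = bd_bd[OF finite_P inj_ord]

lemma simplexD:
  assumes "subcomplex P K" "\<sigma> \<in> simplices K k"
  shows "\<sigma> \<in> K" "\<sigma> \<noteq> {}" "\<sigma> \<subseteq> P" "finite \<sigma>" "int (card \<sigma>) = k + 1"
  using assms finite_subset[OF _ finite_P] by (auto simp: subcomplex_def simplices_def)

lemma finite_simplices: "subcomplex P K \<Longrightarrow> finite (simplices K k)"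
  by (rule finite_subset[of _ "Pow P"]) (auto dest: simplexD(3) simp: finite_P)

lemma face_simplex:
  assumes K: "subcomplex P K" and \<sigma>: "insert v \<tau> \<in> simplices K k" and "v \<notin> \<tau>" "\<tau> \<noteq> {}"
  shows "\<tau> \<in> simplices K (k - 1)"
proof -
  note d = simplexD[OF K \<sigma>]
  have "\<tau> \<in> K" using K d(1) assms(4) by (auto simp: subcomplex_def)
  then show ?thesis using d(4,5) assms(3) by (auto simp: simplices_def)
qed

text \<open>Closure under faces: if \<open>c\<close> has a nonzero coefficient at
  \<open>insert v \<tau>\<close>, then \<tau> is a simplex of \<open>K\<close>. Hence the sum over
  all vertices of \<open>P\<close> in \<open>bd\<close> never leaves \<open>K\<close>.\<close>

lemma D_eq_0:
  assumes K: "subcomplex P K" and c: "c \<in> carrier (chains K k)" and \<tau>: "\<tau> \<notin> simplices K (k - 1)"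
  shows "D c \<tau> = 0"
proof (cases "\<tau> = {} \<or> \<not> \<tau> \<subseteq> P")
  case True
  then show ?thesis by (simp add: bd_def)
next
  case False
  have "c (insert v \<tau>) = 0" if "v \<in> P - \<tau>" for v
    using face_simplex[OF K, of v \<tau> k] \<tau> that False c by (auto simp: carrier_chains)
  then show ?thesis by (simp add: bd_def)
qed

lemma D_closed:
  "subcomplex P K \<Longrightarrow> c \<in> carrier (chains K k) \<Longrightarrow> D c \<in> carrier (chains K (k - 1))"
  using D_eq_0 by (auto simp: carrier_chains[of "D c"])

text \<open>For a fixed face \<tau>, a simplex together with a removed vertex amounts to the vertex
  added to \<tau>, and the signs agree since a vertex does not precede itself. After this the
  complex enters computations with boundaries only through the carriers of the chain groups.\<close>

lemma boundary_eq:
  assumes K: "subcomplex P K" and c: "c \<in> carrier (chains K k)"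
  shows "boundary ord K k c = D c"
proof
  fix \<tau>
  show "boundary ord K k c \<tau> = D c \<tau>"
  proof (cases "\<tau> \<in> simplices K (k - 1)")
    case False
    then show ?thesis using D_eq_0[OF K c] by (simp add: boundary_def)
  next
    case True
    note d = simplexD[OF K True]
    let ?g = "\<lambda>\<sigma> v. (- 1) ^ card {w\<in>\<sigma>. ord w < ord v} * c \<sigma>"
    let ?S = "SIGMA \<sigma>:simplices K k. {v. v \<in> \<sigma> \<and> \<sigma> - {v} = \<tau>}"
    have fin: "finite {v. v \<in> \<sigma> \<and> \<sigma> - {v} = \<tau>}" if "\<sigma> \<in> simplices K k" for \<sigma>
      using simplexD(4)[OF K that] by simp
    have "boundary ord K k c \<tau> = (\<Sum>p\<in>?S. ?g (fst p) (snd p))"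
      using True fin finite_simplices[OF K] by (simp add: boundary_def sum.Sigma split_def)
    also have "\<dots> = (\<Sum>v\<in>{v\<in>P - \<tau>. insert v \<tau> \<in> simplices K k}. ?g (insert v \<tau>) v)"
    proof (rule sum.reindex_bij_witness[of _ "\<lambda>v. (insert v \<tau>, v)" snd])
      fix p assume p: "p \<in> ?S"
      then have *: "fst p = insert (snd p) \<tau>" "snd p \<notin> \<tau>" "fst p \<in> simplices K k" by auto
      then show "(insert (snd p) \<tau>, snd p) = p" by (metis prod.collapse)
      show "snd p \<in> {v \<in> P - \<tau>. insert v \<tau> \<in> simplices K k}"
        using * simplexD(3)[OF K *(3)] by auto
      show "?g (insert (snd p) \<tau>) (snd p) = ?g (fst p) (snd p)" using * by simp
    qed auto
    also have "\<dots> = (\<Sum>v\<in>P - \<tau>. ?g (insert v \<tau>) v)"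
      using finite_P c by (intro sum.mono_neutral_left) (auto simp: carrier_chains)
    also have "\<dots> = D c \<tau>"
    proof -
      have "{w \<in> insert v \<tau>. ord w < ord v} = {w \<in> \<tau>. ord w < ord v}" for v by auto
      then show ?thesis using d by (simp add: bd_def)
    qed
    finally show ?thesis .
  qed
qed

lemma cycles_eq: "subcomplex P K \<Longrightarrow> cycles ord K k = {c \<in> carrier (chains K k). D c = 0}"
  by (auto simp: cycles_def a_kernel_eq boundary_eq)

lemma boundaries_eq: "subcomplex P K \<Longrightarrow> boundaries ord K k = D ` carrier (chains K (k + 1))"
  by (auto simp: boundaries_def boundary_eq image_iff)

lemma cyclesD:
  assumes "subcomplex P K" "c \<in> cycles ord K k"
  shows "c \<in> carrier (chains K k)" "D c = 0"
  using assms by (auto simp: cycles_eq)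

context
  fixes K :: "'p set set" and k :: int
  assumes K: "subcomplex P K"
begin

lemma subspace_cycles: "subsp (cycles ord K k) (chains K k :: ('k::field, _) module)"
  by (rule vs_subspaceI[OF vectorspace_chains])
    (auto simp: cycles_eq[OF K] bd_add bd_smult chains_add chains_smult fun_eq_iff[of _ 0])

definition cycle_space :: "('k::field, 'p set \<Rightarrow> 'k) module" where
  "cycle_space = (chains K k)\<lparr>carrier := cycles ord K k\<rparr>"

lemma cycle_space_simps [simp]:
  "carrier cycle_space = cycles ord K k" "\<zero>\<^bsub>cycle_space\<^esub> = 0" "c \<oplus>\<^bsub>cycle_space\<^esub> d = c + d"
  "a \<odot>\<^bsub>cycle_space\<^esub> c = (\<lambda>\<sigma>. a * c \<sigma>)"
  by (simp_all add: cycle_space_def)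

lemma vectorspace_cycles: "vspace (cycle_space :: ('k::field, _) module)"
  unfolding cycle_space_def by (rule vs_subspaceD[OF vectorspace_chains subspace_cycles])

lemma cycle_space_diff:
  assumes "c \<in> cycles ord K k" "d \<in> cycles ord K k"
  shows "c \<ominus>\<^bsub>cycle_space\<^esub> d = c - d"
  using vs_diff[OF vectorspace_cycles, of c d] assms by (simp add: fun_eq_iff)

lemma boundaries_cycles: "boundaries ord K k \<subseteq> cycles ord K k"
  using D_closed[OF K, of _ "k + 1"] by (auto simp: cycles_eq[OF K] boundaries_eq[OF K] D_D)

lemma subspace_boundaries:
  "subsp (boundaries ord K k) (cycle_space :: ('k::field, _) module)"
proof (rule vs_subspaceI[OF vectorspace_cycles])
  let ?C = "carrier (chains K (k + 1)) :: ('p set \<Rightarrow> 'k) set"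
  show "\<zero>\<^bsub>cycle_space\<^esub> \<in> (boundaries ord K k :: ('p set \<Rightarrow> 'k) set)"
    unfolding boundaries_eq[OF K] by (rule image_eqI[of _ _ 0]) auto
  fix x :: "'p set \<Rightarrow> 'k" assume "x \<in> boundaries ord K k"
  then obtain c where c: "x = D c" "c \<in> ?C" by (auto simp: boundaries_eq[OF K])
  show "a \<odot>\<^bsub>cycle_space\<^esub> x \<in> boundaries ord K k" for a
    unfolding boundaries_eq[OF K] c using c(2) by (intro image_eqI[of _ _ "\<lambda>\<sigma>. a * c \<sigma>"]) (auto simp: bd_smult chains_smult)
  fix y :: "'p set \<Rightarrow> 'k" assume "y \<in> boundaries ord K k"
  then obtain d where d: "y = D d" "d \<in> ?C" by (auto simp: boundaries_eq[OF K])
  show "x \<oplus>\<^bsub>cycle_space\<^esub> y \<in> boundaries ord K k"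
    unfolding boundaries_eq[OF K] c d using c(2) d(2) by (intro image_eqI[of _ _ "c + d"]) (auto simp: bd_add chains_add)
qed (use boundaries_cycles in auto)

lemma homology_eq: "homology ord K k = quotient_space cycle_space (boundaries ord K k)"
  by (simp add: homology_def cycle_space_def)

text \<open>\<open>homology_class\<close> forms cosets in the chain group, \<open>homology\<close>
  in the space of cycles; both add pointwise, so the cosets are the same sets.\<close>

lemma homology_class_eq: "homology_class ord K k = (\<lambda>c. boundaries ord K k +>\<^bsub>cycle_space\<^esub> c)"
  by (simp add: homology_class_def[abs_def] a_r_coset_eq)

lemma carrier_homology: "carrier (homology ord K k) = homology_class ord K k ` cycles ord K k"
  unfolding homology_eq homology_class_eq
  using quotient_space_surj[OF vectorspace_cycles subspace_boundaries] by simp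

lemma linear_homology_class:
  "linmap cycle_space (homology ord K k) (homology_class ord K k :: ('p set \<Rightarrow> 'k::field) \<Rightarrow> _)"
  unfolding homology_eq homology_class_eq
  by (rule quotient_space_linear[OF vectorspace_cycles subspace_boundaries])

lemma homology_class_eq_iff:
  fixes c d :: "'p set \<Rightarrow> 'k::field"
  assumes "c \<in> cycles ord K k" "d \<in> cycles ord K k"
  shows "homology_class ord K k c = homology_class ord K k d \<longleftrightarrow> c - d \<in> boundaries ord K k"
  unfolding homology_class_eq
  using quotient_space_eq_iff[OF vectorspace_cycles subspace_boundaries, of c d] assms
  by (simp add: cycle_space_diff)

lemma homology_class_zero_iff:
  fixes c :: "'p set \<Rightarrow> 'k::field"
  assumes "c \<in> cycles ord K k"
  shows "homology_class ord K k c = \<zero>\<^bsub>homology ord K k\<^esub> \<longleftrightarrow> c \<in> boundaries ord K k"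
proof -
  have "(0 :: 'p set \<Rightarrow> 'k) \<in> cycles ord K k" by (auto simp: cycles_eq[OF K])
  moreover have "homology_class ord K k (0 :: 'p set \<Rightarrow> 'k) = \<zero>\<^bsub>homology ord K k\<^esub>"
    using linear_mapD(6)[OF linear_homology_class] by simp
  ultimately show ?thesis using homology_class_eq_iff[OF assms, of 0] by simp
qed

lemmas vectorspace_homology = linear_mapD(2)[OF linear_homology_class]

lemma homology_class_sum:
  fixes f :: "'i \<Rightarrow> 'p set \<Rightarrow> 'k::field"
  assumes f: "\<And>i. i \<in> I \<Longrightarrow> f i \<in> cycles ord K k"
  shows "homology_class ord K k (\<lambda>\<sigma>. \<Sum>i\<in>I. a i * f i \<sigma>) =
    (\<Oplus>\<^bsub>homology ord K k\<^esub>i\<in>I. a i \<odot>\<^bsub>homology ord K k\<^esub> homology_class ord K k (f i))"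
proof -
  have af: "(\<lambda>\<sigma>. a i * f i \<sigma>) \<in> cycles ord K k" if "i \<in> I" for i
    using vs_smult_closed[OF vectorspace_cycles, of "f i" "a i"] f[OF that] by simp
  have "(\<Oplus>\<^bsub>cycle_space\<^esub>i\<in>I. (\<lambda>\<sigma>. a i * f i \<sigma>)) \<tau> = (\<Sum>i\<in>I. a i * f i \<tau>)" for \<tau>
    using finsum_additive[OF vectorspace_cycles, of "\<lambda>c. c \<tau>" I "\<lambda>i \<sigma>. a i * f i \<sigma>"] af by simp
  then have "(\<lambda>\<sigma>. \<Sum>i\<in>I. a i * f i \<sigma>) = (\<Oplus>\<^bsub>cycle_space\<^esub>i\<in>I. (\<lambda>\<sigma>. a i * f i \<sigma>))" by (intro ext) simp
  then have "homology_class ord K k (\<lambda>\<sigma>. \<Sum>i\<in>I. a i * f i \<sigma>) =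
      (\<Oplus>\<^bsub>homology ord K k\<^esub>i\<in>I. homology_class ord K k (\<lambda>\<sigma>. a i * f i \<sigma>))"
    using linear_map_finsum[OF linear_homology_class, of I "\<lambda>i \<sigma>. a i * f i \<sigma>"] af by simp
  also have "\<dots> = (\<Oplus>\<^bsub>homology ord K k\<^esub>i\<in>I. a i \<odot>\<^bsub>homology ord K k\<^esub> homology_class ord K k (f i))"
  proof -
    interpret H: vectorspace class_ring "homology ord K k :: ('k, _) module" by (rule vectorspace_homology)
    have "homology_class ord K k (\<lambda>\<sigma>. a i * f i \<sigma>) = a i \<odot>\<^bsub>homology ord K k\<^esub> homology_class ord K k (f i)"
      "a i \<odot>\<^bsub>homology ord K k\<^esub> homology_class ord K k (f i) \<in> carrier (homology ord K k)" if "i \<in> I" for i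
      using linear_mapD(5)[OF linear_homology_class, of "f i" "a i"] f[OF that]
        linear_mapD(3)[OF linear_homology_class, of "f i"]
      by (simp_all add: vs_smult_closed[OF vectorspace_homology])
    then show ?thesis by (intro H.finsum_cong') auto
  qed
  finally show ?thesis .
qed

end

lemma homology_map_class:
  fixes c :: "'p set \<Rightarrow> 'k::field"
  assumes K: "subcomplex P K" and L: "subcomplex P L" and "K \<subseteq> L" and c: "c \<in> cycles ord K k"
  shows "homology_map ord L k (homology_class ord K k c) = homology_class ord L k c"
    and "c \<in> cycles ord L k"
proof -
  have cyc: "cycles ord K k \<subseteq> (cycles ord L k :: ('p set \<Rightarrow> 'k) set)"
    using chains_mono[OF \<open>K \<subseteq> L\<close>] by (auto simp: cycles_eq K L)
  then show "c \<in> cycles ord L k" using c by auto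
  have bds: "boundaries ord K k \<subseteq> (boundaries ord L k :: ('p set \<Rightarrow> 'k) set)"
    using chains_mono[OF \<open>K \<subseteq> L\<close>] unfolding boundaries_eq[OF K] boundaries_eq[OF L] by auto
  have lin: "linmap (cycle_space K k) (cycle_space L k :: ('k, _) module) (\<lambda>c. c)"
    using cyc by (intro linear_mapI vectorspace_cycles K L) (auto simp: K L)
  have "quotient_map (cycle_space L k) (boundaries ord L k) (\<lambda>c. c)
     (boundaries ord K k +>\<^bsub>cycle_space K k\<^esub> c) = boundaries ord L k +>\<^bsub>cycle_space L k\<^esub> c"
    using quotient_map_coset[OF vectorspace_cycles subspace_boundaries vectorspace_cycles subspace_boundaries lin]
      K L bds c by simp
  then show "homology_map ord L k (homology_class ord K k c) = homology_class ord L k c"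
    by (simp add: homology_map_def homology_class_eq K L quotient_map_def a_r_coset_eq)
qed

end

section \<open>The Mayer-Vietoris sequence of a cover with one-dimensional nerve\<close>

locale graph_covering = ordered_vertices P ord
  for P :: "'p set" and ord :: "'p \<Rightarrow> nat" +
  fixes \<V> :: "'p set set" and orient :: "'p set set \<Rightarrow> 'p set"
  assumes finite_cover: "finite \<V>" and nonempty_cover: "{} \<notin> \<V>" and Union_cover: "\<Union>\<V> = P"
    and nerve_dim: "has_dimension (nerve \<V>) 1"
    and orient: "\<And>e. e \<in> simplices (nerve \<V>) 1 \<Longrightarrow> orient e \<in> e"
begin

abbreviation cells :: "int \<Rightarrow> 'p set set set" where "cells \<equiv> simplices (nerve \<V>)"
abbreviation verts :: "'p set set set" where "verts \<equiv> simplices (nerve \<V>) 0"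
abbreviation edges :: "'p set set set" where "edges \<equiv> simplices (nerve \<V>) 1"
abbreviation inc :: "'p set set \<Rightarrow> 'p set set \<Rightarrow> 'k::field" where "inc \<equiv> incidence orient"

section \<open>The nerve: vertices, edges and orientation\<close>

lemma vertex_iff: "v \<in> verts \<longleftrightarrow> (\<exists>U\<in>\<V>. v = {U})"
proof
  assume "v \<in> verts"
  then show "\<exists>U\<in>\<V>. v = {U}" by (auto simp: simplices_def nerve_def card_1_singleton_iff)
next
  assume "\<exists>U\<in>\<V>. v = {U}"
  then show "v \<in> verts" using nonempty_cover by (auto simp: simplices_def nerve_def)
qed

lemma edge_iff: "e \<in> edges \<longleftrightarrow> (\<exists>U W. U \<in> \<V> \<and> W \<in> \<V> \<and> U \<noteq> W \<and> U \<inter> W \<noteq> {} \<and> e = {U, W})"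
proof
  assume "e \<in> edges"
  then have e: "card e = 2" "e \<subseteq> \<V>" "\<Inter>e \<noteq> {}" by (simp_all add: simplices_def nerve_def)
  from e(1) obtain U W where UW: "e = {U, W}" "U \<noteq> W" unfolding card_2_iff by blast
  show "\<exists>U W. U \<in> \<V> \<and> W \<in> \<V> \<and> U \<noteq> W \<and> U \<inter> W \<noteq> {} \<and> e = {U, W}"
    by (rule exI[of _ U], rule exI[of _ W]) (use UW e in simp)
next
  assume "\<exists>U W. U \<in> \<V> \<and> W \<in> \<V> \<and> U \<noteq> W \<and> U \<inter> W \<noteq> {} \<and> e = {U, W}"
  then obtain U W where UW: "U \<in> \<V>" "W \<in> \<V>" "U \<noteq> W" "U \<inter> W \<noteq> {}" "e = {U, W}" by blast
  then have "card e = 2" by simp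
  then show "e \<in> edges" using UW by (simp add: simplices_def nerve_def)
qed

lemma finite_verts: "finite verts" and finite_edges: "finite edges"
  using finite_cover by (auto simp: simplices_def nerve_def intro: finite_subset[of _ "Pow \<V>"])

text \<open>Three distinct cover elements through a point would form a simplex of dimension 2 of the
  nerve.\<close>

lemma no_triple:
  assumes "U \<in> \<V>" "W \<in> \<V>" "X \<in> \<V>" "p \<in> U" "p \<in> W" "p \<in> X"
  shows "U = W \<or> U = X \<or> W = X"
proof (rule ccontr)
  assume "\<not> ?thesis"
  then have "card {U, W, X} = 3" by simp
  moreover have "\<Inter>{U, W, X} \<noteq> {}" using assms by blast
  ultimately have "{U, W, X} \<in> simplices (nerve \<V>) 2" using assms by (simp add: simplices_def nerve_def)
  then show False using nerve_dim unfolding has_dimension_def by force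
qed

text \<open>A point lies in at most two cover elements, so different edges have disjoint
  intersections. This makes the coefficients of \<open>E x\<close> readable one edge at a
  time.\<close>

lemma edge_unique:
  assumes "e \<in> edges" "e' \<in> edges" "p \<in> \<Inter>e" "p \<in> \<Inter>e'"
  shows "e = e'"
proof -
  obtain U W where e: "U \<in> \<V>" "W \<in> \<V>" "U \<noteq> W" "e = {U, W}" using assms(1) edge_iff by auto
  obtain X Y where e': "X \<in> \<V>" "Y \<in> \<V>" "X \<noteq> Y" "e' = {X, Y}" using assms(2) edge_iff by auto
  have "U = X \<or> W = X" "U = Y \<or> W = Y"
    using no_triple[of U W X p] no_triple[of U W Y p] e e' assms(3,4) by auto
  then show ?thesis using e e' by auto
qed

lemma vertices_of_edge:
  assumes "e \<in> edges"
  obtains W where "e = {orient e, W}" "W \<noteq> orient e" "orient e \<in> \<V>" "W \<in> \<V>"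
    "{v \<in> verts. v \<subseteq> e} = {{orient e}, {W}}"
proof -
  obtain X Y where e: "X \<in> \<V>" "Y \<in> \<V>" "X \<noteq> Y" "e = {X, Y}" using assms(1) edge_iff by auto
  define W where "W = (if orient e = X then Y else X)"
  have o: "orient e = X \<or> orient e = Y" using orient[OF assms] unfolding e(4) by simp
  have "{X, Y} = {orient e, W}" using o by (auto simp: W_def)
  then have *: "e = {orient e, W}" unfolding e(4)[symmetric] .
  have **: "W \<noteq> orient e" "orient e \<in> \<V>" "W \<in> \<V>"
    using e(1-3) o by (auto simp: W_def)
  have "U \<in> e \<longleftrightarrow> U = orient e \<or> U = W" for U using * by (metis insert_iff singletonD)
  then have "{v \<in> verts. v \<subseteq> e} = {{orient e}, {W}}"
    using ** by (auto simp: vertex_iff)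
  then show thesis using that * ** by blast
qed

lemma head_vertex: "e \<in> edges \<Longrightarrow> {orient e} \<in> verts" "e \<in> edges \<Longrightarrow> {orient e} \<subseteq> e"
proof -
  assume e: "e \<in> edges"
  obtain W where W: "e = {orient e, W}" "W \<noteq> orient e" "orient e \<in> \<V>" "W \<in> \<V>"
    "{v \<in> verts. v \<subseteq> e} = {{orient e}, {W}}" by (rule vertices_of_edge[OF e])
  then show "{orient e} \<in> verts" "{orient e} \<subseteq> e" using orient[OF e] by (simp_all add: vertex_iff)
qed

text \<open>The map \<open>e_map\<close> on plain families, not restricted to the vertices, so that
  its additivity is an equation of functions without side conditions.\<close>

definition E :: "(('p, 'k::field) chain_family) \<Rightarrow> ('p, 'k) chain_family" where
  "E x v = (\<lambda>\<sigma>. \<Sum>e\<in>{e \<in> edges. v \<subseteq> e}. inc v e * x e \<sigma>)"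

definition J :: "(('p, 'k::field) chain_family) \<Rightarrow> 'p set \<Rightarrow> 'k" where
  "J u = (\<lambda>\<sigma>. \<Sum>v\<in>verts. u v \<sigma>)"

lemma E_add: "E (x + y) = E x + E y"
  and E_diff: "E (x - y) = E x - E y"
  and E_smult: "E (\<lambda>e \<sigma>. a * x e \<sigma>) = (\<lambda>v \<sigma>. a * E x v \<sigma>)"
  and E_zero [simp]: "E 0 = 0"
  by (simp_all add: E_def fun_eq_iff sum.distrib sum_subtractf sum_distrib_left algebra_simps)

lemma J_add: "J (x + y) = J x + J y"
  and J_diff: "J (x - y) = J x - J y"
  and J_smult: "J (\<lambda>v \<sigma>. a * x v \<sigma>) = (\<lambda>\<sigma>. a * J x \<sigma>)"
  and J_zero [simp]: "J 0 = 0"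
  by (simp_all add: J_def fun_eq_iff sum.distrib sum_subtractf sum_distrib_left algebra_simps)

lemma E_cong: "(\<And>e. e \<in> edges \<Longrightarrow> x e = y e) \<Longrightarrow> E x = E y"
  by (auto simp: E_def fun_eq_iff intro!: sum.cong)

lemma J_cong: "(\<And>v. v \<in> verts \<Longrightarrow> u v = w v) \<Longrightarrow> J u = J w"
  by (auto simp: J_def fun_eq_iff intro!: sum.cong)

lemma D_E: "D (E x v) = E (\<lambda>e. D (x e)) v"
  by (simp add: E_def bd_sum)

lemma D_J: "D (J u) = J (\<lambda>v. D (u v))"
  using bd_sum[where I = verts and a = "\<lambda>_. 1" and f = u] by (simp add: J_def)

text \<open>After exchanging the two sums, each edge contributes through its two endpoints, whose
  incidence numbers are 1 and -1.\<close>

lemma J_E: "J (E x) = (0 :: 'p set \<Rightarrow> 'k::field)"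
proof
  fix \<sigma>
  have "J (E x) \<sigma> = (\<Sum>v\<in>verts. \<Sum>e | e \<in> edges \<and> v \<subseteq> e. inc v e * x e \<sigma>)"
    by (simp add: J_def E_def)
  also have "\<dots> = (\<Sum>e\<in>edges. \<Sum>v | v \<in> verts \<and> v \<subseteq> e. inc v e * x e \<sigma>)"
    by (rule sum.swap_restrict[OF finite_verts finite_edges])
  also have "\<dots> = 0"
  proof (rule sum.neutral, rule ballI)
    fix e assume "e \<in> edges"
    then obtain W where W: "e = {orient e, W}" "W \<noteq> orient e" "orient e \<in> \<V>" "W \<in> \<V>"
      "{v \<in> verts. v \<subseteq> e} = {{orient e}, {W}}" by (rule vertices_of_edge)
    from W(2,5) show "(\<Sum>v | v \<in> verts \<and> v \<subseteq> e. inc v e * x e \<sigma>) = 0"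
      by (simp add: incidence_def)
  qed
  finally show "J (E x) \<sigma> = 0 \<sigma>" by simp
qed

end

text \<open>The abstract setting of the Mayer-Vietoris argument. The bound on the parameter enters
  through \<open>covered\<close>, which yields the surjectivity of \<open>J\<close>; injectivity of
  \<open>E\<close> and exactness in the middle rest on the shape of the nerve.\<close>

locale covered_complex = graph_covering P ord \<V> orient
  for P :: "'p set" and ord \<V> orient +
  fixes K :: "'p set set" and R :: "'p set set \<Rightarrow> 'p set set"
  assumes K: "subcomplex P K"
    and covered: "\<And>\<sigma>. \<sigma> \<in> K \<Longrightarrow> \<exists>U\<in>\<V>. \<sigma> \<subseteq> U"
    and R_eq: "\<And>c. c \<in> nerve \<V> \<Longrightarrow> R c = {\<sigma> \<in> K. \<sigma> \<subseteq> \<Inter>c}"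
begin

text \<open>Only the values at cells of dimension \<open>j\<close> are constrained, in contrast to
  the extensional carriers of \<open>dsum\<close>. Families are therefore added and subtracted as
  plain functions, and equations between them are stated at cells only.\<close>

definition chain_fams :: "int \<Rightarrow> int \<Rightarrow> (('p, 'k::field) chain_family) set" where
  "chain_fams j k = {x. \<forall>c\<in>cells j. x c \<in> carrier (chains (R c) k)}"

lemma cell_nerve: "c \<in> cells j \<Longrightarrow> c \<in> nerve \<V>"
  by (simp add: simplices_def)

lemma R_iff: "c \<in> cells j \<Longrightarrow> \<sigma> \<in> R c \<longleftrightarrow> \<sigma> \<in> K \<and> \<sigma> \<subseteq> \<Inter>c"
  using R_eq[OF cell_nerve] by simp

lemma R_sub: "c \<in> cells j \<Longrightarrow> R c \<subseteq> K"
  using R_eq[OF cell_nerve] by auto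

lemma R_subcomplex:
  assumes "c \<in> cells j"
  shows "subcomplex P (R c)"
  using K unfolding subcomplex_def R_eq[OF cell_nerve[OF assms]] by blast

lemma R_face: "e \<in> edges \<Longrightarrow> v \<in> verts \<Longrightarrow> v \<subseteq> e \<Longrightarrow> R e \<subseteq> R v"
  unfolding R_eq[OF cell_nerve[of e 1]] R_eq[OF cell_nerve[of v 0]] by blast

lemma simplex_R_iff:
  "c \<in> cells j \<Longrightarrow> \<sigma> \<in> simplices (R c) k \<longleftrightarrow> \<sigma> \<in> simplices K k \<and> \<sigma> \<subseteq> \<Inter>c"
  using R_iff[of c j \<sigma>] by (auto simp: simplices_def)

lemma E_closed:
  assumes x: "x \<in> chain_fams 1 k" and v: "v \<in> verts"
  shows "E x v \<in> carrier (chains (R v) k)"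
  unfolding E_def
proof (rule chains_sum)
  fix e assume "e \<in> {e \<in> edges. v \<subseteq> e}"
  then show "x e \<in> carrier (chains (R v) k)"
    using x v chains_mono[OF R_face, of e v k] by (auto simp: chain_fams_def)
qed

lemma J_closed: "u \<in> chain_fams 0 k \<Longrightarrow> J u \<in> carrier (chains K k)"
  using chains_sum[of verts u K k "\<lambda>_. 1"] chains_mono[OF R_sub, of _ 0 k]
  unfolding J_def chain_fams_def by auto

text \<open>At a simplex of \<open>R e\<close> the other edges contribute nothing, since a nonempty
  simplex lies in the intersection of at most one edge.\<close>

lemma E_value:
  assumes x: "x \<in> chain_fams 1 k" and e: "e \<in> edges" "v \<subseteq> e" and \<sigma>: "\<sigma> \<in> R e"
  shows "E x v \<sigma> = inc v e * x e \<sigma>"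
proof -
  have "inc v e' * x e' \<sigma> = 0" if e': "e' \<in> edges" "e' \<noteq> e" for e'
  proof (rule ccontr)
    assume "inc v e' * x e' \<sigma> \<noteq> 0"
    then have "\<sigma> \<in> R e'" using x e' by (auto simp: chain_fams_def carrier_chains simplices_def)
    then have "\<sigma> \<subseteq> \<Inter>e'" "\<sigma> \<subseteq> \<Inter>e" "\<sigma> \<noteq> {}"
      using \<sigma> e e' R_iff K by (auto simp: subcomplex_def)
    then show False using edge_unique[OF e(1) e'(1)] e'(2) by (metis ex_in_conv subsetD)
  qed
  then have "E x v \<sigma> = (\<Sum>e'\<in>{e}. inc v e' * x e' \<sigma>)"
    unfolding E_def using e finite_edges by (intro sum.mono_neutral_right) auto
  then show ?thesis by simp
qed

text \<open>The coefficients of \<open>x e\<close> are read off at the head of the edge, where the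
  incidence number is 1.\<close>

lemma E_injective:
  assumes x: "x \<in> chain_fams 1 k" and 0: "\<And>v. v \<in> verts \<Longrightarrow> E x v = 0" and e: "e \<in> edges"
  shows "x e = (0 :: 'p set \<Rightarrow> 'k::field)"
proof
  fix \<sigma>
  show "x e \<sigma> = 0 \<sigma>"
  proof (cases "\<sigma> \<in> R e")
    case False
    then show ?thesis using x e by (auto simp: chain_fams_def carrier_chains simplices_def)
  next
    case True
    note o = head_vertex[OF e]
    then show ?thesis using E_value[OF x e o(2) True] 0[OF o(1)] by (simp add: incidence_def)
  qed
qed

text \<open>At a fixed simplex at most two vertices of the nerve can carry a coefficient, and two
  such vertices are joined by an edge. \<open>J u = 0\<close> makes their coefficients opposite,
  just as the incidence numbers of the two endpoints are.\<close>

lemma J_exact: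
  fixes u :: "('p, 'k::field) chain_family"
  assumes u: "u \<in> chain_fams 0 k" and Ju: "J u = 0"
  obtains x where "x \<in> chain_fams 1 k" "\<And>v. v \<in> verts \<Longrightarrow> u v = E x v"
proof -
  \<comment> \<open>By \<open>E_value\<close> this is the only possible choice: the head of
    \<open>e\<close> has incidence number 1.\<close>
  define x where "x e = (\<lambda>\<sigma>. if \<sigma> \<in> R e then u {orient e} \<sigma> else 0)" for e
  note o = head_vertex(1)
  have x: "x \<in> chain_fams 1 k"
    unfolding chain_fams_def carrier_chains mem_Collect_eq
  proof (intro ballI allI impI)
    fix e \<sigma> assume e: "e \<in> edges" and "\<sigma> \<notin> simplices (R e) k"
    then have "\<sigma> \<notin> R e \<or> \<sigma> \<notin> simplices (R {orient e}) k" by (auto simp: simplices_def)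
    then show "x e \<sigma> = 0" using u o[OF e] by (auto simp: x_def chain_fams_def carrier_chains)
  qed
  have supp: "\<sigma> \<in> simplices (R v) k" if "v \<in> verts" "u v \<sigma> \<noteq> 0" for v \<sigma>
    using u that by (auto simp: chain_fams_def carrier_chains)
  have "u v \<sigma> = E x v \<sigma>" if v: "v \<in> verts" for v \<sigma>
  proof (cases "\<sigma> \<in> simplices (R v) k")
    case False
    then show ?thesis using supp[OF v] E_closed[OF x v] by (auto simp: carrier_chains)
  next
    case True
    obtain U where U: "U \<in> \<V>" "v = {U}" using v vertex_iff by auto
    have "\<sigma> \<in> simplices K k" and \<sigma>U: "\<sigma> \<subseteq> U" using True simplex_R_iff[OF v] U by auto
    note \<sigma> = simplexD(1,2)[OF K this(1)] \<sigma>U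
    then obtain p where p: "p \<in> \<sigma>" "p \<in> U" by blast
    \<comment> \<open>Another vertex that carries a coefficient at \<sigma> forces an edge to it,
      with \<sigma> in the complex of that edge.\<close>
    have edge: "{U, X} \<in> edges \<and> \<sigma> \<in> R {U, X}" if "{X} \<in> verts" "u {X} \<sigma> \<noteq> 0" "X \<noteq> U" for X
    proof -
      have X: "\<sigma> \<subseteq> X" "X \<in> \<V>" using supp[OF that(1,2)] simplex_R_iff[OF that(1)] that(1) by (auto simp: vertex_iff)
      then have "{U, X} \<in> edges" using U p that(3) by (auto simp: edge_iff)
      then show ?thesis using R_iff[of _ 1] X \<sigma> by auto
    qed
    show ?thesis
    proof (cases "\<exists>e\<in>edges. v \<subseteq> e \<and> \<sigma> \<in> R e")
      case True
      then obtain e where e: "e \<in> edges" "v \<subseteq> e" "\<sigma> \<in> R e" by auto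
      then have Ex: "E x v \<sigma> = inc v e * u {orient e} \<sigma>" using E_value[OF x e] by (simp add: x_def)
      show ?thesis
      proof (cases "v = {orient e}")
        case True
        then show ?thesis using Ex by (simp add: incidence_def)
      next
        case False
        \<comment> \<open>Here \<open>v\<close> is the tail of \<open>e\<close>, and the head is the
          only other vertex that can carry a coefficient at \<sigma>.\<close>
        then have ne1: "orient e \<noteq> U" using U by auto
        obtain W where W: "e = {orient e, W}" "W \<noteq> orient e" "orient e \<in> \<V>" "W \<in> \<V>"
          "{v \<in> verts. v \<subseteq> e} = {{orient e}, {W}}" by (rule vertices_of_edge[OF e(1)])
        have "v \<in> {{orient e}, {W}}" using v e(2) unfolding W(5)[symmetric] by simp
        then have "U = W" using False U by simp
        then have ne2: "e = {U, orient e}" using W(1) by (metis insert_commute)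
        note ne = ne1 ne2
        have "u w \<sigma> = 0" if w: "w \<in> verts" "w \<notin> {{U}, {orient e}}" for w
        proof (rule ccontr)
          assume "u w \<sigma> \<noteq> 0"
          moreover obtain X where X: "w = {X}" using w vertex_iff by auto
          ultimately have X': "{U, X} \<in> edges" "\<sigma> \<in> R {U, X}" using edge w by auto
          have "p \<in> \<Inter>{U, X}" "p \<in> \<Inter>e" using R_iff[OF X'(1)] R_iff[OF e(1)] X'(2) e(3) p by auto
          then have "{U, X} = e" using edge_unique[OF X'(1) e(1)] by blast
          then show False using ne w X by (auto simp: doubleton_eq_iff)
        qed
        then have "J u \<sigma> = (\<Sum>w\<in>{{U}, {orient e}}. u w \<sigma>)"
          unfolding J_def using finite_verts v o[OF e(1)] U by (intro sum.mono_neutral_right) auto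
        then have "u {U} \<sigma> + u {orient e} \<sigma> = 0" using ne Ju by simp
        then show ?thesis using Ex U(2) False by (simp add: incidence_def flip: eq_neg_iff_add_eq_0)
      qed
    next
      case False
      \<comment> \<open>No edge at \<open>v\<close> has \<sigma> in its complex, so \<open>v\<close>
        alone could contribute to the coefficient of \<open>J u\<close> at \<sigma>.\<close>
      have "u w \<sigma> = 0" if w: "w \<in> verts" "w \<noteq> v" for w
        using edge w False U vertex_iff by (metis insert_subset empty_subsetI insertI1 singleton_iff)
      then have "J u \<sigma> = (\<Sum>w\<in>{v}. u w \<sigma>)"
        unfolding J_def using finite_verts v by (intro sum.mono_neutral_right) auto
      then have "u v \<sigma> = 0" using Ju by simp
      moreover have "E x v \<sigma> = 0" unfolding E_def using False by (intro sum.neutral) (auto simp: x_def)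
      ultimately show ?thesis by simp
    qed
  qed
  then show thesis using that[OF x] by blast
qed

text \<open>Each simplex is assigned to one cover element \<open>f \<sigma>\<close> containing it,
  and its coefficient is placed at that vertex alone.\<close>

lemma J_surjective:
  fixes c :: "'p set \<Rightarrow> 'k::field"
  assumes c: "c \<in> carrier (chains K k)"
  obtains u where "u \<in> chain_fams 0 k" "J u = c"
proof -
  obtain f where f: "\<And>\<sigma>. \<sigma> \<in> K \<Longrightarrow> f \<sigma> \<in> \<V> \<and> \<sigma> \<subseteq> f \<sigma>" using covered by metis
  define u where "u v = (\<lambda>\<sigma>. if \<sigma> \<in> K \<and> v = {f \<sigma>} then c \<sigma> else 0)" for v
  have "u \<in> chain_fams 0 k"
    using c f simplex_R_iff[of _ 0] by (fastforce simp: chain_fams_def carrier_chains u_def)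
  moreover have "J u = c"
  proof
    fix \<sigma>
    show "J u \<sigma> = c \<sigma>"
    proof (cases "\<sigma> \<in> K")
      case True
      then have "{f \<sigma>} \<in> verts" using f vertex_iff by auto
      then show ?thesis using True finite_verts by (simp add: J_def u_def)
    next
      case False
      then have "c \<sigma> = 0" using c by (auto simp: carrier_chains simplices_def)
      then show ?thesis using False by (simp add: J_def u_def)
    qed
  qed
  ultimately show thesis by (rule that)
qed

end

section \<open>Cosheaf homology in terms of families of chains\<close>

text \<open>Turns a set of plain families, closed under the pointwise operations, into a space on
  which taking classes is a linear map.\<close>

definition fam_space :: "('c \<Rightarrow> 'x \<Rightarrow> 'k::field) set \<Rightarrow> ('k, 'c \<Rightarrow> 'x \<Rightarrow> 'k) module" where
  "fam_space Z = \<lparr>carrier = Z, mult = (\<lambda>x y. 0), one = 0, zero = 0, add = (+), smult = (\<lambda>a x c \<sigma>. a * x c \<sigma>)\<rparr>"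

lemma fam_space_simps [simp]:
  "carrier (fam_space Z) = Z" "\<zero>\<^bsub>fam_space Z\<^esub> = 0" "x \<oplus>\<^bsub>fam_space Z\<^esub> y = x + y"
  "a \<odot>\<^bsub>fam_space Z\<^esub> x = (\<lambda>c \<sigma>. a * x c \<sigma>)"
  by (simp_all add: fam_space_def)

lemma vectorspace_fam_space:
  fixes Z :: "('c \<Rightarrow> 'x \<Rightarrow> 'k::field) set"
  assumes "0 \<in> Z" "\<And>x y. x \<in> Z \<Longrightarrow> y \<in> Z \<Longrightarrow> x + y \<in> Z" "\<And>a x. x \<in> Z \<Longrightarrow> (\<lambda>c \<sigma>. a * x c \<sigma>) \<in> Z"
  shows "vspace (fam_space Z)"
  by (rule vectorspaceI) (use assms in \<open>auto simp: fun_eq_iff algebra_simps\<close>)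

context covered_complex
begin

definition cycle_fams :: "int \<Rightarrow> int \<Rightarrow> (('p, 'k::field) chain_family) set" where
  "cycle_fams j k = {x. \<forall>c\<in>cells j. x c \<in> cycles ord (R c) k}"

definition boundary_fams :: "int \<Rightarrow> int \<Rightarrow> (('p, 'k::field) chain_family) set" where
  "boundary_fams j k = {x. \<forall>c\<in>cells j. x c \<in> boundaries ord (R c) k}"

lemma chain_fams_zero [simp]: "0 \<in> chain_fams j k"
  and chain_fams_add: "x \<in> chain_fams j k \<Longrightarrow> y \<in> chain_fams j k \<Longrightarrow> x + y \<in> chain_fams j k"
  and chain_fams_diff: "x \<in> chain_fams j k \<Longrightarrow> y \<in> chain_fams j k \<Longrightarrow> x - y \<in> chain_fams j k"
  and chain_fams_smult: "x \<in> chain_fams j k \<Longrightarrow> (\<lambda>c \<sigma>. a * x c \<sigma>) \<in> chain_fams j k"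
  by (auto simp: chain_fams_def chains_add chains_diff chains_smult)

lemma cycle_fams_iff:
  "x \<in> cycle_fams j k \<longleftrightarrow> x \<in> chain_fams j k \<and> (\<forall>c\<in>cells j. D (x c) = 0)"
  by (auto simp: cycle_fams_def chain_fams_def cycles_eq[OF R_subcomplex])

lemma boundary_fams_iff:
  "x \<in> boundary_fams j k \<longleftrightarrow>
    (\<exists>w\<in>chain_fams j (k + 1). \<forall>c\<in>cells j. x c = D (w c))"
proof
  assume "x \<in> boundary_fams j k"
  then have "\<forall>c\<in>cells j. \<exists>w. w \<in> carrier (chains (R c) (k + 1)) \<and> x c = D w"
    by (auto simp: boundary_fams_def boundaries_eq[OF R_subcomplex])
  then obtain w where "\<forall>c\<in>cells j. w c \<in> carrier (chains (R c) (k + 1)) \<and> x c = D (w c)"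
    by (auto simp: bchoice_iff)
  then show "\<exists>w\<in>chain_fams j (k + 1). \<forall>c\<in>cells j. x c = D (w c)"
    by (intro bexI[of _ w]) (auto simp: chain_fams_def)
qed (auto simp: boundary_fams_def chain_fams_def boundaries_eq[OF R_subcomplex])

lemma cycle_fams_zero [simp]: "0 \<in> cycle_fams j k"
  and cycle_fams_add: "x \<in> cycle_fams j k \<Longrightarrow> y \<in> cycle_fams j k \<Longrightarrow> x + y \<in> cycle_fams j k"
  and cycle_fams_diff: "x \<in> cycle_fams j k \<Longrightarrow> y \<in> cycle_fams j k \<Longrightarrow> x - y \<in> cycle_fams j k"
  and cycle_fams_smult: "x \<in> cycle_fams j k \<Longrightarrow> (\<lambda>c \<sigma>. a * x c \<sigma>) \<in> cycle_fams j k"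
  by (auto simp: cycle_fams_iff chain_fams_add chain_fams_diff chain_fams_smult bd_add bd_diff bd_smult fun_eq_iff[of _ 0])

lemma boundary_fams_zero [simp]: "0 \<in> boundary_fams j k"
  and boundary_fams_add: "x \<in> boundary_fams j k \<Longrightarrow> y \<in> boundary_fams j k \<Longrightarrow> x + y \<in> boundary_fams j k"
  and boundary_fams_smult: "x \<in> boundary_fams j k \<Longrightarrow> (\<lambda>c \<sigma>. a * x c \<sigma>) \<in> boundary_fams j k"
proof -
  show "0 \<in> boundary_fams j k" unfolding boundary_fams_iff by (rule bexI[of _ 0]) auto
  show "x + y \<in> boundary_fams j k" if xy: "x \<in> boundary_fams j k" "y \<in> boundary_fams j k"
  proof -
    obtain w w' where "w \<in> chain_fams j (k + 1)" "\<forall>c\<in>cells j. x c = D (w c)"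
      "w' \<in> chain_fams j (k + 1)" "\<forall>c\<in>cells j. y c = D (w' c)"
      using xy unfolding boundary_fams_iff by blast
    then show ?thesis unfolding boundary_fams_iff
      by (intro bexI[of _ "w + w'"]) (auto simp: bd_add chain_fams_add)
  qed
  show "(\<lambda>c \<sigma>. a * x c \<sigma>) \<in> boundary_fams j k" if x: "x \<in> boundary_fams j k"
  proof -
    obtain w where "w \<in> chain_fams j (k + 1)" "\<forall>c\<in>cells j. x c = D (w c)"
      using x unfolding boundary_fams_iff by blast
    then show ?thesis unfolding boundary_fams_iff
      by (intro bexI[of _ "\<lambda>c \<sigma>. a * w c \<sigma>"]) (auto simp: bd_smult chain_fams_smult)
  qed
qed

lemma E_chain_fams: "x \<in> chain_fams 1 k \<Longrightarrow> E x \<in> chain_fams 0 k"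
  using E_closed by (auto simp: chain_fams_def[of 0])

lemma E_cycle_fams: "x \<in> cycle_fams 1 k \<Longrightarrow> E x \<in> cycle_fams 0 k"
proof -
  assume x: "x \<in> cycle_fams 1 k"
  have "E (\<lambda>e. D (x e)) = E 0" by (rule E_cong) (use x in \<open>auto simp: cycle_fams_iff\<close>)
  then show ?thesis using x E_chain_fams by (auto simp: cycle_fams_iff D_E)
qed

lemma J_cycles: "u \<in> cycle_fams 0 k \<Longrightarrow> J u \<in> cycles ord K k"
proof -
  assume u: "u \<in> cycle_fams 0 k"
  have "J (\<lambda>v. D (u v)) = J 0" by (rule J_cong) (use u in \<open>auto simp: cycle_fams_iff\<close>)
  then show ?thesis using u J_closed by (auto simp: cycle_fams_iff cycles_eq[OF K] D_J)
qed

definition cls :: "int \<Rightarrow> int \<Rightarrow> (('p, 'k::field) chain_family) \<Rightarrow> ('p, 'k) class_family" where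
  "cls j k x = (\<lambda>c\<in>cells j. homology_class ord (R c) k (x c))"

abbreviation HF :: "int \<Rightarrow> ('p set set, 'k::field, ('p set \<Rightarrow> 'k) set) cosheaf" where
  "HF k \<equiv> homology_cosheaf ord R k"

abbreviation HC :: "int \<Rightarrow> int \<Rightarrow> ('k::field, ('p, 'k) class_family) module" where
  "HC j k \<equiv> cosheaf_chains (nerve \<V>) (HF k) j"

lemma HC_eq: "HC j k = dsum (cells j) (\<lambda>c. homology ord (R c) k)"
  by (simp add: cosheaf_chains_def homology_cosheaf_def)

lemma vectorspace_HC: "vspace (HC j k :: ('k::field, _) module)"
  unfolding HC_eq by (rule vectorspace_dsum) (rule vectorspace_homology[OF R_subcomplex])

lemma vectorspace_cycle_fams: "vspace (fam_space (cycle_fams j k) :: ('k::field, _) module)"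
  by (rule vectorspace_fam_space) (auto simp: cycle_fams_add cycle_fams_smult)

lemma cls_cong: "(\<And>c. c \<in> cells j \<Longrightarrow> x c = y c) \<Longrightarrow> cls j k x = cls j k y"
  unfolding cls_def by (rule restrict_ext) simp

lemma linear_cls:
  "linmap (fam_space (cycle_fams j k)) (HC j k) (cls j k :: (('p, 'k::field) chain_family) \<Rightarrow> _)"
proof (rule linear_mapI[OF vectorspace_cycle_fams vectorspace_HC])
  note l = linear_mapD[OF linear_homology_class[OF R_subcomplex[where j = j], where k = k]]
  fix x y :: "('p, 'k) chain_family" and a
  assume x: "x \<in> carrier (fam_space (cycle_fams j k))"
  then have x': "x c \<in> carrier (cycle_space (R c) k)" if "c \<in> cells j" for c
    using that R_subcomplex by (auto simp: cycle_fams_def)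
  show "cls j k x \<in> carrier (HC j k)"
    unfolding HC_eq carrier_dsum_iff cls_def using x' by (auto intro!: l(3))
  show "cls j k (a \<odot>\<^bsub>fam_space (cycle_fams j k)\<^esub> x) = a \<odot>\<^bsub>HC j k\<^esub> cls j k x"
    unfolding HC_eq dsum_simps cls_def
  proof (rule restrict_ext)
    fix c assume c: "c \<in> cells j"
    then show "homology_class ord (R c) k ((a \<odot>\<^bsub>fam_space (cycle_fams j k)\<^esub> x) c) =
        a \<odot>\<^bsub>homology ord (R c) k\<^esub> (\<lambda>c\<in>cells j. homology_class ord (R c) k (x c)) c"
      using l(5)[OF c x'[OF c], of a] R_subcomplex[OF c] by simp
  qed
  assume y: "y \<in> carrier (fam_space (cycle_fams j k))"
  then have y': "y c \<in> carrier (cycle_space (R c) k)" if "c \<in> cells j" for c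
    using that R_subcomplex by (auto simp: cycle_fams_def)
  show "cls j k (x \<oplus>\<^bsub>fam_space (cycle_fams j k)\<^esub> y) = cls j k x \<oplus>\<^bsub>HC j k\<^esub> cls j k y"
    unfolding HC_eq dsum_simps cls_def
  proof (rule restrict_ext)
    fix c assume c: "c \<in> cells j"
    then show "homology_class ord (R c) k ((x \<oplus>\<^bsub>fam_space (cycle_fams j k)\<^esub> y) c) =
        (\<lambda>c\<in>cells j. homology_class ord (R c) k (x c)) c \<oplus>\<^bsub>homology ord (R c) k\<^esub>
        (\<lambda>c\<in>cells j. homology_class ord (R c) k (y c)) c"
      using l(4)[OF c x'[OF c] y'[OF c]] R_subcomplex[OF c] by simp
  qed
qed

lemma carrier_HC: "carrier (HC j k) = cls j k ` (cycle_fams j k :: (('p, 'k::field) chain_family) set)"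
proof
  show "cls j k ` cycle_fams j k \<subseteq> carrier (HC j k :: ('k, _) module)"
    using linear_mapD(3)[OF linear_cls] by auto
  show "carrier (HC j k) \<subseteq> cls j k ` (cycle_fams j k :: (('p, 'k) chain_family) set)"
  proof
    fix y :: "('p, 'k) class_family"
    assume "y \<in> carrier (HC j k)"
    then have y: "y \<in> extensional (cells j)"
      "\<forall>c\<in>cells j. \<exists>z. z \<in> cycles ord (R c) k \<and> y c = homology_class ord (R c) k z"
      by (auto simp: HC_eq carrier_dsum_iff carrier_homology[OF R_subcomplex[where j = j]])
    then obtain x where x: "\<forall>c\<in>cells j. x c \<in> cycles ord (R c) k \<and> y c = homology_class ord (R c) k (x c)"
      unfolding bchoice_iff by blast
    then have "y = cls j k x"
      by (intro extensionalityI[OF y(1)]) (auto simp: cls_def)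
    then show "y \<in> cls j k ` cycle_fams j k" using x by (auto simp: cycle_fams_def)
  qed
qed

lemma cls_eq_iff:
  fixes x y :: "('p, 'k::field) chain_family"
  assumes "x \<in> cycle_fams j k" "y \<in> cycle_fams j k"
  shows "cls j k x = cls j k y \<longleftrightarrow> x - y \<in> boundary_fams j k"
proof -
  have "cls j k x = cls j k y \<longleftrightarrow>
    (\<forall>c\<in>cells j. homology_class ord (R c) k (x c) = homology_class ord (R c) k (y c))"
    by (auto simp: cls_def fun_eq_iff restrict_def)
  also have "\<dots> \<longleftrightarrow> x - y \<in> boundary_fams j k"
    using assms by (simp add: boundary_fams_def cycle_fams_def homology_class_eq_iff[OF R_subcomplex[where j = j]])
  finally show ?thesis .
qed

lemma cls_zero_iff:
  fixes x :: "('p, 'k::field) chain_family"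
  assumes "x \<in> cycle_fams j k"
  shows "cls j k x = \<zero>\<^bsub>HC j k\<^esub> \<longleftrightarrow> x \<in> boundary_fams j k"
proof -
  have "cls j k (0 :: ('p, 'k) chain_family) = \<zero>\<^bsub>HC j k\<^esub>"
    using linear_mapD(6)[OF linear_cls] by simp
  then show ?thesis using cls_eq_iff[OF assms, of 0] by simp
qed

text \<open>The bridge from the cosheaf to chains: its extension maps are induced by inclusions, so
  on representatives its boundary is \<open>E\<close>.\<close>

lemma cosheaf_boundary_cls:
  fixes x :: "('p, 'k::field) chain_family"
  assumes x: "x \<in> cycle_fams 1 k"
  shows "cosheaf_boundary (nerve \<V>) orient (HF k) (cls 1 k x) = cls 0 k (E x)"
  unfolding cosheaf_boundary_def cls_def
proof (rule restrict_ext)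
  fix v assume v: "v \<in> verts"
  note Rv = R_subcomplex[OF v]
  let ?H = "homology ord (R v) k"
  interpret Hv: vectorspace class_ring "?H :: ('k, _) module"
    by (rule vectorspace_homology[OF Rv])
  have xe: "x e \<in> cycles ord (R v) k"
    "homology_map ord (R v) k (homology_class ord (R e) k (x e)) = homology_class ord (R v) k (x e)"
    if "e \<in> {e \<in> edges. v \<subseteq> e}" for e
  proof -
    have e: "e \<in> edges" "v \<subseteq> e" using that by auto
    have "x e \<in> cycles ord (R e) k" using x e by (auto simp: cycle_fams_def)
    from homology_map_class[OF R_subcomplex[OF e(1)] Rv R_face[OF e(1) v e(2)] this]
    show "x e \<in> cycles ord (R v) k"
      "homology_map ord (R v) k (homology_class ord (R e) k (x e)) = homology_class ord (R v) k (x e)"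
      by simp_all
  qed
  have cl: "homology_class ord (R v) k (x e) \<in> carrier (?H)" if "e \<in> {e \<in> edges. v \<subseteq> e}" for e
    using xe(1)[OF that] carrier_homology[OF Rv, of k] by auto
  have "(\<Oplus>\<^bsub>?H\<^esub>e\<in>{e \<in> edges. v \<subseteq> e}.
      inc v e \<odot>\<^bsub>?H\<^esub> homology_map ord (R v) k ((\<lambda>c\<in>edges. homology_class ord (R c) k (x c)) e))
    = (\<Oplus>\<^bsub>?H\<^esub>e\<in>{e \<in> edges. v \<subseteq> e}.
      inc v e \<odot>\<^bsub>?H\<^esub> homology_class ord (R v) k (x e))"
    by (rule Hv.finsum_cong') (use xe cl vs_smult_closed[OF vectorspace_homology[OF Rv]] in \<open>auto\<close>)
  also have "\<dots> = homology_class ord (R v) k (E x v)"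
    unfolding E_def by (rule homology_class_sum[OF Rv, symmetric]) (rule xe)
  finally show "(\<Oplus>\<^bsub>stalk (HF k) v\<^esub>e\<in>{e \<in> edges. v \<subseteq> e}.
      inc v e \<odot>\<^bsub>stalk (HF k) v\<^esub> extension (HF k) e v ((\<lambda>c\<in>edges. homology_class ord (R c) k (x c)) e))
    = homology_class ord (R v) k (E x v)"
    by (simp add: homology_cosheaf_def)
qed

subsection \<open>The two cosheaf homology groups\<close>

abbreviation HH1 :: "int \<Rightarrow> ('k::field, ('p, 'k) class_family) module" where
  "HH1 k \<equiv> cosheaf_H1 (nerve \<V>) orient (HF k)"

abbreviation HH0 :: "int \<Rightarrow> ('k::field, (('p, 'k) class_family) set) module" where
  "HH0 k \<equiv> cosheaf_H0 (nerve \<V>) orient (HF k)"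

text \<open>A family of classes lies in the kernel of the cosheaf boundary iff \<open>E\<close> of
  its cycles bounds at every vertex; these are the cycles that admit a chain such as
  \<Gamma>.\<close>

definition lift_fams :: "int \<Rightarrow> (('p, 'k::field) chain_family) set" where
  "lift_fams k = {x \<in> cycle_fams 1 k. E x \<in> boundary_fams 0 k}"

definition cls0 :: "int \<Rightarrow> (('p, 'k::field) chain_family) \<Rightarrow> (('p, 'k) class_family) set" where
  "cls0 k u = cosheaf_image (nerve \<V>) orient (HF k) +>\<^bsub>HC 0 k\<^esub> cls 0 k u"

lemma carrier_HH1: "carrier (HH1 k) = cls 1 k ` (lift_fams k :: (('p, 'k::field) chain_family) set)"
proof -
  let ?Z = "cycle_fams 1 k :: (('p, 'k) chain_family) set"
  let ?P = "\<lambda>y. cosheaf_boundary (nerve \<V>) orient (HF k) y = \<zero>\<^bsub>HC 0 k\<^esub>"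
  have iff: "?P (cls 1 k x) \<longleftrightarrow> E x \<in> boundary_fams 0 k" if "x \<in> ?Z" for x
    unfolding cosheaf_boundary_cls[OF that] by (rule cls_zero_iff[OF E_cycle_fams[OF that]])
  have "carrier (HH1 k) = {y \<in> cls 1 k ` ?Z. ?P y}"
    unfolding carrier_HC[symmetric] by (simp add: cosheaf_H1_def a_kernel_eq)
  also have "\<dots> = cls 1 k ` {x \<in> ?Z. ?P (cls 1 k x)}" by (rule Compr_image_eq)
  also have "{x \<in> ?Z. ?P (cls 1 k x)} = lift_fams k"
    unfolding lift_fams_def by (rule Collect_cong) (rule conj_cong[OF refl iff])
  finally show ?thesis .
qed

lemma linear_cls1:
  "linmap (fam_space (lift_fams k)) (HH1 k) (cls 1 k :: (('p, 'k::field) chain_family) \<Rightarrow> _)"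
proof (rule linear_map_image)
  show "vspace (fam_space (lift_fams k) :: ('k, _) module)"
    by (rule vectorspace_fam_space)
      (auto simp: lift_fams_def cycle_fams_add cycle_fams_smult boundary_fams_add boundary_fams_smult E_add E_smult)
  show "carrier (HH1 k) = cls 1 k ` carrier (fam_space (lift_fams k) :: ('k, _) module)"
    by (simp add: carrier_HH1)
  note l = linear_mapD[OF linear_cls[of 1 k]]
  show "cls 1 k \<zero>\<^bsub>fam_space (lift_fams k)\<^esub> = \<zero>\<^bsub>HH1 k\<^esub>"
    using l(6) by (simp add: cosheaf_H1_def)
  fix x y :: "('p, 'k) chain_family" and a
  assume x: "x \<in> carrier (fam_space (lift_fams k))"
  show "a \<odot>\<^bsub>HH1 k\<^esub> cls 1 k x = cls 1 k (a \<odot>\<^bsub>fam_space (lift_fams k)\<^esub> x)"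
    using l(5)[of x a] x by (simp add: cosheaf_H1_def lift_fams_def)
  assume y: "y \<in> carrier (fam_space (lift_fams k))"
  show "cls 1 k x \<oplus>\<^bsub>HH1 k\<^esub> cls 1 k y = cls 1 k (x \<oplus>\<^bsub>fam_space (lift_fams k)\<^esub> y)"
    using l(4)[of x y] x y by (simp add: cosheaf_H1_def lift_fams_def)
qed

lemmas vectorspace_HH1 = linear_mapD(2)[OF linear_cls1]

lemma HH1_simps: "\<zero>\<^bsub>HH1 k\<^esub> = \<zero>\<^bsub>HC 1 k\<^esub>"
  by (simp add: cosheaf_H1_def)

lemma cosheaf_image_eq:
  "cosheaf_image (nerve \<V>) orient (HF k) = cls 0 k ` E ` (cycle_fams 1 k :: (('p, 'k::field) chain_family) set)"
  unfolding cosheaf_image_def carrier_HC image_image by (rule image_cong) (auto simp: cosheaf_boundary_cls)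

lemma subspace_cosheaf_image:
  "subsp (cosheaf_image (nerve \<V>) orient (HF k)) (HC 0 k :: ('k::field, _) module)"
proof (rule vs_subspaceI[OF vectorspace_HC])
  note l = linear_mapD[OF linear_cls[of 0 k]]
  let ?I = "cosheaf_image (nerve \<V>) orient (HF k) :: (('p, 'k) class_family) set"
  show "?I \<subseteq> carrier (HC 0 k)"
    unfolding cosheaf_image_eq carrier_HC using E_cycle_fams by auto
  show "\<zero>\<^bsub>HC 0 k\<^esub> \<in> ?I"
    unfolding cosheaf_image_eq image_image by (rule image_eqI[of _ _ 0]) (simp_all add: l(6)[simplified])
  fix y assume "y \<in> ?I"
  then obtain x where x: "x \<in> cycle_fams 1 k" "y = cls 0 k (E x)" unfolding cosheaf_image_eq by blast
  show "a \<odot>\<^bsub>HC 0 k\<^esub> y \<in> ?I" for a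
    unfolding cosheaf_image_eq image_image
    by (rule image_eqI[of _ _ "\<lambda>c \<sigma>. a * x c \<sigma>"])
      (use l(5)[of "E x" a] x E_cycle_fams[OF x(1)] in \<open>simp_all add: E_smult cycle_fams_smult\<close>)
  fix y' assume "y' \<in> ?I"
  then obtain x' where x': "x' \<in> cycle_fams 1 k" "y' = cls 0 k (E x')" unfolding cosheaf_image_eq by blast
  show "y \<oplus>\<^bsub>HC 0 k\<^esub> y' \<in> ?I"
    unfolding cosheaf_image_eq image_image
    by (rule image_eqI[of _ _ "x + x'"])
      (use l(4)[of "E x" "E x'"] x x' E_cycle_fams[OF x(1)] E_cycle_fams[OF x'(1)] in \<open>simp_all add: E_add cycle_fams_add\<close>)
qed

lemma linear_cls0:
  "linmap (fam_space (cycle_fams 0 k)) (HH0 k) (cls0 k :: (('p, 'k::field) chain_family) \<Rightarrow> _)"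
  unfolding cls0_def[abs_def] cosheaf_H0_def
  by (rule linear_map_compose[OF linear_cls quotient_space_linear[OF vectorspace_HC subspace_cosheaf_image]])

lemma carrier_HH0: "carrier (HH0 k) = cls0 k ` (cycle_fams 0 k :: (('p, 'k::field) chain_family) set)"
  unfolding cls0_def[abs_def] cosheaf_H0_def quotient_space_surj[OF vectorspace_HC subspace_cosheaf_image]
    carrier_HC image_image ..

text \<open>Two successive quotients are undone at once: the cycle family \<open>z\<close> accounts
  for the image of the cosheaf boundary, the boundary family for homology at the vertices.\<close>

lemma cls0_eq_iff:
  fixes u w :: "('p, 'k::field) chain_family"
  assumes u: "u \<in> cycle_fams 0 k" and w: "w \<in> cycle_fams 0 k"
  shows "cls0 k u = cls0 k w \<longleftrightarrow> (\<exists>z\<in>cycle_fams 1 k. u - w - E z \<in> boundary_fams 0 k)"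
proof -
  note l = linear_mapD[OF linear_cls[of 0 k]]
  have d: "cls 0 k u \<ominus>\<^bsub>HC 0 k\<^esub> cls 0 k w = cls 0 k (u - w)"
    using l(7)[of u w] vs_diff[OF vectorspace_cycle_fams, of u 0 k w] u w by (simp add: fun_diff_def plus_fun_def)
  have "cls0 k u = cls0 k w \<longleftrightarrow> cls 0 k u \<ominus>\<^bsub>HC 0 k\<^esub> cls 0 k w \<in> cosheaf_image (nerve \<V>) orient (HF k)"
    unfolding cls0_def
    by (rule quotient_space_eq_iff[OF vectorspace_HC subspace_cosheaf_image]) (use u w carrier_HC in auto)
  also have "\<dots> \<longleftrightarrow> (\<exists>z\<in>cycle_fams 1 k. cls 0 k (u - w) = cls 0 k (E z))"
    unfolding d cosheaf_image_eq by auto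
  also have "\<dots> \<longleftrightarrow> (\<exists>z\<in>cycle_fams 1 k. u - w - E z \<in> boundary_fams 0 k)"
    using cls_eq_iff[OF cycle_fams_diff[OF u w] E_cycle_fams] by auto
  finally show ?thesis .
qed

end

section \<open>The connecting relation and the splitting\<close>

text \<open>\<open>disj\<close> contains two conditions: with \<open>x\<close> zero it is
  injectivity of \<open>g\<close>, and in general it says that the images of \<open>f\<close> and
  \<open>g\<close> meet trivially.\<close>

lemma direct_sum_iso:
  fixes A :: "('k::field, 'a) module" and B :: "('k, 'b) module" and G :: "('k, 'g) module"
  assumes f: "linmap A G f" and g: "linmap B G g"
    and inj: "\<And>x. x \<in> carrier A \<Longrightarrow> f x = \<zero>\<^bsub>G\<^esub> \<Longrightarrow> x = \<zero>\<^bsub>A\<^esub>"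
    and disj: "\<And>x y. x \<in> carrier A \<Longrightarrow> y \<in> carrier B \<Longrightarrow> g y = f x \<Longrightarrow> y = \<zero>\<^bsub>B\<^esub>"
    and onto: "\<And>z. z \<in> carrier G \<Longrightarrow> \<exists>x\<in>carrier A. \<exists>y\<in>carrier B. z = f x \<oplus>\<^bsub>G\<^esub> g y"
  shows "linmap (direct_sum A B) G (\<lambda>(x, y). f x \<oplus>\<^bsub>G\<^esub> g y)"
    and "bij_betw (\<lambda>(x, y). f x \<oplus>\<^bsub>G\<^esub> g y) (carrier (direct_sum A B)) (carrier G)"
proof -
  note f' = linear_mapD[OF f] and g' = linear_mapD[OF g]
  interpret A: vectorspace class_ring A by (rule f'(1))
  interpret B: vectorspace class_ring B by (rule g'(1))
  interpret G: vectorspace class_ring G by (rule f'(2))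
  let ?h = "\<lambda>(x, y). f x \<oplus>\<^bsub>G\<^esub> g y"
  have AB: "vspace (direct_sum A B)" by (rule direct_sum_is_vs[OF f'(1) g'(1)])
  interpret AB: vectorspace class_ring "direct_sum A B" by (rule AB)
  show lin: "linmap (direct_sum A B) G ?h"
  proof (rule linear_mapI[OF AB f'(2)])
    show "?h (p \<oplus>\<^bsub>direct_sum A B\<^esub> q) = ?h p \<oplus>\<^bsub>G\<^esub> ?h q"
      if "p \<in> carrier (direct_sum A B)" "q \<in> carrier (direct_sum A B)" for p q
      using that by (auto simp: f'(3,4) g'(3,4) G.a_ac)
    show "?h (a \<odot>\<^bsub>direct_sum A B\<^esub> p) = a \<odot>\<^bsub>G\<^esub> ?h p" if "p \<in> carrier (direct_sum A B)" for a p
      using that by (auto simp: f'(3,5) g'(3,5) vs_smult_rdistr[OF f'(2)])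
  qed (auto simp: f'(3) g'(3))
  note h = linear_mapD[OF lin]
  have ker: "p = \<zero>\<^bsub>direct_sum A B\<^esub>" if p: "p \<in> carrier (direct_sum A B)" "?h p = \<zero>\<^bsub>G\<^esub>" for p
  proof -
    obtain x y where xy: "p = (x, y)" "x \<in> carrier A" "y \<in> carrier B" using p(1) by auto
    have c: "f x \<in> carrier G" "g y \<in> carrier G" using xy f'(3) g'(3) by auto
    have 0: "f x \<oplus>\<^bsub>G\<^esub> g y = \<zero>\<^bsub>G\<^esub>" using p(2) xy(1) by simp
    have "g y = \<ominus>\<^bsub>G\<^esub> f x" using 0 c by (metis G.minus_equality G.a_comm)
    \<comment> \<open>The sign is moved into the argument of \<open>f\<close> to match the form of
      \<open>disj\<close>.\<close>
    also have "\<dots> = f ((- 1) \<odot>\<^bsub>A\<^esub> x)" using c xy f'(5) by (simp add: vs_minus[OF f'(2)])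
    finally have y: "y = \<zero>\<^bsub>B\<^esub>" by (rule disj[OF vs_smult_closed[OF f'(1) xy(2)] xy(3)])
    then have "f x = \<zero>\<^bsub>G\<^esub>" using 0 c g'(6) by simp
    then have "x = \<zero>\<^bsub>A\<^esub>" by (rule inj[OF xy(2)])
    then show ?thesis using y xy(1) by simp
  qed
  show "bij_betw ?h (carrier (direct_sum A B)) (carrier G)"
    unfolding bij_betw_def
  proof
    show "inj_on ?h (carrier (direct_sum A B))"
    proof (rule inj_onI)
      fix p q assume p: "p \<in> carrier (direct_sum A B)" and q: "q \<in> carrier (direct_sum A B)" and "?h p = ?h q"
      then have "?h p \<ominus>\<^bsub>G\<^esub> ?h q = \<zero>\<^bsub>G\<^esub>" using h(3)[OF p] h(3)[OF q] G.minus_other_side by blast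
      then have "?h (p \<ominus>\<^bsub>direct_sum A B\<^esub> q) = \<zero>\<^bsub>G\<^esub>" using h(7)[OF p q] by (rule trans[rotated])
      then have "p \<ominus>\<^bsub>direct_sum A B\<^esub> q = \<zero>\<^bsub>direct_sum A B\<^esub>" by (rule ker[OF AB.minus_closed[OF p q]])
      then show "p = q" using AB.minus_other_side[OF p q] by blast
    qed
    show "?h ` carrier (direct_sum A B) = carrier G"
    proof
      show "?h ` carrier (direct_sum A B) \<subseteq> carrier G" using h(3) by blast
      show "carrier G \<subseteq> ?h ` carrier (direct_sum A B)"
      proof
        fix z assume "z \<in> carrier G"
        then obtain x y where "x \<in> carrier A" "y \<in> carrier B" "z = f x \<oplus>\<^bsub>G\<^esub> g y" using onto by blast
        then show "z \<in> ?h ` carrier (direct_sum A B)" by (intro image_eqI[of _ _ "(x, y)"]) auto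
      qed
    qed
  qed
qed

context covered_complex
begin

lemma D_chain_fams: "x \<in> chain_fams j k \<Longrightarrow> (\<lambda>c. D (x c)) \<in> chain_fams j (k - 1)"
  unfolding chain_fams_def by (auto intro: D_closed[OF R_subcomplex[where j = j]])

text \<open>The pairs formed by a cycle and its chain \<Gamma> in the construction, on plain
  families; \<open>k\<close> is the degree of the chain.\<close>

definition lifting :: "int \<Rightarrow> (('p, 'k::field) chain_family) \<Rightarrow> (('p, 'k) chain_family) \<Rightarrow> bool" where
  "lifting k x y \<longleftrightarrow> x \<in> cycle_fams 1 (k - 1) \<and> y \<in> chain_fams 0 k \<and> (\<forall>v\<in>verts. D (y v) = E x v)"

lemma lifting_zero: "lifting k 0 0"
  by (simp add: lifting_def)

lemma lifting_add: "lifting k x y \<Longrightarrow> lifting k x' y' \<Longrightarrow> lifting k (x + x') (y + y')"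
  by (simp add: lifting_def cycle_fams_add chain_fams_add bd_add E_add)

lemma lifting_smult: "lifting k x y \<Longrightarrow> lifting k (\<lambda>c \<sigma>. a * x c \<sigma>) (\<lambda>c \<sigma>. a * y c \<sigma>)"
  by (simp add: lifting_def cycle_fams_smult chain_fams_smult bd_smult E_smult)

lemma lifting_sum:
  fixes x y :: "'i \<Rightarrow> ('p, 'k::field) chain_family"
  assumes "\<And>i. i \<in> I \<Longrightarrow> lifting k (x i) (y i)"
  shows "lifting k (\<lambda>c \<sigma>. \<Sum>i\<in>I. a i * x i c \<sigma>) (\<lambda>c \<sigma>. \<Sum>i\<in>I. a i * y i c \<sigma>)"
  using assms
proof (induction I rule: infinite_finite_induct)
  case (insert i I)
  have "lifting k ((\<lambda>c \<sigma>. a i * x i c \<sigma>) + (\<lambda>c \<sigma>. \<Sum>i\<in>I. a i * x i c \<sigma>))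
      ((\<lambda>c \<sigma>. a i * y i c \<sigma>) + (\<lambda>c \<sigma>. \<Sum>i\<in>I. a i * y i c \<sigma>))"
    using insert by (intro lifting_add lifting_smult) auto
  then show ?case using insert(1,2) by (simp add: plus_fun_def)
qed (use lifting_zero in \<open>simp_all add: zero_fun_def\<close>)

lemma lifting_cong:
  assumes "lifting k x y" "\<And>e. e \<in> edges \<Longrightarrow> x' e = x e" "\<And>v. v \<in> verts \<Longrightarrow> y' v = y v"
  shows "lifting k x' y'"
proof -
  have "E x' = E x" using assms(2) by (rule E_cong)
  then show ?thesis using assms by (simp add: lifting_def cycle_fams_def chain_fams_def)
qed

lemma lifting_lift_fams: "lifting k x y \<Longrightarrow> x \<in> lift_fams (k - 1)"
  unfolding lifting_def lift_fams_def boundary_fams_iff by force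

lemma lifting_exists:
  assumes "x \<in> lift_fams (k - 1)"
  obtains y where "lifting k x y"
  using assms unfolding lifting_def lift_fams_def boundary_fams_iff by force

text \<open>\<open>J y\<close> is closed although \<open>y\<close> need not be a cycle family: its
  boundary is \<open>J (E x)\<close>, which vanishes.\<close>

lemma lifting_J:
  assumes "lifting k x (y :: ('p, 'k::field) chain_family)"
  shows "J y \<in> cycles ord K k"
proof -
  have "J (\<lambda>v. D (y v)) = J (E x)" by (rule J_cong) (use assms in \<open>auto simp: lifting_def\<close>)
  then show ?thesis using assms J_closed by (auto simp: lifting_def cycles_eq[OF K] D_J J_E)
qed

definition connecting ::
    "int \<Rightarrow> ((('p, 'k::field) class_family) \<times> ('p set \<Rightarrow> 'k) set) set" where
  "connecting k = {(cls 1 (k - 1) x, homology_class ord K k (J y)) | x y. lifting k x y}"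

lemma subspace_connecting:
  "subsp (connecting k)
     (direct_sum (HH1 (k - 1)) (homology ord K k :: ('k::field, _) module))"
proof (rule vs_subspaceI[OF direct_sum_is_vs[OF vectorspace_HH1 vectorspace_homology[OF K]]])
  note l = linear_mapD[OF linear_cls1[of "k - 1"]] linear_mapD[OF linear_homology_class[OF K, of k]]
  let ?C = "connecting k :: ((('p, 'k) class_family) \<times> _) set"
  let ?S = "direct_sum (HH1 (k - 1)) (homology ord K k :: ('k, _) module)"
  have mem: "(cls 1 (k - 1) x, homology_class ord K k (J y)) \<in> ?C" if "lifting k x y" for x y
    using that unfolding connecting_def by blast
  show "?C \<subseteq> carrier ?S"
    by (auto simp: connecting_def carrier_HH1 carrier_homology[OF K] lifting_lift_fams lifting_J)
  show "\<zero>\<^bsub>?S\<^esub> \<in> ?C"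
  proof -
    have "cls 1 (k - 1) (0 :: ('p, 'k) chain_family) = \<zero>\<^bsub>HH1 (k - 1)\<^esub>"
      "homology_class ord K k (0 :: 'p set \<Rightarrow> 'k) = \<zero>\<^bsub>homology ord K k\<^esub>"
      using l(6,13) by (simp_all add: K)
    then show ?thesis using mem[OF lifting_zero] by simp
  qed
  fix p assume "p \<in> ?C"
  then obtain x y where p: "p = (cls 1 (k - 1) x, homology_class ord K k (J y))" "lifting k x y"
    unfolding connecting_def by blast
  note px = lifting_lift_fams[OF p(2)] lifting_J[OF p(2)]
  show "a \<odot>\<^bsub>?S\<^esub> p \<in> ?C" for a
    using mem[OF lifting_smult[OF p(2)], of a] l(5)[of x a] l(12)[of "J y" a] px by (simp add: p(1) K J_smult)
  fix q assume "q \<in> ?C"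
  then obtain x' y' where q: "q = (cls 1 (k - 1) x', homology_class ord K k (J y'))" "lifting k x' y'"
    unfolding connecting_def by blast
  note qx = lifting_lift_fams[OF q(2)] lifting_J[OF q(2)]
  show "p \<oplus>\<^bsub>?S\<^esub> q \<in> ?C"
    using mem[OF lifting_add[OF p(2) q(2)]] l(4)[of x x'] l(11)[of "J y" "J y'"] px qx
    by (simp add: p(1) q(1) K J_add)
qed

lemma connecting_total:
  assumes "b \<in> carrier (HH1 (k - 1))"
  shows "\<exists>z. (b, z) \<in> (connecting k :: (_ \<times> ('p set \<Rightarrow> 'k::field) set) set)"
proof -
  obtain x where x: "b = cls 1 (k - 1) x" "x \<in> lift_fams (k - 1)" using assms by (auto simp: carrier_HH1)
  obtain y where "lifting k x y" by (rule lifting_exists[OF x(2)])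
  then show ?thesis unfolding connecting_def x(1) by blast
qed

text \<open>The usual zigzag: a cycle is lifted through \<open>J\<close>, and the boundary of the
  lift lies in the kernel of \<open>J\<close>, hence in the image of \<open>E\<close>.\<close>

lemma connecting_onto:
  fixes z :: "('p set \<Rightarrow> 'k::field) set"
  assumes "z \<in> carrier (homology ord K k)"
  shows "\<exists>b. (b, z) \<in> connecting k"
proof -
  obtain c where c: "z = homology_class ord K k c" "c \<in> cycles ord K k" using assms by (auto simp: carrier_homology[OF K])
  obtain y where y: "y \<in> chain_fams 0 k" "J y = c" using J_surjective[OF cyclesD(1)[OF K c(2)]] by blast
  note Dy = D_chain_fams[OF y(1)]
  have "J (\<lambda>v. D (y v)) = 0" using cyclesD(2)[OF K c(2)] y(2) D_J[of y] by simp
  then obtain x where x: "x \<in> chain_fams 1 (k - 1)" "\<And>v. v \<in> verts \<Longrightarrow> D (y v) = E x v"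
    using J_exact[OF Dy] by blast
  \<comment> \<open>Injectivity of \<open>E\<close> turns \<open>E (D x) = D (D y) = 0\<close> into
    the cycle condition for \<open>x\<close>.\<close>
  have "D (x e) = 0" if "e \<in> edges" for e
  proof (rule E_injective[OF _ _ that])
    show "(\<lambda>e. D (x e)) \<in> chain_fams 1 (k - 1 - 1)"
      by (rule D_chain_fams[OF x(1)])
    show "E (\<lambda>e. D (x e)) v = 0" if "v \<in> verts" for v
      using x(2)[OF that] by (simp add: D_E[symmetric] D_D flip: x(2)[OF that])
  qed
  then have "lifting k x y" using x y(1) by (simp add: lifting_def cycle_fams_iff)
  then show ?thesis unfolding connecting_def c(1) using y(2) by blast
qed

lemma boundary_lift:
  fixes b :: "'p set \<Rightarrow> 'k::field"
  assumes "b \<in> boundaries ord K k"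
  obtains w where "w \<in> chain_fams 0 (k + 1)" "b = J (\<lambda>v. D (w v))"
proof -
  obtain c where c: "b = D c" "c \<in> carrier (chains K (k + 1))" using assms by (auto simp: boundaries_eq[OF K])
  obtain w where w: "w \<in> chain_fams 0 (k + 1)" "J w = c" using J_surjective[OF c(2)] by blast
  show thesis by (rule that[OF w(1)]) (simp add: c(1) w(2)[symmetric] D_J)
qed

text \<open>The cycles \<open>J y\<close> and \<open>J u\<close> differ by \<open>J\<close> of
  boundaries at the vertices, so \<open>?t\<close> lies in the kernel of \<open>J\<close>. Comparing
  the boundaries of both sides of \<open>?t = E z\<close> shows that \<open>x\<close> is the
  boundary of \<open>z\<close> on the edges. With \<open>u\<close> zero this says that the converse
  of the linear relation is single-valued.\<close>

lemma connecting_glued: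
  fixes u :: "('p, 'k::field) chain_family"
  assumes u: "u \<in> cycle_fams 0 k" and b: "(b, homology_class ord K k (J u)) \<in> connecting k"
  shows "b = \<zero>\<^bsub>HH1 (k - 1)\<^esub>"
proof -
  obtain x y where xy: "b = cls 1 (k - 1) x" "homology_class ord K k (J u) = homology_class ord K k (J y)" "lifting k x y"
    using b unfolding connecting_def by blast
  have "J y - J u \<in> boundaries ord K k"
    using homology_class_eq_iff[OF K lifting_J[OF xy(3)] J_cycles[OF u]] xy(2) by simp
  then obtain w where w: "w \<in> chain_fams 0 (k + 1)" "J y - J u = J (\<lambda>v. D (w v))" by (rule boundary_lift)
  have Dw: "(\<lambda>v. D (w v)) \<in> chain_fams 0 k"
    using D_chain_fams[OF w(1)] by simp
  let ?t = "y - u - (\<lambda>v. D (w v))"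
  have t: "?t \<in> chain_fams 0 k"
    using xy(3) u Dw by (auto simp: lifting_def cycle_fams_iff intro!: chain_fams_diff)
  have Jt: "J ?t = 0" using w(2) by (simp add: J_diff)
  obtain z where z: "z \<in> chain_fams 1 k" "\<And>v. v \<in> verts \<Longrightarrow> ?t v = E z v"
    using J_exact[OF t Jt] by blast
  let ?d = "\<lambda>e. x e - D (z e)"
  note Dz = D_chain_fams[OF z(1)]
  have d: "?d \<in> chain_fams 1 (k - 1)"
    using chain_fams_diff[OF _ Dz, of x] xy(3) by (simp add: lifting_def cycle_fams_iff fun_diff_def)
  have "?d e = 0" if "e \<in> edges" for e
  proof (rule E_injective[OF d _ that])
    fix v assume v: "v \<in> verts"
    have "D (y v) - D (u v) - D (D (w v)) = D (E z v)"
      using z(2)[OF v] by (simp add: bd_diff[symmetric])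
    then have "E x v = E (\<lambda>e. D (z e)) v"
      using xy(3) u v by (simp add: lifting_def cycle_fams_iff D_D D_E)
    then show "E ?d v = 0"
      using E_diff[of x "\<lambda>e. D (z e)"] by (simp add: fun_diff_def fun_eq_iff)
  qed
  then have "x \<in> boundary_fams 1 (k - 1)"
    unfolding boundary_fams_iff using z(1) by (intro bexI[of _ z]) auto
  then have "cls 1 (k - 1) x = \<zero>\<^bsub>HC 1 (k - 1)\<^esub>"
    using cls_zero_iff xy(3) by (auto simp: lifting_def)
  then show ?thesis by (simp add: xy(1) HH1_simps)
qed

text \<open>If \<open>x\<close> is the boundary of a family \<open>w\<close> on the edges, then
  \<open>y - E w\<close> is a cycle family with the same image under \<open>J\<close>, because
  \<open>J (E w) = 0\<close>.\<close>

lemma connecting_zero: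
  fixes z :: "('p set \<Rightarrow> 'k::field) set"
  assumes "(\<zero>\<^bsub>HH1 (k - 1)\<^esub>, z) \<in> connecting k"
  obtains u where "u \<in> cycle_fams 0 k" "z = homology_class ord K k (J u)"
proof -
  obtain x y where xy: "\<zero>\<^bsub>HH1 (k - 1)\<^esub> = cls 1 (k - 1) x" "z = homology_class ord K k (J y)" "lifting k x y"
    using assms unfolding connecting_def by blast
  then have "x \<in> boundary_fams 1 (k - 1)"
    using cls_zero_iff[of x 1 "k - 1"] by (simp add: HH1_simps lifting_def)
  then obtain w where w: "w \<in> chain_fams 1 k" "\<And>e. e \<in> edges \<Longrightarrow> x e = D (w e)"
    unfolding boundary_fams_iff by auto
  have "y - E w \<in> cycle_fams 0 k"
    unfolding cycle_fams_iff
  proof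
    show "y - E w \<in> chain_fams 0 k" using xy(3) w(1) by (auto simp: lifting_def intro!: chain_fams_diff E_chain_fams)
    have "E x = E (\<lambda>e. D (w e))" by (rule E_cong) (rule w(2))
    then show "\<forall>v\<in>verts. D ((y - E w) v) = 0" using xy(3) by (simp add: lifting_def bd_diff D_E)
  qed
  moreover have "J (y - E w) = J y" by (simp add: J_diff J_E)
  ultimately show thesis using that xy(2) by metis
qed

lemma linear_J_class:
  "linmap (fam_space (cycle_fams 0 k)) (homology ord K k)
     (\<lambda>u. homology_class ord K k (J u) :: ('p set \<Rightarrow> 'k::field) set)"
proof -
  have "linmap (fam_space (cycle_fams 0 k)) (cycle_space K k) (J :: _ \<Rightarrow> 'p set \<Rightarrow> 'k)"
    by (rule linear_mapI[OF vectorspace_cycle_fams vectorspace_cycles[OF K]])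
      (auto simp: K J_cycles J_add J_smult)
  from linear_map_compose[OF this linear_homology_class[OF K]] show ?thesis .
qed

text \<open>\<open>J\<close> annihilates the image of \<open>E\<close> and sends boundaries at the
  vertices to boundaries, so the class of \<open>J u\<close> depends only on
  \<open>cls0 k u\<close>.\<close>

lemma glue_exists:
  "\<exists>f. linmap (HH0 k) (homology ord K k) f \<and>
     (\<forall>u\<in>cycle_fams 0 k. f (cls0 k u) = (homology_class ord K k (J u) :: ('p set \<Rightarrow> 'k::field) set))"
proof -
  have ker: "homology_class ord K k (J u) = homology_class ord K k (J w)"
    if uw: "u \<in> carrier (fam_space (cycle_fams 0 k))" "w \<in> carrier (fam_space (cycle_fams 0 k))" "cls0 k u = cls0 k w"
    for u w :: "('p, 'k) chain_family"
  proof -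
    obtain z where z: "z \<in> cycle_fams 1 k" "u - w - E z \<in> boundary_fams 0 k"
      using cls0_eq_iff[of u k w] uw by auto
    then obtain t where t: "t \<in> chain_fams 0 (k + 1)" "\<And>v. v \<in> verts \<Longrightarrow> (u - w - E z) v = D (t v)"
      unfolding boundary_fams_iff by blast
    have "J (u - w - E z) = J (\<lambda>v. D (t v))" by (rule J_cong) (rule t(2))
    then have "J u - J w = D (J t)" by (simp add: J_diff J_E D_J)
    then have "J u - J w \<in> boundaries ord K k" using J_closed[OF t(1)] by (auto simp: boundaries_eq[OF K])
    then show ?thesis using homology_class_eq_iff[OF K J_cycles J_cycles, of u k w] uw by simp
  qed
  show ?thesis
    by (rule linear_map_factor[OF linear_cls0 _ linear_J_class ker]) (auto simp: carrier_HH0)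
qed

definition glue :: "int \<Rightarrow> (('p, 'k::field) class_family) set \<Rightarrow> ('p set \<Rightarrow> 'k) set" where
  "glue k = (SOME f. linmap (HH0 k) (homology ord K k) f \<and>
     (\<forall>u\<in>cycle_fams 0 k. f (cls0 k u) = homology_class ord K k (J u)))"

lemma linear_glue: "linmap (HH0 k) (homology ord K k :: ('k::field, _) module) (glue k)"
  and glue_cls0: "u \<in> cycle_fams 0 k \<Longrightarrow> glue k (cls0 k u) = homology_class ord K k (J u)"
  using someI_ex[OF glue_exists[of k]] unfolding glue_def[symmetric] by blast+

text \<open>If \<open>J u\<close> bounds, then \<open>u\<close> minus suitable boundaries at the
  vertices lies in the kernel of \<open>J\<close> and equals some \<open>E z\<close>. Injectivity of
  \<open>E\<close> makes \<open>z\<close> a cycle family, and then \<open>u\<close> is zero in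
  degree-zero cosheaf homology.\<close>

lemma glue_injective:
  fixes X :: "(('p, 'k::field) class_family) set"
  assumes X: "X \<in> carrier (HH0 k)" and 0: "glue k X = \<zero>\<^bsub>homology ord K k\<^esub>"
  shows "X = \<zero>\<^bsub>HH0 k\<^esub>"
proof -
  obtain u where u: "X = cls0 k u" "u \<in> cycle_fams 0 k" using X by (auto simp: carrier_HH0)
  then have "J u \<in> boundaries ord K k"
    using 0 homology_class_zero_iff[OF K J_cycles[OF u(2)]] by (simp add: glue_cls0)
  then obtain w where w: "w \<in> chain_fams 0 (k + 1)" "J u = J (\<lambda>v. D (w v))" by (rule boundary_lift)
  have Dw: "(\<lambda>v. D (w v)) \<in> chain_fams 0 k"
    using D_chain_fams[OF w(1)] by simp
  have t: "u - (\<lambda>v. D (w v)) \<in> chain_fams 0 k" using u(2) Dw by (auto simp: cycle_fams_iff intro!: chain_fams_diff)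
  have "J (u - (\<lambda>v. D (w v))) = 0" using w(2) by (simp add: J_diff)
  then obtain z where z: "z \<in> chain_fams 1 k" "\<And>v. v \<in> verts \<Longrightarrow> (u - (\<lambda>v. D (w v))) v = E z v"
    using J_exact[OF t] by blast
  have "D (z e) = 0" if "e \<in> edges" for e
  proof (rule E_injective[OF _ _ that])
    show "(\<lambda>e. D (z e)) \<in> chain_fams 1 (k - 1)"
      by (rule D_chain_fams[OF z(1)])
    fix v assume v: "v \<in> verts"
    have "D (u v) - D (D (w v)) = D (E z v)" using z(2)[OF v] by (simp add: bd_diff[symmetric])
    then show "E (\<lambda>e. D (z e)) v = 0" using u(2) v by (simp add: cycle_fams_iff D_D D_E)
  qed
  then have zc: "z \<in> cycle_fams 1 k" using z(1) by (simp add: cycle_fams_iff)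
  have "u - 0 - E z \<in> boundary_fams 0 k"
    unfolding boundary_fams_iff
  proof (intro bexI[of _ w] ballI)
    fix v assume "v \<in> verts"
    then show "(u - 0 - E z) v = D (w v)" using z(2)[of v] by (auto simp: algebra_simps)
  qed (rule w(1))
  then have "cls0 k u = cls0 k 0" using cls0_eq_iff[OF u(2), of 0] zc by auto
  also have "\<dots> = \<zero>\<^bsub>HH0 k\<^esub>" using linear_mapD(6)[OF linear_cls0[of k]] by simp
  finally show ?thesis using u(1) by simp
qed

text \<open>The assumption on \<open>s\<close> makes it its own inverse, so the sign can be moved
  between \<gamma> and its argument.\<close>

lemma splitting_iso:
  fixes \<gamma> :: "(('p, 'k::field) class_family) \<Rightarrow> ('p set \<Rightarrow> 'k) set"
  assumes \<gamma>: "linmap (HH1 (k - 1)) (homology ord K k) \<gamma>"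
    and graph: "\<And>y. y \<in> carrier (HH1 (k - 1)) \<Longrightarrow> (y, \<gamma> y) \<in> connecting k"
    and s: "s * s = 1"
  defines "\<Phi> \<equiv> \<lambda>(X, y). glue k X \<oplus>\<^bsub>homology ord K k\<^esub> (s \<odot>\<^bsub>homology ord K k\<^esub> \<gamma> y)"
  shows "linmap (direct_sum (HH0 k) (HH1 (k - 1))) (homology ord K k) \<Phi>"
    and "bij_betw \<Phi> (carrier (direct_sum (HH0 k) (HH1 (k - 1)))) (carrier (homology ord K k))"
proof -
  let ?H = "homology ord K k :: ('k, _) module" and ?H1 = "HH1 (k - 1) :: ('k, _) module"
  have H: "vspace ?H" by (rule vectorspace_homology[OF K])
  interpret H: vectorspace class_ring ?H by (rule H)
  note H1 = linear_mapD(1)[OF \<gamma>] and \<gamma>' = linear_mapD[OF \<gamma>]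
  note c = vs_subspaceD[OF direct_sum_is_vs[OF H1 H] subspace_connecting]
  have s\<gamma>: "s \<odot>\<^bsub>?H\<^esub> \<gamma> y = \<gamma> (s \<odot>\<^bsub>?H1\<^esub> y)" if "y \<in> carrier ?H1" for y using \<gamma>'(5)[OF that, of s] by simp
  have cs: "(s \<odot>\<^bsub>?H1\<^esub> y, s \<odot>\<^bsub>?H\<^esub> \<gamma> y) \<in> connecting k" if "y \<in> carrier ?H1" for y
    using c(4)[OF graph[OF that], of s] by simp
  have ss: "s \<odot>\<^bsub>?H1\<^esub> (s \<odot>\<^bsub>?H1\<^esub> y) = y" if "y \<in> carrier ?H1" for y
    using vs_smult_assoc[OF H1 that, of s s] vs_smult_1[OF H1 that] s by simp
  have disj: "y = \<zero>\<^bsub>?H1\<^esub>" if X: "X \<in> carrier (HH0 k)" and y: "y \<in> carrier ?H1" and eq: "s \<odot>\<^bsub>?H\<^esub> \<gamma> y = glue k X" for X y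
  proof -
    obtain u where u: "X = cls0 k u" "u \<in> cycle_fams 0 k" using X by (auto simp: carrier_HH0)
    have "s \<odot>\<^bsub>?H1\<^esub> y = \<zero>\<^bsub>?H1\<^esub>"
      by (rule connecting_glued[OF u(2)]) (use cs[OF y] eq u glue_cls0[OF u(2)] in simp)
    then show ?thesis using ss[OF y] vs_smult_zero[OF H1, of s] by simp
  qed
  have onto: "\<exists>X\<in>carrier (HH0 k). \<exists>y\<in>carrier ?H1. z = glue k X \<oplus>\<^bsub>?H\<^esub> s \<odot>\<^bsub>?H\<^esub> \<gamma> y" if z: "z \<in> carrier ?H" for z
  proof -
    \<comment> \<open>Any \<open>y\<close> related to \<open>z\<close> will do:
      \<open>z \<ominus> \<gamma> y\<close> is then related to zero, hence a glued class.\<close>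
    obtain y where yz: "(y, z) \<in> connecting k" using connecting_onto[OF z] by blast
    then have y: "y \<in> carrier ?H1" using c(1) by auto
    have gy: "\<gamma> y \<in> carrier ?H" by (rule \<gamma>'(3)[OF y])
    have "(\<zero>\<^bsub>?H1\<^esub>, z \<ominus>\<^bsub>?H\<^esub> \<gamma> y) \<in> connecting k"
    proof -
      interpret H1: vectorspace class_ring ?H1 by (rule H1)
      have "(y \<oplus>\<^bsub>?H1\<^esub> (- 1) \<odot>\<^bsub>?H1\<^esub> y, z \<oplus>\<^bsub>?H\<^esub> (- 1) \<odot>\<^bsub>?H\<^esub> \<gamma> y) \<in> connecting k"
        using c(3)[OF yz c(4)[OF graph[OF y], of "- 1"]] by simp
      then show ?thesis
        using y z gy by (simp add: vs_diff[OF H, symmetric] vs_diff[OF H1, symmetric] H1.r_neg H1.minus_eq)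
    qed
    then obtain u where u: "u \<in> cycle_fams 0 k" "z \<ominus>\<^bsub>?H\<^esub> \<gamma> y = homology_class ord K k (J u)"
      by (rule connecting_zero)
    have "z = (z \<ominus>\<^bsub>?H\<^esub> \<gamma> y) \<oplus>\<^bsub>?H\<^esub> \<gamma> y" using z gy by (simp add: H.minus_eq H.a_assoc H.l_neg)
    also have "\<dots> = glue k (cls0 k u) \<oplus>\<^bsub>?H\<^esub> s \<odot>\<^bsub>?H\<^esub> \<gamma> (s \<odot>\<^bsub>?H1\<^esub> y)"
      using u s\<gamma>[OF vs_smult_closed[OF H1 y], of s] ss[OF y] glue_cls0[OF u(1)] by simp
    finally show ?thesis using u(1) y vs_smult_closed[OF H1] carrier_HH0 by blast
  qed
  show "linmap (direct_sum (HH0 k) ?H1) ?H \<Phi>"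
    "bij_betw \<Phi> (carrier (direct_sum (HH0 k) ?H1)) (carrier ?H)"
    unfolding \<Phi>_def
    by (rule direct_sum_iso[OF linear_glue linear_map_smult[OF \<gamma>] glue_injective disj onto]; assumption)+
qed

end

section \<open>Rips complexes below the critical parameter\<close>

lemma basisD:
  fixes V :: "('k::field, 'v) module" (structure)
  assumes V: "vspace V" and W: "subsp W V"
    and B: "vectorspace.basis class_ring (V\<lparr>carrier := W\<rparr>) B"
  shows "B \<subseteq> W" "\<zero> \<notin> B"
    "\<And>T a. finite T \<Longrightarrow> T \<subseteq> B \<Longrightarrow> (\<Oplus>b\<in>T. a b \<odot> b) = \<zero> \<Longrightarrow> \<forall>b\<in>T. a b = 0"
    "\<And>T a. T \<subseteq> B \<Longrightarrow> (\<Oplus>b\<in>T. a b \<odot> b) \<in> W"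
proof -
  let ?W = "V\<lparr>carrier := W\<rparr>"
  note W' = vs_subspaceD[OF V W]
  interpret W: vectorspace class_ring ?W by (rule W'(5))
  have B': "W.lin_indpt B" "B \<subseteq> W" using B by (simp_all add: W.basis_def)
  then show "B \<subseteq> W" by simp
  show "\<zero> \<notin> B" using W.vs_zero_lin_dep[of B] B' by simp
  have id: "linmap ?W V (\<lambda>x. x)"
    by (rule linear_map_restrict[OF linear_mapI[OF V V] W]) auto
  have sum: "(\<Oplus>b\<in>T. a b \<odot> b) = (\<Oplus>\<^bsub>?W\<^esub>b\<in>T. a b \<odot> b)" if "T \<subseteq> B" for T and a :: "'v \<Rightarrow> 'k"
    by (rule linear_map_finsum[OF id, symmetric]) (use that B'(2) W'(4) in auto)
  show "(\<Oplus>b\<in>T. a b \<odot> b) \<in> W" if "T \<subseteq> B" for T and a :: "'v \<Rightarrow> 'k"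
  proof -
    have "(\<Oplus>\<^bsub>?W\<^esub>b\<in>T. a b \<odot> b) \<in> carrier ?W"
      by (rule vs_finsum_closed[OF W'(5)]) (use that B'(2) W'(4) in auto)
    then show ?thesis unfolding sum[OF that] by simp
  qed
  show "\<forall>b\<in>T. a b = 0" if T: "finite T" "T \<subseteq> B" "(\<Oplus>b\<in>T. a b \<odot> b) = \<zero>" for T and a :: "'v \<Rightarrow> 'k"
  proof (rule ccontr)
    assume "\<not> (\<forall>b\<in>T. a b = 0)"
    then obtain b where b: "b \<in> T" "a b \<noteq> 0" by blast
    have "W.lincomb a T = \<zero>\<^bsub>?W\<^esub>" using T(3) sum[OF T(2)] by (simp add: W.lincomb_def)
    then have "W.lin_dep B" using W.lin_dep_crit[OF T(1,2), of a b] b by simp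
    then show False using B'(1) by simp
  qed
qed

text \<open>The parts of a vanishing combination along \<open>B\<close> and outside it are opposite,
  so both lie in \<open>W \<inter> W'\<close> and vanish separately.\<close>

lemma complementary_bases_indep:
  fixes V :: "('k::field, 'v) module" (structure)
  assumes V: "vspace V"
    and W: "subsp W V" and B: "vectorspace.basis class_ring (V\<lparr>carrier := W\<rparr>) B"
    and W': "subsp W' V" and B': "vectorspace.basis class_ring (V\<lparr>carrier := W'\<rparr>) B'"
    and int: "W \<inter> W' = {\<zero>}"
    and T: "finite T" "T \<subseteq> B \<union> B'" and 0: "(\<Oplus>b\<in>T. a b \<odot> b) = \<zero>"
  shows "\<forall>b\<in>T. a b = 0"
proof -
  interpret V: vectorspace class_ring V by (rule V)
  note b = basisD[OF V W B] and b' = basisD[OF V W' B']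
  note w = vs_subspaceD[OF V W] and w' = vs_subspaceD[OF V W']
  let ?S = "\<lambda>T. \<Oplus>b\<in>T. a b \<odot> b"
  have sub: "T \<inter> B \<subseteq> B" "T - B \<subseteq> B'" using T(2) by auto
  have 1: "?S (T \<inter> B) \<in> W" "?S (T - B) \<in> W'" using b(4)[OF sub(1)] b'(4)[OF sub(2)] by auto
  then have c: "?S (T \<inter> B) \<in> carrier V" "?S (T - B) \<in> carrier V" using w(1) w'(1) by auto
  have "?S (T \<inter> B) \<oplus> ?S (T - B) = ?S ((T \<inter> B) \<union> (T - B))"
    by (rule V.finsum_Un_disjoint[symmetric])
      (use T w(1) w'(1) b(1) b'(1) vs_smult_closed[OF V] in \<open>auto simp: subset_iff\<close>)
  then have s0: "?S (T \<inter> B) \<oplus> ?S (T - B) = \<zero>" using 0 by (simp add: Int_Diff_Un)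
  then have "?S (T \<inter> B) = (- 1) \<odot> ?S (T - B)"
    unfolding vs_minus[OF V c(2), symmetric] by (rule V.minus_equality[symmetric, OF _ c(2,1)])
  then have "?S (T \<inter> B) \<in> W'" using w'(4)[OF 1(2), of "- 1"] by simp
  then have z: "?S (T \<inter> B) = \<zero>" using int 1(1) by blast
  then have z': "?S (T - B) = \<zero>" using s0 c by simp
  have "\<forall>b\<in>T \<inter> B. a b = 0" using b(3)[OF _ sub(1) z] T(1) by simp
  moreover have "\<forall>b\<in>T - B. a b = 0" using b'(3)[OF _ sub(2) z'] T(1) by simp
  ultimately show ?thesis by blast
qed

lemma linear_map_eq_on_sum:
  fixes V :: "('k::field, 'v) module" (structure) and G :: "('k, 'w) module"
  assumes f: "linmap V G f" and g: "linmap V G g"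
    and W: "subsp W V" and B: "vectorspace.basis class_ring (V\<lparr>carrier := W\<rparr>) B"
    and W': "subsp W' V" and B': "vectorspace.basis class_ring (V\<lparr>carrier := W'\<rparr>) B'"
    and sum: "W <+> W' = carrier V"
    and eq: "\<And>b. b \<in> B \<union> B' \<Longrightarrow> f b = g b" and x: "x \<in> carrier V"
  shows "f x = g x"
proof -
  note f' = linear_mapD[OF f] and g' = linear_mapD[OF g]
  obtain u w where u: "u \<in> W" "w \<in> W'" "x = u \<oplus> w"
  proof -
    have "x \<in> W <+> W'" using x sum by simp
    then have "\<exists>u\<in>W. \<exists>w\<in>W'. x = u \<oplus> w" by (simp add: set_add_def set_mult_def)
    then show thesis using that by blast
  qed
  have c: "u \<in> carrier V" "w \<in> carrier V"
    using u vs_subspaceD(1)[OF f'(1) W] vs_subspaceD(1)[OF f'(1) W'] by auto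
  have "f u = g u"
    by (rule linear_map_eq_on_span[OF linear_map_restrict[OF f W] linear_map_restrict[OF g W] B]) (use eq u in auto)
  moreover have "f w = g w"
    by (rule linear_map_eq_on_span[OF linear_map_restrict[OF f W'] linear_map_restrict[OF g W'] B']) (use eq u in auto)
  ultimately show ?thesis using u(3) c f'(4) g'(4) by simp
qed

lemma subspace_kernel:
  fixes V :: "('k::field, 'v) module" (structure) and G :: "('k, 'w) module"
  assumes f: "linmap V G f"
  shows "subsp (a_kernel V G f) V"
proof -
  note f' = linear_mapD[OF f]
  show ?thesis
    by (rule vs_subspaceI[OF f'(1)])
      (auto simp: a_kernel_eq f' vs_simps[OF f'(1)] vs_simps[OF f'(2)])
qed

context ordered_vertices
begin

lemma linear_homology_map:
  assumes K: "subcomplex P K" and L: "subcomplex P L" and "K \<subseteq> L"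
  shows "linmap (homology ord K k) (homology ord L k :: ('k::field, _) module) (homology_map ord L k)"
proof (rule linear_map_descend[OF linear_homology_class[OF K]])
  show "carrier (homology ord K k) = homology_class ord K k ` carrier (cycle_space K k :: ('k, _) module)"
    using K by (simp add: carrier_homology)
  have "linmap (cycle_space K k) (cycle_space L k :: ('k, _) module) (\<lambda>c. c)"
    by (rule linear_mapI[OF vectorspace_cycles[OF K] vectorspace_cycles[OF L]])
      (use homology_map_class(2)[OF assms] in \<open>auto simp: K L\<close>)
  from linear_map_compose[OF this linear_homology_class[OF L]]
  show "linmap (cycle_space K k) (homology ord L k :: ('k, _) module) (homology_class ord L k)" .
qed (use homology_map_class(1)[OF assms] in \<open>simp add: K\<close>)

end

context covered_complex
begin

lemma cls_sum:
  fixes x :: "'i \<Rightarrow> ('p, 'k::field) chain_family"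
  assumes x: "\<And>i. i \<in> I \<Longrightarrow> x i \<in> lift_fams k"
  shows "cls 1 k (\<lambda>c \<sigma>. \<Sum>i\<in>I. a i * x i c \<sigma>) = (\<Oplus>\<^bsub>HH1 k\<^esub>i\<in>I. a i \<odot>\<^bsub>HH1 k\<^esub> cls 1 k (x i))"
proof -
  let ?L = "fam_space (lift_fams k) :: ('k, _) module"
  note l = linear_mapD[OF linear_cls1[of k]]
  have L: "vspace ?L" by (rule l(1))
  interpret H: vectorspace class_ring "HH1 k :: ('k, _) module" by (rule l(2))
  have ax: "(\<lambda>c \<sigma>. a i * x i c \<sigma>) \<in> lift_fams k" if "i \<in> I" for i
    using vs_smult_closed[OF L, of "x i" "a i"] x[OF that] by simp
  have "(\<Oplus>\<^bsub>?L\<^esub>i\<in>I. (\<lambda>c \<sigma>. a i * x i c \<sigma>)) c \<sigma> = (\<Sum>i\<in>I. a i * x i c \<sigma>)" for c \<sigma>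
    using finsum_additive[OF L, of "\<lambda>x. x c \<sigma>" I "\<lambda>i c \<sigma>. a i * x i c \<sigma>"] ax by simp
  then have "(\<lambda>c \<sigma>. \<Sum>i\<in>I. a i * x i c \<sigma>) = (\<Oplus>\<^bsub>?L\<^esub>i\<in>I. (\<lambda>c \<sigma>. a i * x i c \<sigma>))" by (intro ext) simp
  then have "cls 1 k (\<lambda>c \<sigma>. \<Sum>i\<in>I. a i * x i c \<sigma>) = (\<Oplus>\<^bsub>HH1 k\<^esub>i\<in>I. cls 1 k (\<lambda>c \<sigma>. a i * x i c \<sigma>))"
    using linear_map_finsum[OF linear_cls1, of I "\<lambda>i c \<sigma>. a i * x i c \<sigma>" k] ax by simp
  also have "\<dots> = (\<Oplus>\<^bsub>HH1 k\<^esub>i\<in>I. a i \<odot>\<^bsub>HH1 k\<^esub> cls 1 k (x i))"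
  proof -
    have "cls 1 k (\<lambda>c \<sigma>. a i * x i c \<sigma>) = a i \<odot>\<^bsub>HH1 k\<^esub> cls 1 k (x i)"
      "a i \<odot>\<^bsub>HH1 k\<^esub> cls 1 k (x i) \<in> carrier (HH1 k)" if "i \<in> I" for i
      using l(5)[of "x i" "a i"] x[OF that] l(3)[of "x i"] by (simp_all add: vs_smult_closed[OF l(2)])
    then show ?thesis by (intro H.finsum_cong') auto
  qed
  finally show ?thesis .
qed

end

section \<open>Rips simplices below the constant \<open>eps_star\<close>\<close>

lemma rips_subcomplex: "subcomplex P (rips \<epsilon> P)"
  by (auto simp: subcomplex_def rips_def intro: finite_subset)

lemma rips_mono: "\<epsilon> \<le> \<epsilon>' \<Longrightarrow> rips \<epsilon> P \<subseteq> rips \<epsilon>' P"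
  by (force simp: rips_def)

lemma (in graph_covering) cover_cases:
  assumes "p \<in> P"
  obtains U where "{X \<in> \<V>. p \<in> X} = {U}" | U W where "U \<noteq> W" "{X \<in> \<V>. p \<in> X} = {U, W}"
proof -
  obtain U where U: "U \<in> \<V>" "p \<in> U" using assms Union_cover by blast
  show thesis
  proof (cases "\<exists>W\<in>\<V>. p \<in> W \<and> W \<noteq> U")
    case True
    then obtain W where W: "W \<in> \<V>" "p \<in> W" "U \<noteq> W" by blast
    have "X = U \<or> X = W" if "X \<in> \<V>" "p \<in> X" for X
      using no_triple[OF U(1) W(1) that(1) U(2) W(2) that(2)] W(3) by auto
    then have "{X \<in> \<V>. p \<in> X} = {U, W}" using U W by blast
    then show thesis using that(2) W(3) by blast
  next
    case False
    then have "{X \<in> \<V>. p \<in> X} = {U}" using U by blast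
    then show thesis using that(1) by blast
  qed
qed

text \<open>One vertex \<open>p\<close> of the simplex decides. If \<open>p\<close> lies in
  \<open>U\<close> alone, \<open>K_single\<close> keeps all points outside \<open>U\<close> farther
  than \<epsilon> from \<open>p\<close>. If \<open>p\<close> lies in \<open>U\<close> and
  \<open>W\<close> and the simplex leaves both, a vertex outside \<open>U\<close> and a vertex
  outside \<open>W\<close> form a pair counted by \<open>K_double''\<close>, so they are farther
  than \<epsilon> apart.\<close>

lemma rips_simplex_covered:
  fixes P :: "'p::metric_space set"
  assumes "graph_covering P ord \<V> orient" and \<epsilon>: "ereal \<epsilon> < eps_star P \<V>" and \<sigma>: "\<sigma> \<in> rips \<epsilon> P"
  shows "\<exists>U\<in>\<V>. \<sigma> \<subseteq> U"
proof -
  interpret graph_covering P ord \<V> orient by fact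
  have \<sigma>P: "\<sigma> \<subseteq> P" "\<sigma> \<noteq> {}" and d: "\<And>p q. p \<in> \<sigma> \<Longrightarrow> q \<in> \<sigma> \<Longrightarrow> dist p q \<le> \<epsilon>"
    using \<sigma> by (auto simp: rips_def)
  obtain p where p: "p \<in> \<sigma>" "p \<in> P" using \<sigma>P by auto
  show ?thesis
  proof (rule cover_cases[OF p(2)])
    fix U assume U: "{X \<in> \<V>. p \<in> X} = {U}"
    have "eps_star P \<V> \<le> K_single P p U"
      unfolding eps_star_def by (rule Inf_lower) (use U p in blast)
    then have "ereal \<epsilon> < K_single P p U" using \<epsilon> by simp
    moreover have "K_single P p U \<le> ereal (dist p q)" if "q \<in> \<sigma>" "q \<notin> U" for q
      unfolding K_single_def by (rule INF_lower) (use that \<sigma>P in auto)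
    ultimately have "q \<in> U" if "q \<in> \<sigma>" for q
      using d[OF p(1) that] that by (metis ereal_less_eq(3) leD order_less_le_trans)
    then show ?thesis using U by blast
  next
    fix U W assume UW: "U \<noteq> W" "{X \<in> \<V>. p \<in> X} = {U, W}"
    have "eps_star P \<V> \<le> min (K_double' P p U W) (K_double'' P p U W)"
      unfolding eps_star_def by (rule Inf_lower) (use UW p in blast)
    then have \<epsilon>': "ereal \<epsilon> < K_double' P p U W" "ereal \<epsilon> < K_double'' P p U W" using \<epsilon> by auto
    \<comment> \<open>Every vertex of the simplex meets the nearness condition in
      \<open>K_double''\<close>, because \<epsilon> is below \<open>K_double'\<close>.\<close>
    have near: "ereal (dist p q) < K_double' P p U W" if "q \<in> \<sigma>" for q
      using d[OF p(1) that] \<epsilon>'(1) by (metis ereal_less_eq(3) order_le_less_trans)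
    show ?thesis
    proof (rule ccontr)
      assume "\<not> ?thesis"
      moreover have "U \<in> \<V>" "W \<in> \<V>" using UW by blast+
      ultimately obtain q q' where q: "q \<in> \<sigma>" "q \<notin> U" "q' \<in> \<sigma>" "q' \<notin> W" by blast
      have "K_double'' P p U W \<le> ereal (dist q q')"
        unfolding K_double''_def by (rule Inf_lower) (use q \<sigma>P near in blast)
      with \<epsilon>'(2) have "ereal \<epsilon> < ereal (dist q q')" by (rule order_less_le_trans)
      then show False using d[OF q(1,3)] by simp
    qed
  qed
qed

locale rips_filtration = graph_covering P ord \<V> orient + covered_rips \<V> ord orient \<epsilon> n
  for P :: "'p::metric_space set" and ord \<V> orient \<epsilon> n +
  fixes N :: nat
  assumes eps_step: "\<And>i. i \<in> {1..<N} \<Longrightarrow> \<epsilon> i < \<epsilon> (Suc i)"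
    and eps_small: "ereal (\<epsilon> N) < eps_star P \<V>"
begin

abbreviation "global i \<equiv> rips (\<epsilon> i) P"
abbreviation "cls_at i \<equiv> covered_complex.cls ord \<V> (R_local i)"
abbreviation "cls0_at i \<equiv> covered_complex.cls0 ord \<V> orient (R_local i) (int n)"
abbreviation "lifting_at i \<equiv> covered_complex.lifting P ord \<V> orient (R_local i) (int n)"
abbreviation "connecting_at i \<equiv> covered_complex.connecting P ord \<V> orient (global i) (R_local i) (int n)"
abbreviation "glue_at i \<equiv> covered_complex.glue ord \<V> orient (global i) (R_local i) (int n)"
abbreviation "gcls i \<equiv> homology_class ord (global i) (int n)"

lemma eps_le: "i \<le> N \<Longrightarrow> 1 \<le> i \<Longrightarrow> \<epsilon> i \<le> \<epsilon> N"
proof (induction i rule: inc_induct)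
  case (step i)
  then show ?case using eps_step[of i] by simp
qed simp

lemma complex_at:
  assumes "i \<in> {1..N}"
  shows "covered_complex P ord \<V> orient (global i) (R_local i)"
proof
  show "subcomplex P (global i)" by (rule rips_subcomplex)
  have "\<epsilon> i \<le> \<epsilon> N" using eps_le assms by simp
  then have "ereal (\<epsilon> i) < eps_star P \<V>" using eps_small by (metis ereal_less_eq(3) order_le_less_trans)
  then show "\<exists>U\<in>\<V>. \<sigma> \<subseteq> U" if "\<sigma> \<in> global i" for \<sigma>
    using rips_simplex_covered[OF graph_covering_axioms _ that] by simp
  show "R_local i c = {\<sigma> \<in> global i. \<sigma> \<subseteq> \<Inter>c}" if "c \<in> nerve \<V>" for c
  proof -
    have "\<Inter>c \<subseteq> P" using that Union_cover by (auto simp: nerve_def)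
    then show ?thesis by (auto simp: R_local_def rips_def)
  qed
qed

lemma H0_eq: "H0 i k = cosheaf_H0 (nerve \<V>) orient (homology_cosheaf ord (R_local i) k)"
  and H1_eq: "H1 i k = cosheaf_H1 (nerve \<V>) orient (homology_cosheaf ord (R_local i) k)"
  by (simp_all add: H0_def H1_def F_def)

lemma class_fam_eq: "i \<in> {1..N} \<Longrightarrow> class_fam i j k x = cls_at i j k x"
  by (simp add: class_fam_def dsum_map_def covered_complex.cls_def[OF complex_at])

lemma H0_class_eq: "i \<in> {1..N} \<Longrightarrow> H0_class i x = cls0_at i x"
  by (simp add: H0_class_def F_def class_fam_eq covered_complex.cls0_def[OF complex_at])

section \<open>Passage from one parameter to the next\<close>

context
  fixes i assumes i: "i \<in> {1..<N}"
begin

interpretation s: covered_complex P ord \<V> orient "global i" "R_local i"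
  by (rule complex_at) (use i in simp)

interpretation t: covered_complex P ord \<V> orient "global (Suc i)" "R_local (Suc i)"
  by (rule complex_at) (use i in simp)

lemma global_mono: "global i \<subseteq> global (Suc i)"
  by (rule rips_mono) (use eps_step[OF i] in simp)

lemma local_mono: "R_local i c \<subseteq> R_local (Suc i) c"
  unfolding R_local_def by (rule rips_mono) (use eps_step[OF i] in simp)

text \<open>Chains are extended by zero, so a family for one parameter is, unchanged, a family for
  the next.\<close>

lemma chain_fams_step: "x \<in> s.chain_fams j k \<Longrightarrow> x \<in> t.chain_fams j k"
  using chains_mono[OF local_mono, of _ k] unfolding s.chain_fams_def t.chain_fams_def by blast

lemma cycle_fams_step: "x \<in> s.cycle_fams j k \<Longrightarrow> x \<in> t.cycle_fams j k"
  using chain_fams_step by (auto simp: s.cycle_fams_iff t.cycle_fams_iff)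

lemma lifting_step: "lifting_at i x y \<Longrightarrow> lifting_at (Suc i) x y"
  using chain_fams_step cycle_fams_step by (auto simp: s.lifting_def t.lifting_def)

lemma lift_fams_step: "x \<in> s.lift_fams (int n - 1) \<Longrightarrow> x \<in> t.lift_fams (int n - 1)"
  using s.lifting_exists lifting_step t.lifting_lift_fams by metis

lemma dsum_map_cls:
  assumes x: "x \<in> s.cycle_fams j k"
  shows "dsum_map (cells j) (\<phi> i k) (cls_at i j k x) = cls_at (Suc i) j k (x :: _ \<Rightarrow> _ \<Rightarrow> 'k::field)"
  unfolding dsum_map_def s.cls_def t.cls_def
proof (rule restrict_ext)
  fix c assume c: "c \<in> cells j"
  have "x c \<in> cycles ord (R_local i c) k" using x c by (auto simp: s.cycle_fams_def)
  from homology_map_class(1)[OF s.R_subcomplex[OF c] t.R_subcomplex[OF c] local_mono this]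
  show "\<phi> i k c ((\<lambda>c\<in>cells j. homology_class ord (R_local i c) k (x c)) c) =
      homology_class ord (R_local (Suc i) c) k (x c)"
    using c by (simp add: \<phi>_def)
qed

lemma H1_map_cls:
  "x \<in> s.lift_fams k \<Longrightarrow> H1_map i k (cls_at i 1 k x) = cls_at (Suc i) 1 k (x :: _ \<Rightarrow> _ \<Rightarrow> 'k::field)"
  using dsum_map_cls[of x 1 k] by (simp add: H1_map_def cosheaf_H1_map_def s.lift_fams_def)

lemma H0_map_cls0:
  fixes u :: "('p, 'k::field) chain_family"
  assumes u: "u \<in> s.cycle_fams 0 (int n)"
  shows "H0_map i (int n) (cls0_at i u) = cls0_at (Suc i) u"
proof -
  let ?k = "int n"
  have lin: "linmap (s.HC 0 ?k) (t.HC 0 ?k :: ('k, _) module) (dsum_map verts (\<phi> i ?k))"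
    unfolding s.HC_eq t.HC_eq \<phi>_def
    by (rule linear_map_dsum_map, rule linear_homology_map[OF s.R_subcomplex t.R_subcomplex local_mono])
  have sub: "dsum_map verts (\<phi> i ?k) ` (cosheaf_image (nerve \<V>) orient (s.HF ?k) :: (_ \<Rightarrow> ('p set \<Rightarrow> 'k) set) set)
      \<subseteq> cosheaf_image (nerve \<V>) orient (t.HF ?k)"
    unfolding s.cosheaf_image_eq t.cosheaf_image_eq
    by (auto simp: dsum_map_cls[OF s.E_cycle_fams] intro!: imageI cycle_fams_step)
  have cu: "cls_at i 0 ?k u \<in> carrier (s.HC 0 ?k)" using u by (auto simp: s.carrier_HC)
  have "H0_map i ?k (cls0_at i u) =
      quotient_map (t.HC 0 ?k) (cosheaf_image (nerve \<V>) orient (t.HF ?k)) (dsum_map verts (\<phi> i ?k))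
        (cosheaf_image (nerve \<V>) orient (s.HF ?k) +>\<^bsub>s.HC 0 ?k\<^esub> cls_at i 0 ?k u)"
    by (simp add: H0_map_def cosheaf_H0_map_def F_def s.cls0_def)
  also have "\<dots> = cosheaf_image (nerve \<V>) orient (t.HF ?k) +>\<^bsub>t.HC 0 ?k\<^esub> dsum_map verts (\<phi> i ?k) (cls_at i 0 ?k u)"
    by (rule quotient_map_coset[OF s.vectorspace_HC s.subspace_cosheaf_image t.vectorspace_HC
          t.subspace_cosheaf_image lin sub cu])
  finally show ?thesis by (simp add: dsum_map_cls[OF u] t.cls0_def)
qed

lemma linear_H1_map:
  "linmap (H1 i (int n - 1)) (H1 (Suc i) (int n - 1) :: ('k::field, _) module) (H1_map i (int n - 1))"
  unfolding H1_eq
proof (rule linear_map_descend[OF s.linear_cls1])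
  let ?k = "int n - 1"
  show "carrier (s.HH1 ?k) = cls_at i 1 ?k ` carrier (fam_space (s.lift_fams ?k) :: ('k, _) module)"
    by (simp add: s.carrier_HH1)
  have "linmap (fam_space (s.lift_fams ?k)) (fam_space (t.lift_fams ?k) :: ('k, _) module) (\<lambda>x. x)"
    using linear_mapD(1)[OF s.linear_cls1] linear_mapD(1)[OF t.linear_cls1] lift_fams_step
    by (intro linear_mapI) auto
  from linear_map_compose[OF this t.linear_cls1]
  show "linmap (fam_space (s.lift_fams ?k)) (t.HH1 ?k :: ('k, _) module) (cls_at (Suc i) 1 ?k)" .
qed (simp add: H1_map_cls)

lemma linear_H0_map:
  "linmap (H0 i (int n)) (H0 (Suc i) (int n) :: ('k::field, _) module) (H0_map i (int n))"
  unfolding H0_eq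
proof (rule linear_map_descend[OF s.linear_cls0])
  let ?k = "int n"
  show "carrier (s.HH0 ?k) = cls0_at i ` carrier (fam_space (s.cycle_fams 0 ?k) :: ('k, _) module)"
    by (simp add: s.carrier_HH0)
  have "linmap (fam_space (s.cycle_fams 0 ?k)) (fam_space (t.cycle_fams 0 ?k) :: ('k, _) module) (\<lambda>x. x)"
    using cycle_fams_step
    by (intro linear_mapI s.vectorspace_cycle_fams t.vectorspace_cycle_fams) auto
  from linear_map_compose[OF this t.linear_cls0]
  show "linmap (fam_space (s.cycle_fams 0 ?k)) (t.HH0 ?k :: ('k, _) module) (cls0_at (Suc i))" .
qed (simp add: H0_map_cls0)

lemma linear_global_map:
  "linmap (global_space P i) (global_space P (Suc i) :: ('k::field, _) module) (global_map P i)"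
  unfolding global_space_def global_map_def by (rule linear_homology_map[OF s.K t.K global_mono])

lemma global_map_class:
  "c \<in> cycles ord (global i) (int n) \<Longrightarrow> global_map P i (gcls i c) = gcls (Suc i) (c :: _ \<Rightarrow> 'k::field)"
  unfolding global_map_def by (rule homology_map_class(1)[OF s.K t.K global_mono])

text \<open>Naturality is visible on representatives: both sides are the class of the same chain
  \<open>J u\<close> in the larger complex.\<close>

lemma glue_step:
  fixes X :: "('p, 'k::field) class_family set"
  assumes X: "X \<in> carrier (H0 i (int n))"
  shows "glue_at (Suc i) (H0_map i (int n) X) = global_map P i (glue_at i X)"
proof -
  obtain u where u: "X = cls0_at i u" "u \<in> s.cycle_fams 0 (int n)"
    using X by (auto simp: H0_eq s.carrier_HH0)
  then show ?thesis
    by (simp add: H0_map_cls0 s.glue_cls0 t.glue_cls0 cycle_fams_step global_map_class s.J_cycles)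
qed

end

section \<open>Chain-level notions of the construction at one parameter\<close>

context
  fixes i assumes i: "i \<in> {1..N}"
begin

interpretation s: covered_complex P ord \<V> orient "global i" "R_local i"
  by (rule complex_at) (rule i)

lemma C_fam_eq: "C_fam i j k = dsum (cells j) (\<lambda>c. chains (R_local i c) k)"
  by (simp add: C_fam_def cosheaf_chains_def chain_cosheaf_def)

lemma vectorspace_C_fam: "vspace (C_fam i j k :: ('k::field, _) module)"
  unfolding C_fam_eq by (intro vectorspace_dsum vectorspace_chains)

lemma carrier_C_fam:
  "x \<in> carrier (C_fam i j k) \<longleftrightarrow> x \<in> extensional (cells j) \<and> x \<in> s.chain_fams j k"
  by (auto simp: C_fam_eq carrier_dsum_iff s.chain_fams_def)

lemma bd_fam_eq:
  "x \<in> s.chain_fams j k \<Longrightarrow> bd_fam i j k x = (\<lambda>c\<in>cells j. D (x c))"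
  unfolding bd_fam_def dsum_map_def
  by (rule restrict_ext) (auto simp: s.chain_fams_def boundary_eq[OF s.R_subcomplex])

lemma e_map_eq:
  fixes x :: "('p, 'k::field) chain_family"
  assumes x: "x \<in> s.chain_fams 1 k"
  shows "e_map i k x = (\<lambda>v\<in>verts. E x v)"
  unfolding e_map_def cosheaf_boundary_def
proof (rule restrict_ext, rule ext)
  fix v \<sigma> assume v: "v \<in> verts"
  let ?C = "chains (R_local i v) k :: ('k, _) module"
  have xe: "x e \<in> carrier ?C" if "e \<in> {e \<in> edges. v \<subseteq> e}" for e
    using x that v chains_mono[OF s.R_face, of e v k] by (auto simp: s.chain_fams_def)
  have "(\<Oplus>\<^bsub>?C\<^esub>e\<in>{e \<in> edges. v \<subseteq> e}. (\<lambda>\<sigma>. inc v e * x e \<sigma>)) \<sigma> = (\<Sum>e\<in>{e \<in> edges. v \<subseteq> e}. inc v e * x e \<sigma>)"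
    by (rule finsum_additive[OF vectorspace_chains]) (use xe in \<open>auto simp: chains_smult\<close>)
  then show "(\<Oplus>\<^bsub>stalk (chain_cosheaf (R_local i) k) v\<^esub>e\<in>{e \<in> edges. v \<subseteq> e}.
      inc v e \<odot>\<^bsub>stalk (chain_cosheaf (R_local i) k) v\<^esub> extension (chain_cosheaf (R_local i) k) e v (x e)) \<sigma> = E x v \<sigma>"
    by (simp add: chain_cosheaf_def E_def)
qed

text \<open>The equation in the direct sum is one between extensional functions; evaluated at the
  edges it gives the cycle condition for plain families.\<close>

lemma representsD:
  assumes "represents i x b"
  shows "x \<in> carrier (C_fam i 1 (int n - 1))" "x \<in> s.cycle_fams 1 (int n - 1)" "cls_at i 1 (int n - 1) x = b"
proof -
  from assms have x: "x \<in> carrier (C_fam i 1 (int n - 1))"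
    and bd: "bd_fam i 1 (int n - 1) x = \<zero>\<^bsub>C_fam i 1 (int n - 2)\<^esub>"
    and b: "class_fam i 1 (int n - 1) x = b"
    by (auto simp: represents_def a_kernel_eq)
  show "x \<in> carrier (C_fam i 1 (int n - 1))" by fact
  show "cls_at i 1 (int n - 1) x = b" using b i by (simp add: class_fam_eq)
  have x': "x \<in> s.chain_fams 1 (int n - 1)" using x by (simp add: carrier_C_fam)
  have "D (x e) = 0" if "e \<in> edges" for e
    using fun_cong[OF bd, of e] that by (simp add: bd_fam_eq[OF x'] C_fam_eq)
  then show "x \<in> s.cycle_fams 1 (int n - 1)" using x' by (simp add: s.cycle_fams_iff)
qed

lemma lifts_lifting:
  assumes x: "represents i x b" and y: "lifts i y x"
  shows "lifting_at i x y" "y \<in> carrier (C_fam i 0 (int n))"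
proof -
  note xD = representsD[OF x]
  from y have yc: "y \<in> carrier (C_fam i 0 (int n))" and bd: "bd_fam i 0 (int n) y = e_map i (int n - 1) x"
    by (auto simp: lifts_def)
  show "y \<in> carrier (C_fam i 0 (int n))" by fact
  have x': "x \<in> s.chain_fams 1 (int n - 1)" and y': "y \<in> s.chain_fams 0 (int n)"
    using xD(1) yc by (simp_all add: carrier_C_fam)
  have "D (y v) = E x v" if "v \<in> verts" for v
    using fun_cong[OF bd, of v] that by (simp add: bd_fam_eq[OF y'] e_map_eq[OF x'])
  then show "lifting_at i x y" using xD y' by (simp add: s.lifting_def)
qed

lemma C_fam_sum:
  fixes x :: "'i \<Rightarrow> ('p, 'k::field) chain_family"
  assumes x: "\<And>c. c \<in> I \<Longrightarrow> x c \<in> carrier (C_fam i j k)" and c: "c \<in> cells j"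
  shows "(\<Oplus>\<^bsub>C_fam i j k\<^esub>b\<in>I. d b \<odot>\<^bsub>C_fam i j k\<^esub> x b) c = (\<lambda>\<sigma>. \<Sum>b\<in>I. d b * x b c \<sigma>)"
proof
  fix \<sigma>
  have "(\<Oplus>\<^bsub>C_fam i j k\<^esub>b\<in>I. d b \<odot>\<^bsub>C_fam i j k\<^esub> x b) c \<sigma> = (\<Sum>b\<in>I. (d b \<odot>\<^bsub>C_fam i j k\<^esub> x b) c \<sigma>)"
  proof (rule finsum_additive[OF vectorspace_C_fam])
    show "d b \<odot>\<^bsub>C_fam i j k\<^esub> x b \<in> carrier (C_fam i j k)" if "b \<in> I" for b
      by (rule vs_smult_closed[OF vectorspace_C_fam x[OF that]])
  qed (use c in \<open>simp_all add: C_fam_eq\<close>)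
  then show "(\<Oplus>\<^bsub>C_fam i j k\<^esub>b\<in>I. d b \<odot>\<^bsub>C_fam i j k\<^esub> x b) c \<sigma> = (\<Sum>b\<in>I. d b * x b c \<sigma>)"
    using c by (simp add: C_fam_eq)
qed

lemma vectorspace_H1: "vspace (H1 i k :: ('k::field, _) module)"
  and vectorspace_global: "vspace (global_space P i :: ('k::field, _) module)"
  unfolding H1_eq global_space_def
  by (rule s.vectorspace_HH1 vectorspace_homology[OF s.K])+

end

end

section \<open>The inductive construction\<close>

locale rips_construction = rips_filtration P ord \<V> orient \<epsilon> n N +
    inductive_construction \<V> ord orient \<epsilon> n N A B_A B_ker rep \<Gamma> C rep_C \<Gamma>_C \<alpha> \<psi>
  for P :: "'p::metric_space set" and ord \<V> orient \<epsilon> n N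
    and A B_A B_ker :: "nat \<Rightarrow> ('p, 'k::field) class_family set"
    and rep \<Gamma> C rep_C \<Gamma>_C \<alpha> \<psi>
begin

abbreviation "H i \<equiv> H1 i (int n - 1) :: ('k, ('p, 'k) class_family) module"
abbreviation "G i \<equiv> global_space P i :: ('k, ('p set \<Rightarrow> 'k) set) module"
abbreviation "h i \<equiv> H1_map i (int n - 1) :: ('p, 'k) class_family \<Rightarrow> ('p, 'k) class_family"

lemma subspace_ker: "i \<in> {1..<N} \<Longrightarrow> subsp (ker_H1_map i) (H i)"
  unfolding ker_H1_map_def by (rule subspace_kernel[OF linear_H1_map])

lemma ker_iff: "y \<in> ker_H1_map i \<longleftrightarrow> y \<in> carrier (H i) \<and> h i y = \<zero>\<^bsub>H (Suc i)\<^esub>"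
  by (simp add: ker_H1_map_def a_kernel_eq)

lemma basis_indep:
  assumes i: "i \<in> {1..<N}" and T: "finite T" "T \<subseteq> B_A i \<union> B_ker i"
    and 0: "(\<Oplus>\<^bsub>H i\<^esub>b\<in>T. a b \<odot>\<^bsub>H i\<^esub> b) = \<zero>\<^bsub>H i\<^esub>"
  shows "\<forall>b\<in>T. a b = 0"
proof -
  have V: "vspace (H i)" by (rule vectorspace_H1) (use i in simp)
  show ?thesis
    by (rule complementary_bases_indep[OF V A_subspace[OF i] basis_A[OF i] subspace_ker[OF i] basis_ker[OF i]
          A_inter[OF i] T 0])
qed

text \<open>The invariant of the construction: a cycle for \<open>b\<close> with an admissible
  \<Gamma>. It depends only on the values at edges and vertices and imposes no extensionality, so it
  passes unchanged to the next parameter.\<close>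

definition realizes :: "nat \<Rightarrow> ('p, 'k) chain_family \<Rightarrow> ('p, 'k) chain_family \<Rightarrow> ('p, 'k) class_family \<Rightarrow> bool" where
  "realizes i x y b \<longleftrightarrow> lifting_at i x y \<and> cls_at i 1 (int n - 1) x = b"

lemma realizes_connecting:
  "i \<in> {1..N} \<Longrightarrow> realizes i x y b \<Longrightarrow> (b, gcls i (J y)) \<in> connecting_at i"
  unfolding realizes_def covered_complex.connecting_def[OF complex_at] by blast

lemma realizes_I:
  "i \<in> {1..N} \<Longrightarrow> represents i x b \<Longrightarrow> lifts i y x \<Longrightarrow> realizes i x y b"
  unfolding realizes_def using representsD(3) lifts_lifting(1) by blast

lemma realizes_step:
  assumes i: "i \<in> {1..<N}" and r: "realizes i x y b"
  shows "realizes (Suc i) x y (h i b)"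
proof -
  interpret s: covered_complex P ord \<V> orient "global i" "R_local i"
    by (rule complex_at) (use i in simp)
  have l: "lifting_at i x y" "cls_at i 1 (int n - 1) x = b" using r by (simp_all add: realizes_def)
  show ?thesis
    using lifting_step[OF i l(1)] H1_map_cls[OF i s.lifting_lift_fams[OF l(1)]] l(2) by (simp add: realizes_def)
qed

lemma realizes_cong:
  assumes i: "i \<in> {1..N}" and r: "realizes i x y b"
    and "\<And>e. e \<in> edges \<Longrightarrow> x' e = x e" "\<And>v. v \<in> verts \<Longrightarrow> y' v = y v"
  shows "realizes i x' y' b"
proof -
  interpret t: covered_complex P ord \<V> orient "global i" "R_local i" by (rule complex_at[OF i])
  from r have l: "lifting_at i x y" "cls_at i 1 (int n - 1) x = b" by (simp_all add: realizes_def)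
  have "lifting_at i x' y'" using t.lifting_cong[OF l(1) assms(3,4)] .
  moreover have "cls_at i 1 (int n - 1) x' = b" using t.cls_cong[of 1 x' x, OF assms(3)] l(2) by simp
  ultimately show ?thesis by (simp add: realizes_def)
qed

text \<open>\<open>\<kappa>\<close> and \<open>\<iota>\<close> merely cut families down to edges and
  vertices. This supplies the extensionality that \<open>C_fam\<close> demands and does not affect
  \<open>realizes\<close>.\<close>

lemma restrict_step:
  assumes i: "i \<in> {1..<N}" and r: "realizes i x y b"
  shows "realizes (Suc i) (\<kappa> x) (\<iota> y) (h i b)"
    and "\<kappa> x \<in> carrier (C_fam (Suc i) 1 (int n - 1))" and "\<iota> y \<in> carrier (C_fam (Suc i) 0 (int n))"
    and "class_fam (Suc i) 1 (int n - 1) (\<kappa> x) = h i b"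
proof -
  have i': "Suc i \<in> {1..N}" using i by simp
  interpret t: covered_complex P ord \<V> orient "global (Suc i)" "R_local (Suc i)"
    by (rule complex_at[OF i'])
  show *: "realizes (Suc i) (\<kappa> x) (\<iota> y) (h i b)"
    by (rule realizes_cong[OF i' realizes_step[OF i r]]) (simp_all add: \<kappa>_def \<iota>_def dsum_map_def)
  then show "\<kappa> x \<in> carrier (C_fam (Suc i) 1 (int n - 1))" "\<iota> y \<in> carrier (C_fam (Suc i) 0 (int n))"
    "class_fam (Suc i) 1 (int n - 1) (\<kappa> x) = h i b"
    by (simp_all add: realizes_def t.lifting_def carrier_C_fam[OF i'] t.cycle_fams_iff class_fam_eq[OF i'])
      (simp_all add: \<kappa>_def \<iota>_def dsum_map_def)
qed

text \<open>\<open>prev\<close> is a hypothesis because this lemma serves the induction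
  \<open>basis_realizes\<close>, which establishes it for all stages.\<close>

lemma C_realizes:
  assumes i: "1 \<le> i" "Suc i < N" and prev: "\<And>b. b \<in> B_A i \<Longrightarrow> realizes i (rep i b) (\<Gamma> i b) b"
    and c: "c \<in> C (Suc i)"
  shows "realizes (Suc i) (rep_C (Suc i) c) (\<Gamma>_C (Suc i) c) c"
    and "rep_C (Suc i) c \<in> carrier (C_fam (Suc i) 1 (int n - 1))"
    and "\<Gamma>_C (Suc i) c \<in> carrier (C_fam (Suc i) 0 (int n))"
proof -
  have i0: "i \<in> {1..<N}" and i': "Suc i \<in> {1..N}" using i by auto
  let ?f = "\<lambda>b. class_fam (Suc i) 1 (int n - 1) (\<kappa> (rep i b))"
  have "realizes (Suc i) (rep_C (Suc i) c) (\<Gamma>_C (Suc i) c) c \<and>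
    rep_C (Suc i) c \<in> carrier (C_fam (Suc i) 1 (int n - 1)) \<and>
    \<Gamma>_C (Suc i) c \<in> carrier (C_fam (Suc i) 0 (int n))"
  proof (cases "c \<in> ?f ` B_A i")
    case True
    then obtain b where b: "b \<in> B_A i" "c = ?f b" by blast
    note r = restrict_step[OF i0 prev[OF b(1)]]
    have "rep_C (Suc i) c = \<kappa> (rep i b)" "\<Gamma>_C (Suc i) c = \<iota> (\<Gamma> i b)"
      using C_on_image[OF i b] by auto
    then show ?thesis using r b(2) by simp
  next
    case False
    then have "represents (Suc i) (rep_C (Suc i) c) c" "lifts (Suc i) (\<Gamma>_C (Suc i) c) (rep_C (Suc i) c)"
      using C_off_image[OF i] c by auto
    then show ?thesis using realizes_I[OF i'] representsD(1)[OF i'] lifts_lifting(2)[OF i'] by blast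
  qed
  then show "realizes (Suc i) (rep_C (Suc i) c) (\<Gamma>_C (Suc i) c) c"
    "rep_C (Suc i) c \<in> carrier (C_fam (Suc i) 1 (int n - 1))"
    "\<Gamma>_C (Suc i) c \<in> carrier (C_fam (Suc i) 0 (int n))" by blast+
qed

text \<open>One coefficient function is shared by the class, the cycle and the chain \<Gamma>. This
  is what makes a linear \<gamma> with prescribed values on \<open>C\<close> take the intended
  values on the basis of the stage.\<close>

definition expands :: "nat \<Rightarrow> ('p, 'k) class_family \<Rightarrow> (('p, 'k) class_family \<Rightarrow> 'k) \<Rightarrow> bool" where
  "expands i b d \<longleftrightarrow> b = (\<Oplus>\<^bsub>H (Suc i)\<^esub>c\<in>C (Suc i). d c \<odot>\<^bsub>H (Suc i)\<^esub> c) \<and>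
     (\<forall>e\<in>edges. rep (Suc i) b e = (\<lambda>\<sigma>. \<Sum>c\<in>C (Suc i). d c * rep_C (Suc i) c e \<sigma>)) \<and>
     (\<forall>v\<in>verts. \<Gamma> (Suc i) b v = (\<lambda>\<sigma>. \<Sum>c\<in>C (Suc i). d c * \<Gamma>_C (Suc i) c v \<sigma>))"

lemma expansion_realized:
  assumes i: "1 \<le> i" "Suc i < N" and prev: "\<And>b. b \<in> B_A i \<Longrightarrow> realizes i (rep i b) (\<Gamma> i b) b"
    and b: "b \<in> B_A (Suc i) \<union> B_ker (Suc i)"
  obtains d where "expands i b d"
proof -
  have i': "Suc i \<in> {1..N}" using i by auto
  obtain d where d: "b = (\<Oplus>\<^bsub>H (Suc i)\<^esub>c\<in>C (Suc i). d c \<odot>\<^bsub>H (Suc i)\<^esub> c)"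
    "rep (Suc i) b = (\<Oplus>\<^bsub>C_fam (Suc i) 1 (int n - 1)\<^esub> c\<in>C (Suc i). d c \<odot>\<^bsub>C_fam (Suc i) 1 (int n - 1)\<^esub> rep_C (Suc i) c)"
    "\<Gamma> (Suc i) b = (\<Oplus>\<^bsub>C_fam (Suc i) 0 (int n)\<^esub> c\<in>C (Suc i). d c \<odot>\<^bsub>C_fam (Suc i) 0 (int n)\<^esub> \<Gamma>_C (Suc i) c)"
    using expansion[OF i b] by blast
  have "expands i b d"
    unfolding expands_def
  proof (intro conjI ballI)
    show "b = (\<Oplus>\<^bsub>H (Suc i)\<^esub>c\<in>C (Suc i). d c \<odot>\<^bsub>H (Suc i)\<^esub> c)" by (rule d(1))
    show "rep (Suc i) b e = (\<lambda>\<sigma>. \<Sum>c\<in>C (Suc i). d c * rep_C (Suc i) c e \<sigma>)" if "e \<in> edges" for e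
      unfolding d(2) by (rule C_fam_sum[OF i' _ that]) (rule C_realizes(2)[OF i prev])
    show "\<Gamma> (Suc i) b v = (\<lambda>\<sigma>. \<Sum>c\<in>C (Suc i). d c * \<Gamma>_C (Suc i) c v \<sigma>)" if "v \<in> verts" for v
      unfolding d(3) by (rule C_fam_sum[OF i' _ that]) (rule C_realizes(3)[OF i prev])
  qed
  then show thesis by (rule that)
qed

text \<open>Combinations with common coefficients preserve the realizing relation, so it passes from
  the previous \<open>B_A\<close> to \<open>C\<close>, and from \<open>C\<close> to the bases of the
  stage.\<close>

lemma basis_realizes:
  assumes "1 \<le> i" "i < N" "b \<in> B_A i \<union> B_ker i"
  shows "realizes i (rep i b) (\<Gamma> i b) b"
  using assms
proof (induction i arbitrary: b rule: nat_induct_at_least)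
  case base
  then show ?case using stage_1[OF _ base(2)] realizes_I[of 1] by simp
next
  case (Suc i)
  have i: "1 \<le> i" "Suc i < N" and i': "Suc i \<in> {1..N}" using Suc by auto
  have prev: "\<And>b. b \<in> B_A i \<Longrightarrow> realizes i (rep i b) (\<Gamma> i b) b" using Suc.IH i by simp
  obtain d where d: "expands i b d"
    by (rule expansion_realized[OF i prev Suc.prems(2)])
  note d = d[unfolded expands_def, THEN conjunct1] d[unfolded expands_def, THEN conjunct2]
  interpret t: covered_complex P ord \<V> orient "global (Suc i)" "R_local (Suc i)"
    by (rule complex_at[OF i'])
  have V: "vspace (H (Suc i))" by (rule vectorspace_H1[OF i'])
  interpret V: vectorspace class_ring "H (Suc i)" by (rule V)
  have r: "lifting_at (Suc i) (rep_C (Suc i) c) (\<Gamma>_C (Suc i) c)"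
    "cls_at (Suc i) 1 (int n - 1) (rep_C (Suc i) c) = c" if "c \<in> C (Suc i)" for c
    using C_realizes(1)[OF i prev that] by (auto simp: realizes_def)
  have "cls_at (Suc i) 1 (int n - 1) (\<lambda>e \<sigma>. \<Sum>c\<in>C (Suc i). d c * rep_C (Suc i) c e \<sigma>) =
      (\<Oplus>\<^bsub>H (Suc i)\<^esub>c\<in>C (Suc i). d c \<odot>\<^bsub>H (Suc i)\<^esub> cls_at (Suc i) 1 (int n - 1) (rep_C (Suc i) c))"
    unfolding H1_eq by (rule t.cls_sum) (rule t.lifting_lift_fams[OF r(1)])
  also have "\<dots> = b"
  proof -
    have "c \<in> carrier (H (Suc i))" if "c \<in> C (Suc i)" for c
      using C_basis[OF i] that unfolding V.basis_def by blast
    then show ?thesis unfolding d(1)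
      by (intro V.finsum_cong') (auto simp: r(2) intro: vs_smult_closed[OF V])
  qed
  finally have "realizes (Suc i) (\<lambda>e \<sigma>. \<Sum>c\<in>C (Suc i). d c * rep_C (Suc i) c e \<sigma>)
      (\<lambda>v \<sigma>. \<Sum>c\<in>C (Suc i). d c * \<Gamma>_C (Suc i) c v \<sigma>) b"
    using t.lifting_sum[OF r(1)] by (simp add: realizes_def)
  then show ?case by (rule realizes_cong[OF i']) (simp_all add: d(2))
qed

section \<open>Choice of the splittings\<close>

lemma gcls_J_sum:
  fixes y :: "'i \<Rightarrow> ('p, 'k) chain_family"
  assumes i: "i \<in> {1..N}" and y: "\<And>c. c \<in> I \<Longrightarrow> J (y c) \<in> cycles ord (global i) (int n)"
  shows "gcls i (J (\<lambda>v \<sigma>. \<Sum>c\<in>I. d c * y c v \<sigma>)) = (\<Oplus>\<^bsub>G i\<^esub>c\<in>I. d c \<odot>\<^bsub>G i\<^esub> gcls i (J (y c)))"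
proof -
  have "J (\<lambda>v \<sigma>. \<Sum>c\<in>I. d c * y c v \<sigma>) = (\<lambda>\<sigma>. \<Sum>c\<in>I. d c * J (y c) \<sigma>)"
    unfolding J_def by (simp add: sum_distrib_left sum.swap[of _ I])
  then show ?thesis
    unfolding global_space_def using homology_class_sum[OF rips_subcomplex y] by simp
qed

text \<open>The third clause serves the square leaving stage \<open>i\<close> and is therefore asked
  only for \<open>i < N\<close>; the fourth serves the square entering it. In the fourth only
  \<open>B_A\<close> occurs, since the structure map kills \<open>B_ker\<close>.\<close>

definition compatible :: "nat \<Rightarrow> (('p, 'k) class_family \<Rightarrow> ('p set \<Rightarrow> 'k) set) \<Rightarrow> bool" where
  "compatible i \<gamma> \<longleftrightarrow> linmap (H i) (G i) \<gamma> \<and>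
     (\<forall>y\<in>carrier (H i). (y, \<gamma> y) \<in> connecting_at i) \<and>
     (i < N \<longrightarrow> (\<forall>b\<in>B_A i \<union> B_ker i. \<gamma> b = gcls i (J (\<Gamma> i b)))) \<and>
     (\<forall>j\<ge>1. i = Suc j \<longrightarrow> (\<forall>b\<in>B_A j. \<gamma> (h j b) = gcls i (J (\<Gamma> j b))))"

lemma select:
  fixes s :: "'i \<Rightarrow> ('p, 'k) class_family"
  assumes i: "i \<in> {1..N}" and st: "\<And>c. c \<in> I \<Longrightarrow> (s c, t c) \<in> connecting_at i"
    and indep: "\<And>T a. finite T \<Longrightarrow> T \<subseteq> I \<Longrightarrow> (\<Oplus>\<^bsub>H i\<^esub>c\<in>T. a c \<odot>\<^bsub>H i\<^esub> s c) = \<zero>\<^bsub>H i\<^esub> \<Longrightarrow> \<forall>c\<in>T. a c = 0"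
  obtains \<gamma> where "linmap (H i) (G i) \<gamma>" "\<forall>y\<in>carrier (H i). (y, \<gamma> y) \<in> connecting_at i"
    "\<forall>c\<in>I. \<gamma> (s c) = t c"
proof -
  interpret t: covered_complex P ord \<V> orient "global i" "R_local i" by (rule complex_at[OF i])
  have L: "subsp (connecting_at i) (direct_sum (H i) (G i))"
    unfolding H1_eq global_space_def by (rule t.subspace_connecting)
  have total: "\<exists>z. (y, z) \<in> connecting_at i" if "y \<in> carrier (H i)" for y
    by (rule t.connecting_total) (use that in \<open>simp add: H1_eq\<close>)
  show thesis
    by (rule linear_selection[OF vectorspace_H1[OF i] vectorspace_global[OF i] L total st indep])
      (assumption+, rule that, assumption, blast+)
qed

lemma compatible_1:
  assumes "1 \<le> N"
  shows "\<exists>\<gamma>. compatible 1 \<gamma>"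
proof -
  \<comment> \<open>With a single parameter no basis is constrained, and nothing is
    prescribed.\<close>
  let ?I = "if 1 < N then B_A 1 \<union> B_ker 1 else {}"
  have i: "1 \<in> {1..N}" using assms by simp
  obtain \<gamma> where \<gamma>: "linmap (H 1) (G 1) \<gamma>" "\<forall>y\<in>carrier (H 1). (y, \<gamma> y) \<in> connecting_at 1"
    "\<forall>b\<in>?I. \<gamma> b = gcls 1 (J (\<Gamma> 1 b))"
  proof (rule select[OF i, of ?I "\<lambda>b. b" "\<lambda>b. gcls 1 (J (\<Gamma> 1 b))"])
    show "(b, gcls 1 (J (\<Gamma> 1 b))) \<in> connecting_at 1" if "b \<in> ?I" for b
      using that basis_realizes[of 1 b] realizes_connecting[OF i] by (auto split: if_splits)
    show "\<forall>c\<in>T. a c = 0" if "finite T" "T \<subseteq> ?I" "(\<Oplus>\<^bsub>H 1\<^esub>c\<in>T. a c \<odot>\<^bsub>H 1\<^esub> c) = \<zero>\<^bsub>H 1\<^esub>" for T a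
      using that basis_indep[of 1 T a] by (auto split: if_splits)
  qed
  then have "compatible 1 \<gamma>" by (auto simp: compatible_def)
  then show ?thesis by blast
qed

lemma C_contains:
  assumes i: "1 \<le> i" "Suc i < N" and b: "b \<in> B_A i"
  shows "h i b \<in> C (Suc i)" "\<Gamma>_C (Suc i) (h i b) = \<iota> (\<Gamma> i b)"
proof -
  have i0: "i \<in> {1..<N}" using i by simp
  have r: "realizes i (rep i b) (\<Gamma> i b) b" using basis_realizes[of i b] i b by simp
  note c = restrict_step(4)[OF i0 r]
  show "h i b \<in> C (Suc i)" using C_image[OF i] b c by force
  show "\<Gamma>_C (Suc i) (h i b) = \<iota> (\<Gamma> i b)" using C_on_image[OF i b c[symmetric]] by simp
qed

lemma J_iota: "J (\<iota> y) = J y"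
  by (rule J_cong) (simp add: \<iota>_def dsum_map_def)

text \<open>Values are prescribed on \<open>C\<close> alone. Those on the basis of this stage follow
  by linearity from the common expansion, while the images of the previous \<open>B_A\<close> are
  members of \<open>C\<close> that carry the old chains \<Gamma>.\<close>

lemma compatible_middle:
  assumes i: "1 \<le> i" "Suc i < N"
  shows "\<exists>\<gamma>. compatible (Suc i) \<gamma>"
proof -
  have i0: "i \<in> {1..<N}" and i': "Suc i \<in> {1..N}" using i by auto
  interpret t: covered_complex P ord \<V> orient "global (Suc i)" "R_local (Suc i)"
    by (rule complex_at[OF i'])
  have prev: "\<And>b. b \<in> B_A i \<Longrightarrow> realizes i (rep i b) (\<Gamma> i b) b" using basis_realizes i by simp
  have V: "vspace (H (Suc i))" by (rule vectorspace_H1[OF i'])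
  interpret V: vectorspace class_ring "H (Suc i)" by (rule V)
  have W: "vspace (G (Suc i))" by (rule vectorspace_global[OF i'])
  interpret W: vectorspace class_ring "G (Suc i)" by (rule W)
  have whole: "subsp (carrier (H (Suc i))) (H (Suc i))"
    by (rule vs_subspaceI[OF V]) (auto intro: vs_smult_closed[OF V])
  have basis: "vectorspace.basis class_ring (H (Suc i)\<lparr>carrier := carrier (H (Suc i))\<rparr>) (C (Suc i))"
    using C_basis[OF i] by simp
  note Cb = basisD[OF V whole basis]
  let ?t = "\<lambda>c. gcls (Suc i) (J (\<Gamma>_C (Suc i) c))"
  obtain \<gamma> where \<gamma>: "linmap (H (Suc i)) (G (Suc i)) \<gamma>"
    "\<forall>y\<in>carrier (H (Suc i)). (y, \<gamma> y) \<in> connecting_at (Suc i)" "\<forall>c\<in>C (Suc i). \<gamma> c = ?t c"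
  proof (rule select[OF i', of "C (Suc i)" "\<lambda>c. c" ?t])
    show "(c, ?t c) \<in> connecting_at (Suc i)" if "c \<in> C (Suc i)" for c
      using C_realizes(1)[OF i prev that] realizes_connecting[OF i'] by blast
    show "\<forall>c\<in>T. a c = 0" if "finite T" "T \<subseteq> C (Suc i)"
      "(\<Oplus>\<^bsub>H (Suc i)\<^esub>c\<in>T. a c \<odot>\<^bsub>H (Suc i)\<^esub> c) = \<zero>\<^bsub>H (Suc i)\<^esub>" for T a
      using Cb(3)[OF that] .
  qed
  note \<gamma>' = linear_mapD[OF \<gamma>(1)]
  have "\<gamma> b = gcls (Suc i) (J (\<Gamma> (Suc i) b))" if b: "b \<in> B_A (Suc i) \<union> B_ker (Suc i)" for b
  proof -
    obtain d where d: "expands i b d"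
      by (rule expansion_realized[OF i prev b])
    note d = d[unfolded expands_def, THEN conjunct1] d[unfolded expands_def, THEN conjunct2, THEN conjunct2]
    have cyc: "J (\<Gamma>_C (Suc i) c) \<in> cycles ord (global (Suc i)) (int n)" if "c \<in> C (Suc i)" for c
      using C_realizes(1)[OF i prev that] t.lifting_J by (auto simp: realizes_def)
    have cH: "c \<in> carrier (H (Suc i))" if "c \<in> C (Suc i)" for c using Cb(1) that by auto
    have "\<gamma> b = (\<Oplus>\<^bsub>G (Suc i)\<^esub>c\<in>C (Suc i). \<gamma> (d c \<odot>\<^bsub>H (Suc i)\<^esub> c))"
      unfolding d(1) by (rule linear_map_finsum[OF \<gamma>(1)]) (rule vs_smult_closed[OF V cH])
    also have "\<dots> = (\<Oplus>\<^bsub>G (Suc i)\<^esub>c\<in>C (Suc i). d c \<odot>\<^bsub>G (Suc i)\<^esub> ?t c)"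
    proof (rule W.finsum_cong')
      fix c assume c: "c \<in> C (Suc i)"
      show "\<gamma> (d c \<odot>\<^bsub>H (Suc i)\<^esub> c) = d c \<odot>\<^bsub>G (Suc i)\<^esub> ?t c"
        using \<gamma>'(5)[OF cH[OF c], of "d c"] \<gamma>(3) c by simp
    next
      show "(\<lambda>c. d c \<odot>\<^bsub>G (Suc i)\<^esub> ?t c) \<in> C (Suc i) \<rightarrow> carrier (G (Suc i))"
        using \<gamma>'(3)[OF cH] \<gamma>(3) by (auto intro!: vs_smult_closed[OF W])
    qed simp
    also have "\<dots> = gcls (Suc i) (J (\<lambda>v \<sigma>. \<Sum>c\<in>C (Suc i). d c * \<Gamma>_C (Suc i) c v \<sigma>))"
      by (rule gcls_J_sum[OF i' cyc, symmetric])
    also have "J (\<lambda>v \<sigma>. \<Sum>c\<in>C (Suc i). d c * \<Gamma>_C (Suc i) c v \<sigma>) = J (\<Gamma> (Suc i) b)"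
      by (rule J_cong) (simp add: d(2))
    finally show ?thesis .
  qed
  moreover have "\<gamma> (h i b) = gcls (Suc i) (J (\<Gamma> i b))" if b: "b \<in> B_A i" for b
    using \<gamma>(3) C_contains[OF i b] by (simp add: J_iota)
  ultimately have "compatible (Suc i) \<gamma>" using \<gamma> by (auto simp: compatible_def)
  then show ?thesis by blast
qed

text \<open>The construction provides no basis at the last stage, and only the entering square makes
  a demand. The images of \<open>B_A\<close> are independent because \<open>A\<close> meets the
  kernel of the structure map trivially.\<close>

lemma compatible_last:
  assumes i: "1 \<le> i" "Suc i = N"
  shows "\<exists>\<gamma>. compatible N \<gamma>"
proof -
  have i0: "i \<in> {1..<N}" and i1: "i \<in> {1..N}" and i': "N \<in> {1..N}" using i by auto
  have V: "vspace (H i)" by (rule vectorspace_H1[OF i1])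
  have W: "vspace (H N)" by (rule vectorspace_H1[OF i'])
  interpret W: vectorspace class_ring "H N" by (rule W)
  have hl: "linmap (H i) (H N) (h i)" using linear_H1_map[OF i0] i(2) by simp
  note h' = linear_mapD[OF hl]
  note Ab = basisD[OF V A_subspace[OF i0] basis_A[OF i0]]
  note As = vs_subspaceD[OF V A_subspace[OF i0]]
  let ?t = "\<lambda>b. gcls N (J (\<Gamma> i b))"
  obtain \<gamma> where \<gamma>: "linmap (H N) (G N) \<gamma>"
    "\<forall>y\<in>carrier (H N). (y, \<gamma> y) \<in> connecting_at N" "\<forall>b\<in>B_A i. \<gamma> (h i b) = ?t b"
  proof (rule select[OF i', of "B_A i" "h i" ?t])
    show "(h i b, ?t b) \<in> connecting_at N" if "b \<in> B_A i" for b
    proof -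
      have "realizes i (rep i b) (\<Gamma> i b) b" using basis_realizes[of i b] i that by simp
      from realizes_step[OF i0 this] have "realizes N (rep i b) (\<Gamma> i b) (h i b)" by (simp add: i(2))
      then show ?thesis by (rule realizes_connecting[OF i'])
    qed
    show "\<forall>c\<in>T. a c = 0" if T: "finite T" "T \<subseteq> B_A i" and 0: "(\<Oplus>\<^bsub>H N\<^esub>c\<in>T. a c \<odot>\<^bsub>H N\<^esub> h i c) = \<zero>\<^bsub>H N\<^esub>" for T a
    proof -
      have TV: "c \<in> carrier (H i)" if "c \<in> T" for c using that T(2) Ab(1) As(1) by auto
      let ?s = "\<Oplus>\<^bsub>H i\<^esub>c\<in>T. a c \<odot>\<^bsub>H i\<^esub> c"
      have "h i ?s = (\<Oplus>\<^bsub>H N\<^esub>c\<in>T. h i (a c \<odot>\<^bsub>H i\<^esub> c))"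
        by (rule linear_map_finsum[OF hl]) (rule vs_smult_closed[OF V TV])
      also have "\<dots> = (\<Oplus>\<^bsub>H N\<^esub>c\<in>T. a c \<odot>\<^bsub>H N\<^esub> h i c)"
        by (rule W.finsum_cong') (auto simp: h'(5)[OF TV] intro!: vs_smult_closed[OF W] h'(3)[OF TV])
      finally have "h i ?s = \<zero>\<^bsub>H N\<^esub>" using 0 by simp
      moreover have sA: "?s \<in> A i" by (rule Ab(4)[OF T(2)])
      ultimately have "?s \<in> ker_H1_map i" using As(1) i(2) by (auto simp: ker_iff)
      then have "?s = \<zero>\<^bsub>H i\<^esub>" using A_inter[OF i0] sA by blast
      then show ?thesis by (rule Ab(3)[OF T])
    qed
  qed
  then have "compatible N \<gamma>" using i by (auto simp: compatible_def)
  then show ?thesis by blast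
qed

lemma compatible_exists:
  assumes "i \<in> {1..N}"
  shows "\<exists>\<gamma>. compatible i \<gamma>"
proof (cases "i = 1")
  case True
  then show ?thesis using compatible_1 assms by simp
next
  case False
  then obtain j where j: "i = Suc j" "1 \<le> j" using assms by (cases i) auto
  show ?thesis
  proof (cases "i = N")
    case True
    then show ?thesis using compatible_last[of j] j by simp
  next
    case False
    then show ?thesis using compatible_middle[of j] j assms by simp
  qed
qed

text \<open>At the next parameter the cycle of \<open>b\<close> bounds over every edge, so \<Gamma>
  can be corrected by \<open>E\<close> of \<alpha> to a cycle family. \<open>J\<close> does not see
  the correction, hence gluing \<open>\<psi> i b\<close> gives the class of
  \<open>J (\<Gamma> i b)\<close>.\<close>

lemma psi_ker_class:
  assumes i: "i \<in> {1..<N}" and b: "b \<in> B_ker i"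
  obtains u where "u \<in> covered_complex.cycle_fams ord \<V> (R_local (Suc i)) 0 (int n)"
    "\<psi> i b = cls0_at (Suc i) u" "J u = J (\<Gamma> i b)"
proof -
  have i': "Suc i \<in> {1..N}" and i1: "i \<in> {1..N}" using i by auto
  interpret t: covered_complex P ord \<V> orient "global (Suc i)" "R_local (Suc i)"
    by (rule complex_at[OF i'])
  have r: "realizes i (rep i b) (\<Gamma> i b) b" using basis_realizes[of i b] i b by simp
  have lift: "lifting_at (Suc i) (rep i b) (\<Gamma> i b)" using realizes_step[OF i r] by (simp add: realizes_def)
  let ?a = "\<alpha> (Suc i) b"
  have a: "?a \<in> t.chain_fams 1 (int n)" and bd: "bd_fam (Suc i) 1 (int n) ?a = \<kappa> (rep i b)"
    using \<alpha>[OF i b] by (simp_all add: carrier_C_fam[OF i'])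
  have Da: "D (?a e) = rep i b e" if "e \<in> edges" for e
    using that fun_cong[OF bd, of e]
    by (simp add: bd_fam_eq[OF i' a] \<kappa>_def dsum_map_def)
  define u where "u = \<Gamma> i b - E ?a"
  have gamma: "\<Gamma> i b \<in> t.chain_fams 0 (int n)" using lift by (simp add: t.lifting_def)
  have uc: "u \<in> t.chain_fams 0 (int n)"
    unfolding u_def by (rule t.chain_fams_diff[OF gamma t.E_chain_fams[OF a]])
  have "E (\<lambda>e. D (?a e)) = E (rep i b)" by (rule E_cong) (rule Da)
  then have "D (u v) = 0" if "v \<in> verts" for v
    using lift that by (simp add: u_def bd_diff D_E t.lifting_def)
  then have u: "u \<in> t.cycle_fams 0 (int n)" using uc by (simp add: t.cycle_fams_iff)
  let ?C = "C_fam (Suc i) 0 (int n) :: ('k, _) module"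
  have eC: "e_map (Suc i) (int n) ?a \<in> carrier ?C"
    using t.E_chain_fams[OF a] by (simp add: e_map_eq[OF i' a] carrier_C_fam[OF i'] t.chain_fams_def)
  let ?w = "\<ominus>\<^bsub>?C\<^esub> e_map (Suc i) (int n) ?a \<oplus>\<^bsub>?C\<^esub> \<iota> (\<Gamma> i b)"
  \<comment> \<open>The element formed in the record \<open>C_fam\<close> and the plain family
    \<open>u\<close> agree at the vertices, which is all that classes depend on.\<close>
  have "?w v = u v" if "v \<in> verts" for v
    using that unfolding vs_minus[OF vectorspace_C_fam[OF i'] eC]
    by (simp add: C_fam_eq[OF i'] e_map_eq[OF i' a] \<iota>_def dsum_map_def
        u_def fun_eq_iff)
  then have "cls_at (Suc i) 0 (int n) ?w = cls_at (Suc i) 0 (int n) u" by (rule t.cls_cong)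
  then have "\<psi> i b = cls0_at (Suc i) u"
    unfolding \<psi>_ker[OF i b] H0_class_eq[OF i'] t.cls0_def by simp
  moreover have "J u = J (\<Gamma> i b)" by (simp add: u_def J_diff J_E)
  ultimately show thesis by (rule that[OF u])
qed

lemma linear_glue_at: "i \<in> {1..N} \<Longrightarrow> linmap (H0 i (int n)) (G i) (glue_at i)"
  unfolding H0_eq global_space_def by (rule covered_complex.linear_glue[OF complex_at])

text \<open>Both sides are linear in \<open>y\<close>, so the two bases suffice. On
  \<open>B_A\<close> the first summand vanishes and the second is given by the clause for the
  entering square; on \<open>B_ker\<close> the second vanishes and the first is computed by
  \<open>psi_ker_class\<close>.\<close>

lemma compatible_step:
  assumes i: "i \<in> {1..<N}" and \<gamma>: "compatible i \<gamma>" and \<gamma>': "compatible (Suc i) \<gamma>'"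
    and y: "y \<in> carrier (H i)"
  shows "glue_at (Suc i) (\<psi> i y) \<oplus>\<^bsub>G (Suc i)\<^esub> \<gamma>' (h i y) = global_map P i (\<gamma> y)"
proof -
  have i': "Suc i \<in> {1..N}" and i1: "i \<in> {1..N}" using i by auto
  interpret s: covered_complex P ord \<V> orient "global i" "R_local i"
    by (rule complex_at[OF i1])
  interpret t: covered_complex P ord \<V> orient "global (Suc i)" "R_local (Suc i)"
    by (rule complex_at[OF i'])
  have W: "vspace (G (Suc i))" by (rule vectorspace_global[OF i'])
  interpret W: vectorspace class_ring "G (Suc i)" by (rule W)
  have V: "vspace (H i)" by (rule vectorspace_H1[OF i1])
  note glue = linear_glue_at[OF i']
  have l: "linmap (H i) (G i) \<gamma>" "linmap (H (Suc i)) (G (Suc i)) \<gamma>'"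
    using \<gamma> \<gamma>' by (auto simp: compatible_def)
  have left: "linmap (H i) (G (Suc i)) (\<lambda>y. glue_at (Suc i) (\<psi> i y) \<oplus>\<^bsub>G (Suc i)\<^esub> \<gamma>' (h i y))"
    by (intro linear_map_add linear_map_compose[OF \<psi>_linear[OF i] glue] linear_map_compose[OF linear_H1_map[OF i] l(2)])
  have right: "linmap (H i) (G (Suc i)) (\<lambda>y. global_map P i (\<gamma> y))"
    by (rule linear_map_compose[OF l(1) linear_global_map[OF i]])
  show ?thesis
  proof (rule linear_map_eq_on_sum[OF left right A_subspace[OF i] basis_A[OF i] subspace_ker[OF i] basis_ker[OF i]
        A_sum[OF i] _ y])
    fix b assume b: "b \<in> B_A i \<union> B_ker i"
    have "realizes i (rep i b) (\<Gamma> i b) b" using basis_realizes[of i b] i b by simp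
    then have cyc: "J (\<Gamma> i b) \<in> cycles ord (global i) (int n)" using s.lifting_J by (auto simp: realizes_def)
    have "\<gamma> b = gcls i (J (\<Gamma> i b))" using \<gamma> i b by (simp add: compatible_def)
    then have right_b: "global_map P i (\<gamma> b) = gcls (Suc i) (J (\<Gamma> i b))"
      using global_map_class[OF i cyc] by simp
    have gc: "gcls (Suc i) (J (\<Gamma> i b)) \<in> carrier (G (Suc i))"
      using linear_mapD(3)[OF right, of b] right_b b basisD(1)[OF V A_subspace[OF i] basis_A[OF i]]
        basisD(1)[OF V subspace_ker[OF i] basis_ker[OF i]] vs_subspaceD(1)[OF V A_subspace[OF i]]
        vs_subspaceD(1)[OF V subspace_ker[OF i]] by auto
    show "glue_at (Suc i) (\<psi> i b) \<oplus>\<^bsub>G (Suc i)\<^esub> \<gamma>' (h i b) = global_map P i (\<gamma> b)"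
    proof (cases "b \<in> B_A i")
      case True
      then have "\<psi> i b = \<zero>\<^bsub>H0 (Suc i) (int n)\<^esub>"
        using \<psi>_A[OF i] basisD(1)[OF V A_subspace[OF i] basis_A[OF i]] by auto
      then have "glue_at (Suc i) (\<psi> i b) = \<zero>\<^bsub>G (Suc i)\<^esub>" using linear_mapD(6)[OF glue] by simp
      moreover have "\<gamma>' (h i b) = gcls (Suc i) (J (\<Gamma> i b))" using \<gamma>' True i by (simp add: compatible_def)
      ultimately show ?thesis using right_b gc by simp
    next
      case False
      then have bk: "b \<in> B_ker i" using b by simp
      then have "h i b = \<zero>\<^bsub>H (Suc i)\<^esub>"
        using basisD(1)[OF V subspace_ker[OF i] basis_ker[OF i]] ker_iff by blast
      then have "\<gamma>' (h i b) = \<zero>\<^bsub>G (Suc i)\<^esub>" using linear_mapD(6)[OF l(2)] by simp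
      moreover obtain u where u: "u \<in> t.cycle_fams 0 (int n)" "\<psi> i b = cls0_at (Suc i) u" "J u = J (\<Gamma> i b)"
        by (rule psi_ker_class[OF i bk])
      ultimately show ?thesis using right_b gc by (simp add: t.glue_cls0)
    qed
  qed
qed

theorem persistence_iso:
  "isomorphic_persistence_modules N local_space (\<Psi> \<psi>) (global_space P :: nat \<Rightarrow> ('k, _) module) (global_map P)"
proof -
  \<comment> \<open>The choices at different stages are made separately: \<open>compatible\<close>
    refers to the chains \<Gamma>, never to another \<gamma>.\<close>
  define \<gamma> where "\<gamma> i = (SOME g. compatible i g)" for i
  have \<gamma>: "compatible i (\<gamma> i)" if "i \<in> {1..N}" for i
    unfolding \<gamma>_def using compatible_exists[OF that] by (rule someI_ex)
  define s :: 'k where "s = (- 1) ^ (n + 1)"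
  have ss: "s * s = 1" by (simp add: s_def flip: power_mult_distrib)
  have \<Psi>_eq: "\<Psi> \<psi> i (X, y) = (H0_map i (int n) X \<oplus>\<^bsub>H0 (Suc i) (int n)\<^esub> s \<odot>\<^bsub>H0 (Suc i) (int n)\<^esub> \<psi> i y, h i y)"
    for i X y by (simp only: \<Psi>_def s_def prod.case)
  define \<Phi> where "\<Phi> i = (\<lambda>(X, y). glue_at i X \<oplus>\<^bsub>G i\<^esub> (s \<odot>\<^bsub>G i\<^esub> \<gamma> i y))" for i
  have iso: "linmap (local_space i) (G i) (\<Phi> i)"
    "bij_betw (\<Phi> i) (carrier (local_space i)) (carrier (G i))" if i: "i \<in> {1..N}" for i
  proof -
    interpret c: covered_complex P ord \<V> orient "global i" "R_local i" by (rule complex_at[OF i])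
    have "linmap (c.HH1 (int n - 1)) (homology ord (global i) (int n)) (\<gamma> i)"
      "\<And>y. y \<in> carrier (c.HH1 (int n - 1)) \<Longrightarrow> (y, \<gamma> i y) \<in> connecting_at i"
      using \<gamma>[OF i] by (simp_all add: compatible_def H1_eq global_space_def)
    from c.splitting_iso[OF this ss]
    show "linmap (local_space i) (G i) (\<Phi> i)"
      "bij_betw (\<Phi> i) (carrier (local_space i)) (carrier (G i))"
      unfolding local_space_def \<Phi>_def H1_eq H0_eq global_space_def by auto
  qed
  have loc: "linmap (local_space i) (local_space (Suc i)) (\<Psi> \<psi> i)" if i: "i \<in> {1..<N}" for i
  proof -
    have V: "vspace (local_space i :: ('k, _) module)"
      "vspace (local_space (Suc i) :: ('k, _) module)"
      using iso(1)[of i] iso(1)[of "Suc i"] linear_mapD(1) i by auto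
    note f = linear_mapD[OF linear_map_smult[OF \<psi>_linear[OF i], of s]]
    note g = linear_mapD[OF linear_H0_map[OF i, where ?'k = 'k]]
    note k = linear_mapD[OF linear_H1_map[OF i, where ?'k = 'k]]
    interpret W: vectorspace class_ring "H0 (Suc i) (int n) :: ('k, _) module" by (rule f(2))
    show ?thesis
    proof (rule linear_mapI[OF V])
      fix p :: "('p, 'k) class_family set \<times> ('p, 'k) class_family" and a
      assume p: "p \<in> carrier (local_space i)"
      show "\<Psi> \<psi> i p \<in> carrier (local_space (Suc i))"
        using p f(3) g(3) k(3) by (auto simp: local_space_def \<Psi>_eq)
      show "\<Psi> \<psi> i (a \<odot>\<^bsub>local_space i\<^esub> p) = a \<odot>\<^bsub>local_space (Suc i)\<^esub> \<Psi> \<psi> i p"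
        using p by (auto simp: local_space_def \<Psi>_eq f(3,5) g(3,5) k(5) vs_smult_rdistr[OF f(2)])
      fix q :: "('p, 'k) class_family set \<times> ('p, 'k) class_family"
      assume q: "q \<in> carrier (local_space i)"
      show "\<Psi> \<psi> i (p \<oplus>\<^bsub>local_space i\<^esub> q) = \<Psi> \<psi> i p \<oplus>\<^bsub>local_space (Suc i)\<^esub> \<Psi> \<psi> i q"
        using p q by (auto simp: local_space_def \<Psi>_eq f(3,4) g(3,4) k(4) W.a_ac)
    qed
  qed
  have comm: "\<Phi> (Suc i) (\<Psi> \<psi> i p) = global_map P i (\<Phi> i p)" if i: "i \<in> {1..<N}" and p: "p \<in> carrier (local_space i)" for i p
  proof -
    have i': "Suc i \<in> {1..N}" and i1: "i \<in> {1..N}" using i by auto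
    obtain X y where Xy: "p = (X, y)" "X \<in> carrier (H0 i (int n))" "y \<in> carrier (H i)"
      using p by (auto simp: local_space_def)
    have W: "vspace (G (Suc i))" by (rule vectorspace_global[OF i'])
    interpret W: vectorspace class_ring "G (Suc i)" by (rule W)
    note gl' = linear_mapD[OF linear_glue_at[OF i']] and gl = linear_mapD[OF linear_glue_at[OF i1]]
    note gm = linear_mapD[OF linear_global_map[OF i, where ?'k = 'k]]
    have "linmap (H i) (G i) (\<gamma> i)" using \<gamma>[OF i1] by (simp add: compatible_def)
    note g = linear_mapD[OF this]
    have "linmap (H (Suc i)) (G (Suc i)) (\<gamma> (Suc i))" using \<gamma>[OF i'] by (simp add: compatible_def)
    note g' = linear_mapD[OF this]
    note h0 = linear_mapD[OF linear_H0_map[OF i, where ?'k = 'k]]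
    note h1 = linear_mapD[OF linear_H1_map[OF i, where ?'k = 'k]]
    note ps = linear_mapD[OF \<psi>_linear[OF i]]
    have c: "H0_map i (int n) X \<in> carrier (H0 (Suc i) (int n))" "\<psi> i y \<in> carrier (H0 (Suc i) (int n))"
      "h i y \<in> carrier (H (Suc i))" "s \<odot>\<^bsub>H0 (Suc i) (int n)\<^esub> \<psi> i y \<in> carrier (H0 (Suc i) (int n))"
      using h0(3) ps(3) h1(3) Xy vs_smult_closed[OF gl'(1)] by auto
    note c' = gl'(3)[OF c(1)] gl'(3)[OF c(2)] g'(3)[OF c(3)]
    have "\<Phi> (Suc i) (\<Psi> \<psi> i p) =
        (glue_at (Suc i) (H0_map i (int n) X) \<oplus>\<^bsub>G (Suc i)\<^esub> s \<odot>\<^bsub>G (Suc i)\<^esub> glue_at (Suc i) (\<psi> i y))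
          \<oplus>\<^bsub>G (Suc i)\<^esub> s \<odot>\<^bsub>G (Suc i)\<^esub> \<gamma> (Suc i) (h i y)"
      using c by (simp add: \<Phi>_def \<Psi>_eq Xy(1) gl'(4,5))
    \<comment> \<open>The same sign stands in \<open>\<Psi>\<close> and in \<open>\<Phi>\<close>, so
      it factors out and leaves the left-hand side of \<open>compatible_step\<close>.\<close>
    also have "\<dots> = glue_at (Suc i) (H0_map i (int n) X) \<oplus>\<^bsub>G (Suc i)\<^esub>
        s \<odot>\<^bsub>G (Suc i)\<^esub> (glue_at (Suc i) (\<psi> i y) \<oplus>\<^bsub>G (Suc i)\<^esub> \<gamma> (Suc i) (h i y))"
      using c' vs_smult_closed[OF W] by (simp add: vs_smult_rdistr[OF W] W.a_assoc)
    also have "\<dots> = global_map P i (glue_at i X) \<oplus>\<^bsub>G (Suc i)\<^esub> s \<odot>\<^bsub>G (Suc i)\<^esub> global_map P i (\<gamma> i y)"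
      by (simp only: glue_step[OF i Xy(2)] compatible_step[OF i \<gamma>[OF i1] \<gamma>[OF i'] Xy(3)])
    also have "\<dots> = global_map P i (\<Phi> i p)"
      using gl(3)[OF Xy(2)] g(3)[OF Xy(3)] vs_smult_closed[OF g(2)]
      by (simp add: \<Phi>_def Xy(1) gm(4,5))
    finally show ?thesis .
  qed
  show ?thesis
    unfolding isomorphic_persistence_modules_def persistence_module_def
    using iso loc comm linear_global_map[where ?'k = 'k] linear_mapD(1)[OF iso(1)] linear_mapD(2)[OF iso(1)]
    by (intro conjI exI[of _ \<Phi>] ballI) simp_all
qed

end

theorem theorem1:
  fixes P :: "(real ^ 'm) set"
    and \<V> :: "(real ^ 'm) set set"
    and ord :: "real ^ 'm \<Rightarrow> nat"
    and orient :: "(real ^ 'm) set set \<Rightarrow> (real ^ 'm) set"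
    and \<epsilon> :: "nat \<Rightarrow> real"
    and n N :: nat
    and A B_A B_ker C :: "nat \<Rightarrow> (real ^ 'm, 'k::field) class_family set"
    and rep \<Gamma> rep_C \<Gamma>_C \<alpha> ::
      "nat \<Rightarrow> (real ^ 'm, 'k) class_family \<Rightarrow> (real ^ 'm, 'k) chain_family"
    and \<psi> :: "nat \<Rightarrow> (real ^ 'm, 'k) class_family \<Rightarrow> (real ^ 'm, 'k) class_family set"
  assumes "finite P"
    and "finite \<V>" and "{} \<notin> \<V>" and "\<Union>\<V> = P"
    and "has_dimension (nerve \<V>) 1"
    and "inj_on ord P"
    and "\<And>e. e \<in> simplices (nerve \<V>) 1 \<Longrightarrow> orient e \<in> e"
    and "1 \<le> N" and "0 < \<epsilon> 1"
    and "\<And>i. i \<in> {1..<N} \<Longrightarrow> \<epsilon> i < \<epsilon> (Suc i)"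
    and "ereal (\<epsilon> N) < eps_star P \<V>"
    and "inductive_construction \<V> ord orient \<epsilon> n N A B_A B_ker rep \<Gamma> C rep_C \<Gamma>_C \<alpha> \<psi>"
  shows "isomorphic_persistence_modules N
           (covered_rips.local_space \<V> ord orient \<epsilon> n) (covered_rips.\<Psi> \<V> ord orient \<epsilon> n \<psi>)
           (covered_rips.global_space ord \<epsilon> n P) (covered_rips.global_map ord \<epsilon> n P)"
proof -
  interpret inductive_construction \<V> ord orient \<epsilon> n N A B_A B_ker rep \<Gamma> C rep_C \<Gamma>_C \<alpha> \<psi> by fact
  interpret rips_construction P ord \<V> orient \<epsilon> n N A B_A B_ker rep \<Gamma> C rep_C \<Gamma>_C \<alpha> \<psi>
    by unfold_locales (use assms in auto)
  show ?thesis by (rule persistence_iso)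
qed

end
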